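(* For every fixed $m\ge 1$ there is an algorithm that, given a functional vset-automaton $A$, a sequence $S=\zeta^{=}_{x_1,y_1}\cdots\zeta^{=}_{x_m,y_m}$ of string equality selections over $\mathsf{Vars}(A)$ (i.e., $x_i,y_i\in\mathsf{Vars}(A)$), and a string $\mathbf{s}\in\Sigma^*$, enumerates $[\![S A]\!](\mathbf{s})$ (each tuple exactly once) with polynomial delay.
   Context: Strings and spans. $\Sigma$ is a finite alphabet with $|\Sigma|\ge 2$. A span of $\mathbf{s}=\sigma_1\cdots\sigma_\ell\in\Sigma^*$ is an expression $[i,j\rangle$ with $1\le i\le j\le \ell+1$; $\mathbf{s}_{[i,j\rangle}=\sigma_i\cdots\sigma_{j-1}$. $\mathsf{Vars}$ is an infinite set of variables, disjoint from $\Sigma$. For finite $V\subset\mathsf{Vars}$, a $(V,\mathbf{s})$-tuple is a function from $V$ to the spans of $\mathbf{s}$. Ref-words. For finite $V\subset\mathsf{Vars}$ let $\Gamma_V=\{x{\vdash},\ {\dashv}x \mid x\in V\}$, disjoint from $\Sigma$. A word $\mathbf{r}\in(\Sigma\cup\Gamma_V)^*$ is valid for $V$ if for each $x\in V$ it contains exactly one $x{\vdash}$ and exactly one ${\dashv}x$, the former to the left of the latter. $\mathsf{clr}$ is the morphism erasing $\Gamma_V$ and fixing $\Sigma$. A valid $\mathbf{r}$ with $\mathsf{clr}(\mathbf{r})=\mathbf{s}$ defines the $(V,\mathbf{s})$-tuple $\mu^{\mathbf{r}}$: writing $\mathbf{r}=\mathbf{r}'_x\, x{\vdash}\,\mathbf{r}_x\,{\dashv}x\,\mathbf{r}''_x$,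 $\mu^{\mathbf{r}}(x)=[i,j\rangle$ with $i=|\mathsf{clr}(\mathbf{r}'_x)|+1$, $j=i+|\mathsf{clr}(\mathbf{r}_x)|$. Vset-automata. A vset-automaton is a tuple $A=(V,Q,q_0,q_f,\delta)$ with $\mathsf{Vars}(A)=V\subset\mathsf{Vars}$ finite, $Q$ a finite set of states, $q_0,q_f\in Q$ initial and final states, and $\delta\colon Q\times(\Sigma\cup\{\epsilon\}\cup\Gamma_V)\to 2^Q$. $\mathcal{R}(A)$ is the set of words over $\Sigma\cup\Gamma_V$ accepted by $A$ viewed as an $\epsilon$-NFA. $[\![A]\!](\mathbf{s})=\{\mu^{\mathbf{r}}\mid\mathbf{r}\in\mathcal{R}(A)\text{ valid for }V,\ \mathsf{clr}(\mathbf{r})=\mathbf{s}\}$. $A$ is functional if every word in $\mathcal{R}(A)$ is valid for $V$. String equality selection: $[\![\zeta^{=}_{x_1,y_1}\cdots\zeta^{=}_{x_m,y_m}A]\!](\mathbf{s})$ is the set of all $\mu\in[\![A]\!](\mathbf{s})$ with $\mathbf{s}_{\mu(x_i)}=\mathbf{s}_{\mu(y_i)}$ for all $1\le i\le m$. Polynomial delay: the time between every two consecutive answers produced is polynomial in the size of the input $(A,S,\mathbf{s})$. *)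

theory Defs
  imports "HOL-Computational_Algebra.Polynomial"
begin

section \<open>Spans, ref-words and vset-automata\<close>

text \<open>The letters of a ref-word: a terminal, or one of the two markers of a variable.\<close>

datatype ('a, 'v) letter = Sym 'a | Open 'v | Close 'v

definition letters :: "'v set \<Rightarrow> ('a, 'v) letter set" where
  "letters V = range Sym \<union> Open ` V \<union> Close ` V"

fun clr :: "('a, 'v) letter list \<Rightarrow> 'a list" where
  "clr [] = []"
| "clr (Sym a # r) = a # clr r"
| "clr (Open x # r) = clr r"
| "clr (Close x # r) = clr r"

definition valid :: "'v set \<Rightarrow> ('a, 'v) letter list \<Rightarrow> bool" where
  "valid V r \<longleftrightarrow> set r \<subseteq> letters V \<and>
     (\<forall>x\<in>V. count_list r (Open x) = 1 \<and> count_list r (Close x) = 1 \<and>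
            (\<exists>u v w. r = u @ Open x # v @ Close x # w))"

text \<open>The pair \<open>(i, j)\<close> is the span \<open>[i,j\<rangle>\<close>; positions are counted from 1.\<close>

type_synonym span = "nat \<times> nat"

definition substring :: "'a list \<Rightarrow> span \<Rightarrow> 'a list" where
  "substring s = (\<lambda>(i, j). take (j - i) (drop (i - 1) s))"

text \<open>A \<open>(V,s)\<close>-tuple is a partial map with domain \<open>V\<close>. For valid \<open>r\<close> the following relation
  holds for exactly one \<open>\<mu>\<close>.\<close>

type_synonym 'v tuple = "'v \<Rightarrow> span option"

definition tuple_of :: "'v set \<Rightarrow> ('a, 'v) letter list \<Rightarrow> 'v tuple \<Rightarrow> bool" where
  "tuple_of V r \<mu> \<longleftrightarrow> dom \<mu> = V \<and>
     (\<forall>x\<in>V. \<exists>u v w i j. r = u @ Open x # v @ Close x # w \<and>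
        i = length (clr u) + 1 \<and> j = i + length (clr v) \<and> \<mu> x = Some (i, j))"

text \<open>The argument \<open>None\<close> of the transition function stands for \<open>\<epsilon>\<close>.\<close>

record ('a, 'v, 'q) automaton =
  Vars :: "'v set"
  states :: "'q set"
  init :: 'q
  final :: 'q
  delta :: "'q \<Rightarrow> ('a, 'v) letter option \<Rightarrow> 'q set"

definition labels :: "'v set \<Rightarrow> ('a, 'v) letter option set" where
  "labels V = insert None (Some ` letters V)"

definition vset_automaton :: "('a, 'v, 'q) automaton \<Rightarrow> bool" where
  "vset_automaton A \<longleftrightarrow> finite (Vars A) \<and> finite (states A) \<and>
     init A \<in> states A \<and> final A \<in> states A \<and>
     (\<forall>p\<in>states A. \<forall>l\<in>labels (Vars A). delta A p l \<subseteq> states A)"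

inductive path :: "('a, 'v, 'q) automaton \<Rightarrow> 'q \<Rightarrow> ('a, 'v) letter list \<Rightarrow> 'q \<Rightarrow> bool"
  for A where
  path_nil: "path A p [] p"
| path_eps: "q \<in> delta A p None \<Longrightarrow> path A q r q' \<Longrightarrow> path A p r q'"
| path_letter: "l \<in> letters (Vars A) \<Longrightarrow> q \<in> delta A p (Some l) \<Longrightarrow> path A q r q' \<Longrightarrow>
    path A p (l # r) q'"

definition ref_language :: "('a, 'v, 'q) automaton \<Rightarrow> ('a, 'v) letter list set" where
  "ref_language A = {r. path A (init A) r (final A)}"

definition functional :: "('a, 'v, 'q) automaton \<Rightarrow> bool" where
  "functional A \<longleftrightarrow> (\<forall>r\<in>ref_language A. valid (Vars A) r)"

definition spanner :: "('a, 'v, 'q) automaton \<Rightarrow> 'a list \<Rightarrow> 'v tuple set" where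
  "spanner A s = {\<mu>. \<exists>r\<in>ref_language A. valid (Vars A) r \<and> clr r = s \<and> tuple_of (Vars A) r \<mu>}"

text \<open>A sequence of string equality selections is given by the list of its pairs
  \<open>(x\<^sub>i, y\<^sub>i)\<close>.\<close>

definition select_eq ::
  "('v \<times> 'v) list \<Rightarrow> ('a, 'v, 'q) automaton \<Rightarrow> 'a list \<Rightarrow> 'v tuple set" where
  "select_eq S A s = {\<mu> \<in> spanner A s.
     \<forall>(x, y)\<in>set S. substring s (the (\<mu> x)) = substring s (the (\<mu> y))}"


section \<open>The machine model\<close>

text \<open>
  Algorithms are programs of the WHILE language of Jones (\<^emph>\<open>Computability and Complexity\<close>):
  imperative programs over binary trees, extended by a command that produces an answer. Constructing
  and destructing a tree takes unit time; this model and Turing machines simulate each other with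
  polynomial overhead. Operations that have to traverse trees (comparing them, writing them to the
  output) are charged for the sizes of these trees. \<open>size\<close> is the number of inner nodes.
\<close>

datatype tree = Nil | Pair tree tree

datatype expr = Var nat | Const tree | Cons expr expr | Hd expr | Tl expr | Equal expr expr

datatype com =
    Skip
  | Assign nat expr
  | Seq com com
  | If expr com com
  | While expr com
  | Emit expr

type_synonym store = "nat \<Rightarrow> tree"

fun head :: "tree \<Rightarrow> tree" where
  "head Nil = Nil"
| "head (Pair a b) = a"

fun tail :: "tree \<Rightarrow> tree" where
  "tail Nil = Nil"
| "tail (Pair a b) = b"

fun eval :: "expr \<Rightarrow> store \<Rightarrow> tree" where
  "eval (Var x) \<sigma> = \<sigma> x"
| "eval (Const d) \<sigma> = d"
| "eval (Cons e f) \<sigma> = Pair (eval e \<sigma>) (eval f \<sigma>)"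
| "eval (Hd e) \<sigma> = head (eval e \<sigma>)"
| "eval (Tl e) \<sigma> = tail (eval e \<sigma>)"
| "eval (Equal e f) \<sigma> = (if eval e \<sigma> = eval f \<sigma> then Pair Nil Nil else Nil)"

fun cost :: "expr \<Rightarrow> store \<Rightarrow> nat" where
  "cost (Var x) \<sigma> = 1"
| "cost (Const d) \<sigma> = 1"
| "cost (Cons e f) \<sigma> = 1 + cost e \<sigma> + cost f \<sigma>"
| "cost (Hd e) \<sigma> = 1 + cost e \<sigma>"
| "cost (Tl e) \<sigma> = 1 + cost e \<sigma>"
| "cost (Equal e f) \<sigma> = 1 + cost e \<sigma> + cost f \<sigma> + size (eval e \<sigma>) + size (eval f \<sigma>)"

text \<open>
  The trace of a terminating run is a list of events: \<open>None\<close> is the passing of one unit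
  of time, \<open>Some d\<close> is the production of the answer \<open>d\<close>. A tree is read as true if it is not
  \<open>Nil\<close>.
\<close>

type_synonym trace = "tree option list"

abbreviation ticks :: "nat \<Rightarrow> trace" where
  "ticks n \<equiv> replicate n None"

inductive exec :: "com \<Rightarrow> store \<Rightarrow> trace \<Rightarrow> store \<Rightarrow> bool" where
  exec_skip: "exec Skip \<sigma> (ticks 1) \<sigma>"
| exec_assign: "exec (Assign x e) \<sigma> (ticks (1 + cost e \<sigma>)) (\<sigma>(x := eval e \<sigma>))"
| exec_seq: "exec c \<sigma> t \<sigma>' \<Longrightarrow> exec c' \<sigma>' t' \<sigma>'' \<Longrightarrow> exec (Seq c c') \<sigma> (t @ t') \<sigma>''"
| exec_if_true: "eval e \<sigma> \<noteq> Nil \<Longrightarrow> exec c \<sigma> t \<sigma>' \<Longrightarrow>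
    exec (If e c c') \<sigma> (ticks (1 + cost e \<sigma>) @ t) \<sigma>'"
| exec_if_false: "eval e \<sigma> = Nil \<Longrightarrow> exec c' \<sigma> t \<sigma>' \<Longrightarrow>
    exec (If e c c') \<sigma> (ticks (1 + cost e \<sigma>) @ t) \<sigma>'"
| exec_while_true: "eval e \<sigma> \<noteq> Nil \<Longrightarrow> exec c \<sigma> t \<sigma>' \<Longrightarrow> exec (While e c) \<sigma>' t' \<sigma>'' \<Longrightarrow>
    exec (While e c) \<sigma> (ticks (1 + cost e \<sigma>) @ t @ t') \<sigma>''"
| exec_while_false: "eval e \<sigma> = Nil \<Longrightarrow> exec (While e c) \<sigma> (ticks (1 + cost e \<sigma>)) \<sigma>"
| exec_emit: "exec (Emit e) \<sigma>
    (ticks (1 + cost e \<sigma> + size (eval e \<sigma>)) @ [Some (eval e \<sigma>)]) \<sigma>"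

lemma exec_deterministic:
  "exec c \<sigma> t \<sigma>' \<Longrightarrow> exec c \<sigma> u \<sigma>'' \<Longrightarrow> u = t \<and> \<sigma>'' = \<sigma>'"
proof (induction arbitrary: u \<sigma>'' rule: exec.induct)
  case (exec_seq c \<sigma> t \<sigma>1 c' t' \<sigma>2)
  from exec_seq.prems show ?case
    by (cases rule: exec.cases) (auto dest: exec_seq.IH)
next
  case (exec_if_true e \<sigma> c t \<sigma>1 c')
  from exec_if_true.prems exec_if_true.hyps show ?case
    by (cases rule: exec.cases) (auto dest: exec_if_true.IH)
next
  case (exec_if_false e \<sigma> c' t \<sigma>1 c)
  from exec_if_false.prems exec_if_false.hyps show ?case
    by (cases rule: exec.cases) (auto dest: exec_if_false.IH)
next
  case (exec_while_true e \<sigma> c t \<sigma>1 t' \<sigma>2)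
  from exec_while_true.prems exec_while_true.hyps show ?case
    by (cases rule: exec.cases) (auto dest!: exec_while_true.IH)
qed (erule exec.cases; simp)+

definition answers :: "trace \<Rightarrow> tree list" where
  "answers t = List.map_filter id t"

text \<open>
  At most \<open>D\<close> units of time pass without an answer. This bounds the time between any two
  consecutive answers and also, as usual for enumeration algorithms, the time before the first
  answer and the time from the last answer to termination.
\<close>

definition delay_le :: "trace \<Rightarrow> nat \<Rightarrow> bool" where
  "delay_le t D \<longleftrightarrow> (\<forall>u k w. t = u @ ticks k @ w \<longrightarrow> k \<le> D)"

text \<open>
  On the input \<open>d\<close>, placed in register 0, the program \<open>c\<close> enumerates \<open>R\<close> without repetitions
  and with delay at most \<open>D\<close>; \<open>code d' x\<close> means that the tree \<open>d'\<close> represents the answer \<open>x\<close>.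
\<close>

definition enumerates :: "com \<Rightarrow> tree \<Rightarrow> (tree \<Rightarrow> 'b \<Rightarrow> bool) \<Rightarrow> 'b set \<Rightarrow> nat \<Rightarrow> bool" where
  "enumerates c d code R D \<longleftrightarrow>
     (\<exists>t \<sigma> xs. exec c ((\<lambda>_. Nil)(0 := d)) t \<sigma> \<and>
        list_all2 code (answers t) xs \<and> distinct xs \<and> set xs = R \<and> delay_le t D)"


section \<open>Representation of inputs and answers\<close>

fun enc_list :: "tree list \<Rightarrow> tree" where
  "enc_list [] = Nil"
| "enc_list (d # ds) = Pair d (enc_list ds)"

text \<open>Binary notation, least significant bit first.\<close>

fun binary :: "nat \<Rightarrow> bool list" where
  "binary n = (if n = 0 then [] else odd n # binary (n div 2))"

declare binary.simps [simp del]

definition enc_nat :: "nat \<Rightarrow> tree" where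
  "enc_nat n = enc_list (map (\<lambda>b. if b then Pair Nil Nil else Nil) (binary n))"

text \<open>
  Alphabet symbols and variables are written as the binary notation of a number assigned to
  them by the functions \<open>lc\<close> and \<open>vc\<close>; states are natural numbers. Sets are
  represented by lists of their elements, without repetitions, in an arbitrary order.
\<close>

fun enc_label ::
  "('a \<Rightarrow> nat) \<Rightarrow> ('v \<Rightarrow> nat) \<Rightarrow> ('a, 'v) letter option \<Rightarrow> tree" where
  "enc_label lc vc None = Nil"
| "enc_label lc vc (Some (Sym a)) = Pair (enc_nat 0) (enc_nat (lc a))"
| "enc_label lc vc (Some (Open x)) = Pair (enc_nat 1) (enc_nat (vc x))"
| "enc_label lc vc (Some (Close x)) = Pair (enc_nat 2) (enc_nat (vc x))"

definition set_code :: "('b \<Rightarrow> tree) \<Rightarrow> tree \<Rightarrow> 'b set \<Rightarrow> bool" where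
  "set_code enc d X \<longleftrightarrow> (\<exists>xs. distinct xs \<and> set xs = X \<and> d = enc_list (map enc xs))"

definition transitions ::
  "('a, 'v, 'q) automaton \<Rightarrow> ('q \<times> ('a, 'v) letter option \<times> 'q) set" where
  "transitions A = {(p, l, q). p \<in> states A \<and> l \<in> labels (Vars A) \<and> q \<in> delta A p l}"

definition automaton_code ::
  "('a \<Rightarrow> nat) \<Rightarrow> ('v \<Rightarrow> nat) \<Rightarrow> tree \<Rightarrow> ('a, 'v, nat) automaton \<Rightarrow> bool" where
  "automaton_code lc vc d A \<longleftrightarrow>
     (\<exists>dV dQ dT. set_code (\<lambda>x. enc_nat (vc x)) dV (Vars A) \<and> set_code enc_nat dQ (states A) \<and>
        set_code (\<lambda>(p, l, q). Pair (enc_nat p) (Pair (enc_label lc vc l) (enc_nat q)))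
          dT (transitions A) \<and>
        d = enc_list [dV, dQ, enc_nat (init A), enc_nat (final A), dT])"

definition input_code ::
  "('a \<Rightarrow> nat) \<Rightarrow> ('v \<Rightarrow> nat) \<Rightarrow> tree \<Rightarrow>
   ('a, 'v, nat) automaton \<Rightarrow> ('v \<times> 'v) list \<Rightarrow> 'a list \<Rightarrow> bool" where
  "input_code lc vc d A S s \<longleftrightarrow>
     (\<exists>dA. automaton_code lc vc dA A \<and>
        d = enc_list [dA,
              enc_list (map (\<lambda>(x, y). Pair (enc_nat (vc x)) (enc_nat (vc y))) S),
              enc_list (map (\<lambda>a. enc_nat (lc a)) s)])"

definition tuple_code :: "('v \<Rightarrow> nat) \<Rightarrow> tree \<Rightarrow> 'v tuple \<Rightarrow> bool" where
  "tuple_code vc d \<mu> \<longleftrightarrow>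
     set_code (\<lambda>(x, i, j). Pair (enc_nat (vc x)) (Pair (enc_nat i) (enc_nat j)))
       d (Map.graph \<mu>)"

text \<open>Every input has a representation, and an answer is determined by its representation.\<close>

lemma set_code_exists: "finite X \<Longrightarrow> \<exists>d. set_code enc d X"
  unfolding set_code_def using finite_distinct_list by blast

lemma input_code_exists:
  fixes A :: "('a::finite, 'v, nat) automaton"
  assumes "vset_automaton A"
  shows "\<exists>d. input_code lc vc d A S s"
proof -
  have fin: "finite (Vars A)" "finite (states A)"
    using assms by (auto simp: vset_automaton_def)
  have "finite (labels (Vars A) :: ('a, 'v) letter option set)"
    using fin by (simp add: labels_def letters_def)
  moreover have "transitions A \<subseteq> states A \<times> labels (Vars A) \<times> states A"
    using assms by (auto simp: transitions_def vset_automaton_def)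
  ultimately have "finite (transitions A)"
    using fin by (meson finite_SigmaI finite_subset)
  then obtain dT where "set_code (\<lambda>(p, l, q). Pair (enc_nat p) (Pair (enc_label lc vc l) (enc_nat q)))
      dT (transitions A)"
    using set_code_exists by blast
  moreover obtain dV where "set_code (\<lambda>x. enc_nat (vc x)) dV (Vars A)"
    using set_code_exists fin by blast
  moreover obtain dQ where "set_code enc_nat dQ (states A)"
    using set_code_exists fin by blast
  ultimately show ?thesis
    unfolding input_code_def automaton_code_def by blast
qed

lemma binary_inject: "binary m = binary n \<Longrightarrow> m = n"
proof (induction m arbitrary: n rule: less_induct)
  case (less m)
  show ?case
  proof (cases "m = 0 \<or> n = 0")
    case True
    then show ?thesis
      using less.prems by (simp add: binary.simps[of m] binary.simps[of n] split: if_splits)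
  next
    case False
    then have "odd m = odd n" "binary (m div 2) = binary (n div 2)"
      using less.prems by (simp_all add: binary.simps[of m] binary.simps[of n])
    moreover have "m div 2 = n div 2"
      using less.IH[of "m div 2"] False calculation(2) by simp
    ultimately show ?thesis
      by (metis even_two_times_div_two odd_two_times_div_two_succ)
  qed
qed

lemma enc_list_inject: "enc_list ds = enc_list es \<Longrightarrow> ds = es"
proof (induction ds arbitrary: es)
  case Nil
  then show ?case by (cases es) auto
next
  case (Cons d ds)
  then show ?case by (cases es) auto
qed

lemma inj_enc_nat: "inj enc_nat"
proof (rule injI)
  fix m n
  assume "enc_nat m = enc_nat n"
  then have "map (\<lambda>b. if b then Pair Nil Nil else Nil) (binary m) =
      map (\<lambda>b. if b then Pair Nil Nil else Nil) (binary n)"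
    unfolding enc_nat_def by (rule enc_list_inject)
  moreover have "inj (\<lambda>b. if b then Pair Nil Nil else Nil)"
    by (auto simp: inj_def)
  ultimately show "m = n"
    by (metis binary_inject inj_map_eq_map)
qed

lemma tuple_code_unique:
  assumes "inj vc" "tuple_code vc d \<mu>" "tuple_code vc d \<nu>"
  shows "\<mu> = \<nu>"
proof -
  let ?enc = "\<lambda>(x, i, j). Pair (enc_nat (vc x)) (Pair (enc_nat i) (enc_nat j))"
  have "inj ?enc"
    using assms(1) inj_enc_nat by (auto simp: inj_def)
  then have "Map.graph \<mu> = Map.graph \<nu>"
    using assms(2,3) enc_list_inject unfolding tuple_code_def set_code_def
    by (metis inj_map_eq_map)
  then have "\<mu> x = Some y \<longleftrightarrow> \<nu> x = Some y" for x y
    by (metis in_graphD in_graphI)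
  then show ?thesis
    by (metis ext not_None_eq)
qed

end

theory Submission
  imports Defs
begin

text \<open>
  All ref-words accepted by a functional automaton are valid. Hence a partial assignment of spans
  extends to a tuple of the spanner iff the final configuration is reachable in the graph whose
  nodes are pairs of a state and a position, where a marker of an assigned variable may only be
  passed at the prescribed position. At most \<open>2m\<close> variables occur in the selections, so all of
  their polynomially many assignments can be tested for the equalities and for being extensible.
  The remaining variables are assigned by depth-first search, which enters extensible nodes only
  and therefore reaches an answer after at most as many steps as there are variables. The answers
  below different nodes are different, as they differ in an assigned variable.

  The subroutines are written in a language of folds over lists that is compiled to the WHILE
  language. Their running time is polynomial as soon as the lists they run through and the trees
  they compare have polynomial size.
\<close>

section \<open>A language of folds\<close>

text \<open>String equality is not a regular condition, so extensibility under the selections cannot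
  be decided by reachability in a graph of configurations. Once the spans of all selected variables
  are fixed, the equalities become facts about the string and only a reachability question remains.
  The price is an exponent of about \<open>4 * m\<close> in the number of assignments tried, which
  is polynomial because \<open>m\<close> is fixed; all of it is paid before the first answer.

  Two features of the machine shape the programs. Time must be bounded for all code executed between
  two answers, yet the search as a whole may run exponentially long. Hence everything except its
  loop is written with folds, whose value and time are given by structural recursion. And the
  machine has no arithmetic: numbers are only incremented and compared for equality, never ordered
  or subtracted. This is why positions are listed in a table together with their successors, why
  factors are cut out by a scan, and why pairs \<open>(i, j)\<close> with \<open>i > j\<close> are
  tried as well and left to the test for extensibility.\<close>

text \<open>
  Programs are evaluated in an environment, a list of trees whose \<open>i\<close>-th element is \<open>Arg i\<close>.
  \<open>Bind\<close> appends one local variable to it, the body of a \<open>Fold\<close> two: the accumulator and the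
  current element. The body of a \<open>Call\<close> sees nothing but its three arguments.
\<close>

datatype prog =
    Arg nat
  | Leaf
  | Node prog prog
  | First prog
  | Rest prog
  | Same prog prog
  | Cond prog prog prog
  | Bind prog prog
  | Fold prog prog prog
  | Call prog prog prog prog

fun spine :: "tree \<Rightarrow> tree list" where
  "spine Nil = []"
| "spine (Pair a b) = a # spine b"

lemma spine_enc_list [simp]: "spine (enc_list xs) = xs"
  by (induction xs) auto

text \<open>Codes of lists exhaust the trees, so a fold can run over any tree without a
  well-formedness condition.\<close>

lemma enc_list_spine [simp]: "enc_list (spine d) = d"
  by (induction d) auto

abbreviation true :: tree where
  "true \<equiv> Pair Nil Nil"

definition truth :: "bool \<Rightarrow> tree" where
  "truth b = (if b then true else Nil)"

lemma truth_simps [simp]: "truth True = true" "truth False = Nil" "truth b = Nil \<longleftrightarrow> \<not> b"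
  by (auto simp: truth_def)

text \<open>The default \<open>Nil\<close> outside the environment agrees with the constant that
  \<open>compile\<close> generates for such an index.\<close>

definition lookup :: "tree list \<Rightarrow> nat \<Rightarrow> tree" where
  "lookup env i = (if i < length env then env ! i else Nil)"

primrec val :: "prog \<Rightarrow> tree list \<Rightarrow> tree" where
  "val (Arg i) env = lookup env i"
| "val Leaf env = Nil"
| "val (Node e f) env = Pair (val e env) (val f env)"
| "val (First e) env = head (val e env)"
| "val (Rest e) env = tail (val e env)"
| "val (Same e f) env = truth (val e env = val f env)"
| "val (Cond e f g) env = (if val e env \<noteq> Nil then val f env else val g env)"
| "val (Bind e f) env = val f (env @ [val e env])"
| "val (Fold e f g) env =
     foldl (\<lambda>a x. val g (env @ [a, x])) (val f env) (spine (val e env))"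
| "val (Call g e1 e2 e3) env = val g [val e1 env, val e2 env, val e3 env]"

text \<open>
  Apart from the structure of the program, its running time depends only on the sizes of
  compared trees and on the lengths of the lists that folds run through.
\<close>

primrec bounded :: "prog \<Rightarrow> tree list \<Rightarrow> nat \<Rightarrow> bool" where
  "bounded (Arg i) env B = True"
| "bounded Leaf env B = True"
| "bounded (Node e f) env B = (bounded e env B \<and> bounded f env B)"
| "bounded (First e) env B = bounded e env B"
| "bounded (Rest e) env B = bounded e env B"
| "bounded (Same e f) env B = (bounded e env B \<and> bounded f env B \<and>
     size (val e env) \<le> B \<and> size (val f env) \<le> B)"
| "bounded (Cond e f g) env B = (bounded e env B \<and>
     (if val e env \<noteq> Nil then bounded f env B else bounded g env B))"
| "bounded (Bind e f) env B = (bounded e env B \<and> bounded f (env @ [val e env]) B)"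
| "bounded (Fold e f g) env B = (bounded e env B \<and> bounded f env B \<and>
     length (spine (val e env)) \<le> B \<and>
     (\<forall>n < length (spine (val e env)). bounded g (env @
        [foldl (\<lambda>a x. val g (env @ [a, x])) (val f env) (take n (spine (val e env))),
         spine (val e env) ! n]) B))"
| "bounded (Call g e1 e2 e3) env B = (bounded e1 env B \<and> bounded e2 env B \<and>
     bounded e3 env B \<and> bounded g [val e1 env, val e2 env, val e3 env] B)"

lemma foldl_take_inv:
  assumes "P a" and "\<And>a x. P a \<Longrightarrow> x \<in> set xs \<Longrightarrow> P (f a x)"
  shows "P (foldl f a (take n xs))"
proof (induction n)
  case 0
  then show ?case using assms(1) by simp
next
  case (Suc n)
  then show ?case
  proof (cases "n < length xs")
    case True
    then show ?thesis using Suc assms(2) by (simp add: take_Suc_conv_app_nth)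
  qed simp
qed

text \<open>\<open>bounded\<close> speaks of the accumulators that actually arise. An invariant
  \<open>P\<close> describes them without computing them; the trivial one suffices whenever the cost
  of the body does not depend on the accumulator.\<close>

lemma bounded_FoldI:
  assumes "bounded e env B" "bounded f env B" "length (spine (val e env)) \<le> B"
    and "P (val f env)"
    and step: "\<And>a x. P a \<Longrightarrow> x \<in> set (spine (val e env)) \<Longrightarrow>
      P (val g (env @ [a, x])) \<and> bounded g (env @ [a, x]) B"
  shows "bounded (Fold e f g) env B"
proof -
  have "P (foldl (\<lambda>a x. val g (env @ [a, x])) (val f env) (take n (spine (val e env))))" for n
    by (rule foldl_take_inv) (use assms(4) step in auto)
  then show ?thesis
    using assms(1-3) step by auto
qed

text \<open>
  The register \<open>k\<close> receives the value, the registers below \<open>k\<close> are preserved, and \<open>\<rho>\<close> lists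
  the registers that hold the environment.
\<close>

primrec compile :: "prog \<Rightarrow> nat list \<Rightarrow> nat \<Rightarrow> com" where
  "compile (Arg i) \<rho> k = Assign k (if i < length \<rho> then Var (\<rho> ! i) else Const Nil)"
| "compile Leaf \<rho> k = Assign k (Const Nil)"
| "compile (Node e f) \<rho> k =
     Seq (compile e \<rho> k) (Seq (compile f \<rho> (k + 1)) (Assign k (Cons (Var k) (Var (k + 1)))))"
| "compile (First e) \<rho> k = Seq (compile e \<rho> k) (Assign k (Hd (Var k)))"
| "compile (Rest e) \<rho> k = Seq (compile e \<rho> k) (Assign k (Tl (Var k)))"
| "compile (Same e f) \<rho> k =
     Seq (compile e \<rho> k) (Seq (compile f \<rho> (k + 1)) (Assign k (Equal (Var k) (Var (k + 1)))))"
| "compile (Cond e f g) \<rho> k =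
     Seq (compile e \<rho> k) (If (Var k) (compile f \<rho> k) (compile g \<rho> k))"
| "compile (Bind e f) \<rho> k =
     Seq (compile e \<rho> k) (Seq (compile f (\<rho> @ [k]) (k + 1)) (Assign k (Var (k + 1))))"
| "compile (Fold e f g) \<rho> k =
     Seq (compile e \<rho> k) (Seq (compile f \<rho> (k + 1))
       (Seq (While (Var k)
               (Seq (Assign (k + 2) (Hd (Var k)))
               (Seq (compile g (\<rho> @ [k + 1, k + 2]) (k + 3))
               (Seq (Assign (k + 1) (Var (k + 3)))
                    (Assign k (Tl (Var k)))))))
            (Assign k (Var (k + 1)))))"
| "compile (Call g e1 e2 e3) \<rho> k =
     Seq (compile e1 \<rho> k) (Seq (compile e2 \<rho> (k + 1)) (Seq (compile e3 \<rho> (k + 2))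
       (Seq (compile g [k, k + 1, k + 2] (k + 3)) (Assign k (Var (k + 3))))))"

text \<open>A pass of the loop costs 10 besides the body: 2 for the test, 3 each for taking head and
  tail, 2 for copying the accumulator. Adding both branches of a \<open>Cond\<close> instead of
  taking the maximum keeps the bound a polynomial in \<open>B\<close>, of a degree that grows with
  the nesting of folds.\<close>

primrec time :: "prog \<Rightarrow> nat \<Rightarrow> nat" where
  "time (Arg i) B = 2"
| "time Leaf B = 2"
| "time (Node e f) B = time e B + (time f B + 4)"
| "time (First e) B = time e B + 3"
| "time (Rest e) B = time e B + 3"
| "time (Same e f) B = time e B + (time f B + (4 + 2 * B))"
| "time (Cond e f g) B = time e B + (2 + time f B + time g B)"
| "time (Bind e f) B = time e B + (time f B + 2)"
| "time (Fold e f g) B = time e B + (time f B + ((2 + B * (10 + time g B)) + 2))"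
| "time (Call g e1 e2 e3) B = time e1 B + (time e2 B + (time e3 B + (time g B + 2)))"

section \<open>Runs without answers and correctness of the compiler\<close>

definition runs :: "com \<Rightarrow> store \<Rightarrow> nat \<Rightarrow> store \<Rightarrow> bool" where
  "runs c \<sigma> T \<sigma>' \<longleftrightarrow> (\<exists>n\<le>T. exec c \<sigma> (ticks n) \<sigma>')"

lemma runs_mono: "runs c \<sigma> T \<sigma>' \<Longrightarrow> T \<le> T' \<Longrightarrow> runs c \<sigma> T' \<sigma>'"
  by (auto simp: runs_def intro: order_trans)

lemma runs_Assign: "1 + cost e \<sigma> \<le> T \<Longrightarrow> runs (Assign x e) \<sigma> T (\<sigma>(x := eval e \<sigma>))"
  unfolding runs_def using exec_assign by blast

lemma runs_Seq:
  assumes "runs c \<sigma> T \<sigma>'" "runs c' \<sigma>' T' \<sigma>''"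
  shows "runs (Seq c c') \<sigma> (T + T') \<sigma>''"
proof -
  obtain n n' where "n \<le> T" "n' \<le> T'" "exec c \<sigma> (ticks n) \<sigma>'" "exec c' \<sigma>' (ticks n') \<sigma>''"
    using assms by (auto simp: runs_def)
  then show ?thesis
    using exec_seq[of c \<sigma> "ticks n" \<sigma>' c' "ticks n'" \<sigma>'']
    by (auto simp: runs_def replicate_add[symmetric] intro: add_mono)
qed

lemma runs_If:
  assumes "runs (if eval e \<sigma> \<noteq> Nil then c else c') \<sigma> T \<sigma>'" "1 + cost e \<sigma> \<le> K"
  shows "runs (If e c c') \<sigma> (K + T) \<sigma>'"
proof -
  obtain n where n: "n \<le> T" "exec (if eval e \<sigma> \<noteq> Nil then c else c') \<sigma> (ticks n) \<sigma>'"
    using assms by (auto simp: runs_def)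
  have "exec (If e c c') \<sigma> (ticks (1 + cost e \<sigma>) @ ticks n) \<sigma>'"
  proof (cases "eval e \<sigma> = Nil")
    case True
    then show ?thesis using n by (intro exec_if_false) auto
  next
    case False
    then show ?thesis using n by (intro exec_if_true) auto
  qed
  then show ?thesis
    using n(1) assms(2) unfolding runs_def replicate_add[symmetric]
    by (intro exI[of _ "1 + cost e \<sigma> + n"]) auto
qed

lemma runs_While_false:
  assumes "eval e \<sigma> = Nil" "1 + cost e \<sigma> \<le> T"
  shows "runs (While e c) \<sigma> T \<sigma>"
  unfolding runs_def using exec_while_false assms by blast

lemma runs_While_true:
  assumes "eval e \<sigma> \<noteq> Nil" "runs c \<sigma> T \<sigma>'" "runs (While e c) \<sigma>' T' \<sigma>''" "1 + cost e \<sigma> \<le> K"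
  shows "runs (While e c) \<sigma> (K + T + T') \<sigma>''"
proof -
  obtain n n' where n: "n \<le> T" "n' \<le> T'" "exec c \<sigma> (ticks n) \<sigma>'"
      "exec (While e c) \<sigma>' (ticks n') \<sigma>''"
    using assms by (auto simp: runs_def)
  then have "exec (While e c) \<sigma> (ticks (1 + cost e \<sigma>) @ ticks n @ ticks n') \<sigma>''"
    using assms by (intro exec_while_true)
  then show ?thesis
    using n(1,2) assms(4) unfolding runs_def replicate_add[symmetric]
    by (intro exI[of _ "1 + cost e \<sigma> + (n + n')"]) auto
qed

lemma lookup_map: "lookup (map \<sigma> \<rho>) i = (if i < length \<rho> then \<sigma> (\<rho> ! i) else Nil)"
  by (simp add: lookup_def)

text \<open>The environment lives below register \<open>k\<close> and all writes go to
  \<open>k\<close> and above, so it survives the evaluation of every subprogram. The registers from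
  \<open>k\<close> on may initially hold leftovers of earlier computations.\<close>

lemma compile_correct:
  assumes "bounded e (map \<sigma> \<rho>) B" "\<And>r. r \<in> set \<rho> \<Longrightarrow> r < k"
  shows "\<exists>\<sigma>'. runs (compile e \<rho> k) \<sigma> (time e B) \<sigma>' \<and> \<sigma>' k = val e (map \<sigma> \<rho>) \<and>
    (\<forall>r<k. \<sigma>' r = \<sigma> r)"
  using assms
proof (induction e arbitrary: \<sigma> \<rho> k)
  case (Arg i)
  show ?case unfolding compile.simps time.simps
    by (intro exI conjI, rule runs_Assign) (auto simp: lookup_map)
next
  case Leaf
  show ?case unfolding compile.simps time.simps
    by (intro exI conjI, rule runs_Assign) auto
next
  case (Node e f)
  from Node.IH(1)[of \<sigma> \<rho> k] Node.prems obtain \<sigma>1 where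
    1: "runs (compile e \<rho> k) \<sigma> (time e B) \<sigma>1" "\<sigma>1 k = val e (map \<sigma> \<rho>)" "\<forall>r<k. \<sigma>1 r = \<sigma> r" by auto
  then have m1: "map \<sigma>1 \<rho> = map \<sigma> \<rho>" using Node.prems by auto
  from Node.IH(2)[of \<sigma>1 \<rho> "k + 1"] Node.prems m1 obtain \<sigma>2 where
    2: "runs (compile f \<rho> (k + 1)) \<sigma>1 (time f B) \<sigma>2" "\<sigma>2 (k + 1) = val f (map \<sigma> \<rho>)"
       "\<forall>r<k + 1. \<sigma>2 r = \<sigma>1 r" by (metis bounded.simps(3) less_SucI Suc_eq_plus1)
  show ?case unfolding compile.simps time.simps
    by (intro exI conjI, rule runs_Seq[OF 1(1)], rule runs_Seq[OF 2(1)], rule runs_Assign)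
      (use 1 2 in auto)
next
  case (First e)
  from First.IH[of \<sigma> \<rho> k] First.prems obtain \<sigma>1 where
    1: "runs (compile e \<rho> k) \<sigma> (time e B) \<sigma>1" "\<sigma>1 k = val e (map \<sigma> \<rho>)" "\<forall>r<k. \<sigma>1 r = \<sigma> r" by auto
  show ?case unfolding compile.simps time.simps
    by (intro exI conjI, rule runs_Seq[OF 1(1)], rule runs_Assign) (use 1 in auto)
next
  case (Rest e)
  from Rest.IH[of \<sigma> \<rho> k] Rest.prems obtain \<sigma>1 where
    1: "runs (compile e \<rho> k) \<sigma> (time e B) \<sigma>1" "\<sigma>1 k = val e (map \<sigma> \<rho>)" "\<forall>r<k. \<sigma>1 r = \<sigma> r" by auto
  show ?case unfolding compile.simps time.simps
    by (intro exI conjI, rule runs_Seq[OF 1(1)], rule runs_Assign) (use 1 in auto)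
next
  case (Same e f)
  from Same.IH(1)[of \<sigma> \<rho> k] Same.prems obtain \<sigma>1 where
    1: "runs (compile e \<rho> k) \<sigma> (time e B) \<sigma>1" "\<sigma>1 k = val e (map \<sigma> \<rho>)" "\<forall>r<k. \<sigma>1 r = \<sigma> r" by auto
  then have m1: "map \<sigma>1 \<rho> = map \<sigma> \<rho>" using Same.prems by auto
  from Same.IH(2)[of \<sigma>1 \<rho> "k + 1"] Same.prems m1 obtain \<sigma>2 where
    2: "runs (compile f \<rho> (k + 1)) \<sigma>1 (time f B) \<sigma>2" "\<sigma>2 (k + 1) = val f (map \<sigma> \<rho>)"
       "\<forall>r<k + 1. \<sigma>2 r = \<sigma>1 r" by (metis bounded.simps(6) less_SucI Suc_eq_plus1)
  show ?case unfolding compile.simps time.simps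
    by (intro exI conjI, rule runs_Seq[OF 1(1)], rule runs_Seq[OF 2(1)], rule runs_Assign)
      (use 1 2 Same.prems in \<open>auto simp: truth_def\<close>)
next
  case (Cond e f g)
  from Cond.IH(1)[of \<sigma> \<rho> k] Cond.prems obtain \<sigma>1 where
    1: "runs (compile e \<rho> k) \<sigma> (time e B) \<sigma>1" "\<sigma>1 k = val e (map \<sigma> \<rho>)" "\<forall>r<k. \<sigma>1 r = \<sigma> r" by auto
  then have m1: "map \<sigma>1 \<rho> = map \<sigma> \<rho>" using Cond.prems by auto
  obtain \<sigma>2 where
    2: "runs (if eval (Var k) \<sigma>1 \<noteq> Nil then compile f \<rho> k else compile g \<rho> k) \<sigma>1
         (time f B + time g B) \<sigma>2"
       "\<sigma>2 k = val (Cond e f g) (map \<sigma> \<rho>)" "\<forall>r<k. \<sigma>2 r = \<sigma>1 r"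
  proof (cases "\<sigma>1 k = Nil")
    case True
    with Cond.IH(3)[of \<sigma>1 \<rho> k] Cond.prems m1 1(2) obtain \<sigma>2 where
      "runs (compile g \<rho> k) \<sigma>1 (time g B) \<sigma>2" "\<sigma>2 k = val g (map \<sigma> \<rho>)" "\<forall>r<k. \<sigma>2 r = \<sigma>1 r"
      by auto
    then show ?thesis
      using True 1(2) by (intro that[of \<sigma>2]) (auto elim: runs_mono)
  next
    case False
    with Cond.IH(2)[of \<sigma>1 \<rho> k] Cond.prems m1 1(2) obtain \<sigma>2 where
      "runs (compile f \<rho> k) \<sigma>1 (time f B) \<sigma>2" "\<sigma>2 k = val f (map \<sigma> \<rho>)" "\<forall>r<k. \<sigma>2 r = \<sigma>1 r"
      by auto
    then show ?thesis
      using False 1(2) by (intro that[of \<sigma>2]) (auto elim: runs_mono)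
  qed
  show ?case unfolding compile.simps time.simps
    by (intro exI conjI, rule runs_Seq[OF 1(1)], subst add.assoc, rule runs_If[OF 2(1)])
      (use 1 2 in auto)
next
  case (Bind e f)
  from Bind.IH(1)[of \<sigma> \<rho> k] Bind.prems obtain \<sigma>1 where
    1: "runs (compile e \<rho> k) \<sigma> (time e B) \<sigma>1" "\<sigma>1 k = val e (map \<sigma> \<rho>)" "\<forall>r<k. \<sigma>1 r = \<sigma> r" by auto
  then have m1: "map \<sigma>1 (\<rho> @ [k]) = map \<sigma> \<rho> @ [val e (map \<sigma> \<rho>)]" using Bind.prems by auto
  obtain \<sigma>2 where
    2: "runs (compile f (\<rho> @ [k]) (k + 1)) \<sigma>1 (time f B) \<sigma>2"
       "\<sigma>2 (k + 1) = val (Bind e f) (map \<sigma> \<rho>)" "\<forall>r<k + 1. \<sigma>2 r = \<sigma>1 r"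
    using Bind.IH(2)[of \<sigma>1 "\<rho> @ [k]" "k + 1", unfolded m1] Bind.prems by (fastforce simp: less_Suc_eq)
  show ?case unfolding compile.simps time.simps
    by (intro exI conjI, rule runs_Seq[OF 1(1)], rule runs_Seq[OF 2(1)], rule runs_Assign)
      (use 1 2 in auto)
next
  case (Fold e f g)
  define env where "env = map \<sigma> \<rho>"
  define h where "h = (\<lambda>a x. val g (env @ [a, x]))"
  from Fold.IH(1)[of \<sigma> \<rho> k] Fold.prems obtain \<sigma>1 where
    1: "runs (compile e \<rho> k) \<sigma> (time e B) \<sigma>1" "\<sigma>1 k = val e env" "\<forall>r<k. \<sigma>1 r = \<sigma> r"
    by (auto simp: env_def)
  then have m1: "map \<sigma>1 \<rho> = env" using Fold.prems by (auto simp: env_def)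
  from Fold.IH(2)[of \<sigma>1 \<rho> "k + 1"] Fold.prems m1 obtain \<sigma>2 where
    2: "runs (compile f \<rho> (k + 1)) \<sigma>1 (time f B) \<sigma>2" "\<sigma>2 (k + 1) = val f env"
       "\<forall>r<k + 1. \<sigma>2 r = \<sigma>1 r" by (metis bounded.simps(9) less_SucI Suc_eq_plus1 env_def)
  let ?body = "Seq (Assign (k + 2) (Hd (Var k)))
               (Seq (compile g (\<rho> @ [k + 1, k + 2]) (k + 3))
               (Seq (Assign (k + 1) (Var (k + 3)))
                    (Assign k (Tl (Var k)))))"
  \<comment> \<open>Register \<open>k\<close> holds the remaining list and \<open>k + 1\<close> the
    accumulator. Stating this for arbitrary \<open>xs\<close> and \<open>a\<close> lets the
    induction go from one pass to the next; the hypothesis on prefixes shifts by one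
    element.\<close>
  have loop: "\<exists>\<sigma>'. runs (While (Var k) ?body) \<sigma>a (2 + length xs * (10 + time g B)) \<sigma>' \<and>
      \<sigma>' (k + 1) = foldl h a xs \<and> (\<forall>r<k. \<sigma>' r = \<sigma> r)"
    if "\<sigma>a k = enc_list xs" "\<sigma>a (k + 1) = a" "\<forall>r<k. \<sigma>a r = \<sigma> r"
      "\<forall>n<length xs. bounded g (env @ [foldl h a (take n xs), xs ! n]) B" for \<sigma>a xs a
    using that
  proof (induction xs arbitrary: \<sigma>a a)
    case Nil
    then show ?case
      by (intro exI[of _ \<sigma>a] conjI runs_While_false) auto
  next
    case (Cons x xs)
    define \<sigma>b where "\<sigma>b = \<sigma>a(k + 2 := x)"
    have "Suc (Suc k) \<notin> set \<rho>" using Fold.prems(2)[of "Suc (Suc k)"] by auto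
    then have mb: "map \<sigma>b (\<rho> @ [k + 1, k + 2]) = env @ [a, x]"
      using Cons.prems Fold.prems(2) by (auto simp: \<sigma>b_def env_def)
    have bb: "bounded g (env @ [a, x]) B" using Cons.prems(4) by auto
    have lt: "r < k + 3" if "r \<in> set (\<rho> @ [k + 1, k + 2])" for r
      using that by (auto dest: Fold.prems(2))
    obtain \<sigma>c where c: "runs (compile g (\<rho> @ [k + 1, k + 2]) (k + 3)) \<sigma>b (time g B) \<sigma>c"
        "\<sigma>c (k + 3) = h a x" "\<forall>r<k + 3. \<sigma>c r = \<sigma>b r"
      using Fold.IH(3)[of \<sigma>b "\<rho> @ [k + 1, k + 2]" "k + 3", unfolded mb, OF bb lt]
      unfolding h_def by auto
    define \<sigma>d where "\<sigma>d = (\<sigma>c(k + 1 := h a x))(k := enc_list xs)"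
    have r1: "runs (Assign (k + 2) (Hd (Var k))) \<sigma>a 3 \<sigma>b"
      using runs_Assign[of "Hd (Var k)" \<sigma>a 3 "k + 2"] Cons.prems(1) by (simp add: \<sigma>b_def)
    have r2: "runs (Assign (k + 1) (Var (k + 3))) \<sigma>c 2 (\<sigma>c(k + 1 := h a x))"
      using runs_Assign[of "Var (k + 3)" \<sigma>c 2 "k + 1"] c(2) by simp
    have r3: "runs (Assign k (Tl (Var k))) (\<sigma>c(k + 1 := h a x)) 3 \<sigma>d"
      using runs_Assign[of "Tl (Var k)" "\<sigma>c(k + 1 := h a x)" 3 k] c(3) Cons.prems(1)
      by (simp add: \<sigma>d_def \<sigma>b_def)
    have body: "runs ?body \<sigma>a (3 + (time g B + (2 + 3))) \<sigma>d"
      by (intro runs_Seq[OF r1] runs_Seq[OF c(1)] runs_Seq[OF r2] r3)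
    have "\<exists>\<sigma>'. runs (While (Var k) ?body) \<sigma>d (2 + length xs * (10 + time g B)) \<sigma>' \<and>
        \<sigma>' (k + 1) = foldl h (h a x) xs \<and> (\<forall>r<k. \<sigma>' r = \<sigma> r)"
    proof (rule Cons.IH)
      show "\<forall>n<length xs. bounded g (env @ [foldl h (h a x) (take n xs), xs ! n]) B"
      proof (intro allI impI)
        fix n assume "n < length xs"
        then show "bounded g (env @ [foldl h (h a x) (take n xs), xs ! n]) B"
          using Cons.prems(4)[rule_format, of "Suc n"] by simp
      qed
    qed (use c Cons.prems in \<open>auto simp: \<sigma>d_def \<sigma>b_def\<close>)
    then obtain \<sigma>' where \<sigma>': "runs (While (Var k) ?body) \<sigma>d (2 + length xs * (10 + time g B)) \<sigma>'"
        "\<sigma>' (k + 1) = foldl h (h a x) xs" "\<forall>r<k. \<sigma>' r = \<sigma> r" by blast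
    have "runs (While (Var k) ?body) \<sigma>a
        (2 + (3 + (time g B + (2 + 3))) + (2 + length xs * (10 + time g B))) \<sigma>'"
      using Cons.prems(1) by (intro runs_While_true[OF _ body \<sigma>'(1)]) auto
    then have "runs (While (Var k) ?body) \<sigma>a (2 + length (x # xs) * (10 + time g B)) \<sigma>'"
      by (rule runs_mono) simp
    then show ?case using \<sigma>' by auto
  qed
  define xs where "xs = spine (val e env)"
  have "\<sigma>2 k = enc_list xs" using 1 2 by (simp add: xs_def)
  then obtain \<sigma>3 where
    3: "runs (While (Var k) ?body) \<sigma>2 (2 + length xs * (10 + time g B)) \<sigma>3"
      "\<sigma>3 (k + 1) = foldl h (val f env) xs" "\<forall>r<k. \<sigma>3 r = \<sigma> r"
    using loop[of \<sigma>2 xs "val f env"] 1 2 Fold.prems(1)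
    by (auto simp: h_def xs_def env_def)
  have len: "length xs \<le> B" using Fold.prems(1) by (simp add: xs_def env_def)
  have 4: "runs (While (Var k) ?body) \<sigma>2 (2 + B * (10 + time g B)) \<sigma>3"
    by (rule runs_mono[OF 3(1)]) (use len in \<open>simp del: distrib_left_numeral add_mult_distrib2\<close>)
  show ?case unfolding compile.simps time.simps
    by (intro exI conjI, rule runs_Seq[OF 1(1)], rule runs_Seq[OF 2(1)], rule runs_Seq[OF 4],
        rule runs_Assign) (use 3 in \<open>auto simp: h_def xs_def env_def\<close>)
next
  case (Call g e1 e2 e3)
  define env where "env = map \<sigma> \<rho>"
  from Call.IH(2)[of \<sigma> \<rho> k] Call.prems obtain \<sigma>1 where
    1: "runs (compile e1 \<rho> k) \<sigma> (time e1 B) \<sigma>1" "\<sigma>1 k = val e1 env" "\<forall>r<k. \<sigma>1 r = \<sigma> r"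
    by (auto simp: env_def)
  then have m1: "map \<sigma>1 \<rho> = env" using Call.prems by (auto simp: env_def)
  from Call.IH(3)[of \<sigma>1 \<rho> "k + 1"] Call.prems m1 obtain \<sigma>2 where
    2: "runs (compile e2 \<rho> (k + 1)) \<sigma>1 (time e2 B) \<sigma>2" "\<sigma>2 (k + 1) = val e2 env"
       "\<forall>r<k + 1. \<sigma>2 r = \<sigma>1 r" by (metis bounded.simps(10) less_SucI Suc_eq_plus1 env_def)
  have "\<sigma>2 r = \<sigma> r" if "r \<in> set \<rho>" for r
    using 1(3) 2(3) Call.prems(2)[OF that] by simp
  then have m2: "map \<sigma>2 \<rho> = env" by (simp add: env_def)
  have lt: "r < k + 2" if "r \<in> set \<rho>" for r
    using Call.prems(2)[OF that] by simp
  from Call.IH(4)[of \<sigma>2 \<rho> "k + 2", OF _ lt] Call.prems m2 obtain \<sigma>3 where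
    3: "runs (compile e3 \<rho> (k + 2)) \<sigma>2 (time e3 B) \<sigma>3" "\<sigma>3 (k + 2) = val e3 env"
       "\<forall>r<k + 2. \<sigma>3 r = \<sigma>2 r" by (auto simp: env_def)
  have m3: "map \<sigma>3 [k, k + 1, k + 2] = [val e1 env, val e2 env, val e3 env]"
    using 1 2 3 by simp
  obtain \<sigma>4 where
    4: "runs (compile g [k, k + 1, k + 2] (k + 3)) \<sigma>3 (time g B) \<sigma>4"
       "\<sigma>4 (k + 3) = val (Call g e1 e2 e3) env" "\<forall>r<k + 3. \<sigma>4 r = \<sigma>3 r"
    using Call.IH(1)[of \<sigma>3 "[k, k + 1, k + 2]" "k + 3", unfolded m3] Call.prems(1)
    by (fastforce simp: env_def)
  show ?case unfolding compile.simps time.simps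
    by (intro exI conjI, rule runs_Seq[OF 1(1)], rule runs_Seq[OF 2(1)], rule runs_Seq[OF 3(1)],
        rule runs_Seq[OF 4(1)], rule runs_Assign) (use 1 2 3 4 in \<open>auto simp: env_def\<close>)
qed

section \<open>Functions bounded by polynomials\<close>

definition poly_bounded :: "(nat \<Rightarrow> nat) \<Rightarrow> bool" where
  "poly_bounded f \<longleftrightarrow> (\<exists>p :: nat poly. \<forall>n. f n \<le> poly p n)"

lemma poly_bounded_const [intro]: "poly_bounded (\<lambda>_. c)"
  unfolding poly_bounded_def by (rule exI[of _ "[:c:]"]) simp

lemma poly_bounded_id [intro]: "poly_bounded (\<lambda>n. n)"
  unfolding poly_bounded_def by (rule exI[of _ "[:0, 1:]"]) simp

lemma poly_bounded_add [intro]: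
  assumes "poly_bounded f" "poly_bounded g" shows "poly_bounded (\<lambda>n. f n + g n)"
proof -
  obtain p q where "\<forall>n. f n \<le> poly p n" "\<forall>n. g n \<le> poly q n"
    using assms unfolding poly_bounded_def by blast
  then show ?thesis
    unfolding poly_bounded_def by (intro exI[of _ "p + q"]) (simp add: add_mono)
qed

lemma poly_bounded_mult [intro]:
  assumes "poly_bounded f" "poly_bounded g" shows "poly_bounded (\<lambda>n. f n * g n)"
proof -
  obtain p q where "\<forall>n. f n \<le> poly p n" "\<forall>n. g n \<le> poly q n"
    using assms unfolding poly_bounded_def by blast
  then show ?thesis
    unfolding poly_bounded_def by (intro exI[of _ "p * q"]) (simp add: mult_mono)
qed

lemma poly_bounded_power [intro]: "poly_bounded f \<Longrightarrow> poly_bounded (\<lambda>n. f n ^ k)"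
  by (induction k) auto

text \<open>Natural coefficients make a polynomial monotone. Composition of bounds rests on this,
  and with it the passage from \<open>B\<close> to the size of the input.\<close>

lemma poly_nat_mono: "m \<le> n \<Longrightarrow> poly (p :: nat poly) m \<le> poly p n"
  by (induction p) (auto intro: add_mono mult_mono)

lemma poly_bounded_compose:
  assumes "poly_bounded f" "poly_bounded g" shows "poly_bounded (\<lambda>n. f (g n))"
proof -
  obtain p q where "\<forall>n. f n \<le> poly p n" "\<forall>n. g n \<le> poly q n"
    using assms unfolding poly_bounded_def by blast
  then have "f (g n) \<le> poly (pcompose p q) n" for n
    using poly_nat_mono[of "g n" "poly q n" p] by (simp add: poly_pcompose) (meson order_trans)
  then show ?thesis
    unfolding poly_bounded_def by blast
qed

lemma poly_bounded_time: "poly_bounded (time e)"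
  by (induction e; unfold time.simps[abs_def])
    (assumption | intro poly_bounded_add poly_bounded_mult poly_bounded_const poly_bounded_id)+

section \<open>Subroutines\<close>

lemma size_head: "size (head d) \<le> size d"
  by (cases d) auto

lemma size_tail: "size (tail d) \<le> size d"
  by (cases d) auto

lemmas size_head_le = order_trans[OF size_head]
lemmas size_tail_le = order_trans[OF size_tail]

fun bits_inc :: "bool list \<Rightarrow> bool list" where
  "bits_inc [] = [True]"
| "bits_inc (False # bs) = True # bs"
| "bits_inc (True # bs) = False # bits_inc bs"

lemma binary_Suc: "binary (Suc n) = bits_inc (binary n)"
proof (induction n rule: less_induct)
  case (less n)
  show ?case
  proof (cases "n = 0")
    case True
    then show ?thesis by (simp add: binary.simps[of 0] binary.simps[of "Suc 0"])
  next
    case False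
    show ?thesis
    proof (cases "even n")
      case True
      then show ?thesis using False by (simp add: binary.simps[of n] binary.simps[of "Suc n"])
    next
      case False
      then have "Suc n div 2 = Suc (n div 2)" "n \<noteq> 0" "n div 2 < n" by (auto elim: oddE)
      then show ?thesis using False less[of "n div 2"]
        by (simp add: binary.simps[of n] binary.simps[of "Suc n"])
    qed
  qed
qed

lemma length_binary: "length (binary n) \<le> n"
proof (induction n rule: less_induct)
  case (less n)
  show ?case
  proof (cases "n = 0")
    case False
    then have "length (binary (n div 2)) \<le> n div 2" by (intro less) simp
    moreover have "Suc (n div 2) \<le> n" using False by (simp add: Suc_leI)
    ultimately show ?thesis using False by (simp add: binary.simps[of n])
  qed (simp add: binary.simps[of 0])
qed

lemma enc_nat_truth: "enc_nat n = enc_list (map truth (binary n))"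
proof -
  have "(\<lambda>b. if b then true else Nil) = truth" by (simp add: fun_eq_iff truth_def)
  then show ?thesis by (simp add: enc_nat_def)
qed

text \<open>Linear instead of logarithmic, but applied only to positions, which are at most
  \<open>n + 1\<close>. The numbers of states, variables and symbols can be exponential in the input
  size and are measured by the sizes of their codes.\<close>

lemma size_enc_nat: "size (enc_nat n) \<le> 2 * n"
proof -
  have "size (enc_list (map truth bs)) \<le> 2 * length bs" for bs
    by (induction bs) (auto simp: truth_def)
  then show ?thesis
    using length_binary[of n] by (simp add: enc_nat_truth) (meson le_trans mult_le_mono2)
qed

lemma length_spine_enc_nat: "length (spine (enc_nat n)) \<le> n"
  using length_binary by (simp add: enc_nat_truth)

text \<open>
  Evaluating a program symbolically requires simplification inside the branches of conditionals
  that are not yet decided.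
\<close>

declare if_weak_cong [cong del]

text \<open>A \<open>Call\<close> body starts with the arguments \<open>Arg 0\<close> to
  \<open>Arg 2\<close>; hence its outer fold has accumulator \<open>Arg 3\<close> and element
  \<open>Arg 4\<close>, and a fold nested in that body has \<open>Arg 5\<close> and
  \<open>Arg 6\<close>. Each \<open>Bind\<close> passed on the way shifts these by one.
  \<open>Node Leaf Leaf\<close> is \<open>true\<close>.\<close>

definition mem :: prog where
  "mem = Fold (Arg 1) Leaf (Cond (Same (Arg 0) (Arg 4)) (Node Leaf Leaf) (Arg 3))"

lemma foldl_mem: "foldl (\<lambda>a y. if P y then true else a) a ys = (if \<exists>y\<in>set ys. P y then true else a)"
  by (induction ys arbitrary: a) auto

lemma val_mem [simp]: "val mem [x, xs, z] = truth (x \<in> set (spine xs))"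
  using foldl_mem[of "\<lambda>y. x = y" Nil "spine xs"]
  by (simp add: mem_def lookup_def)

lemma bounded_mem:
  assumes "size x \<le> B" "\<forall>y\<in>set (spine xs). size y \<le> B" "length (spine xs) \<le> B"
  shows "bounded mem [x, xs, z] B"
  unfolding mem_def by (rule bounded_FoldI[where P = "\<lambda>_. True"])
    (use assms in \<open>auto simp: lookup_def\<close>)

definition reverse :: prog where
  "reverse = Fold (Arg 0) Leaf (Node (Arg 4) (Arg 3))"

lemma val_reverse [simp]: "val reverse [xs, y, z] = enc_list (rev (spine xs))"
proof -
  have "foldl (\<lambda>a x. Pair x a) (enc_list as) xs = enc_list (rev xs @ as)" for as xs
  proof (induction xs arbitrary: as)
    case (Cons x xs)
    show ?case using Cons[of "x # as"] by simp
  qed simp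
  from this[of "[]"] show ?thesis
    by (simp add: reverse_def lookup_def)
qed

lemma bounded_reverse: "length (spine xs) \<le> B \<Longrightarrow> bounded reverse [xs, y, z] B"
  unfolding reverse_def by (rule bounded_FoldI[where P = "\<lambda>_. True"]) (auto simp: lookup_def)

text \<open>With the least significant bit first, the carry ripples along the list. The accumulator
  pairs the carry, initially set, with the digits produced so far in reverse; a carry left over
  becomes the leading digit.\<close>

definition inc :: prog where
  "inc =
  Bind
    (Fold (Arg 0) (Node (Node Leaf Leaf) Leaf)
      (Cond (First (Arg 3))
        (Cond (Arg 4)
          (Node (Node Leaf Leaf) (Node Leaf (Rest (Arg 3))))
          (Node Leaf (Node (Node Leaf Leaf) (Rest (Arg 3)))))
        (Node Leaf (Node (Arg 4) (Rest (Arg 3))))))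
    (Call reverse
      (Cond (First (Arg 3)) (Node (Node Leaf Leaf) (Rest (Arg 3))) (Rest (Arg 3))) Leaf Leaf)"

lemma val_inc [simp]: "val inc [enc_nat n, y, z] = enc_nat (Suc n)"
proof -
  define step where "step = (\<lambda>a x. if head a \<noteq> Nil
     then if x \<noteq> Nil then Pair true (Pair Nil (tail a)) else Pair Nil (Pair true (tail a))
     else Pair Nil (Pair x (tail a)))"
  define finish where "finish = (\<lambda>a. rev (spine (if head a \<noteq> Nil then Pair true (tail a) else tail a)))"
  have "finish (foldl step (Pair (truth c) (enc_list (map truth out))) (map truth bs)) =
      rev (map truth out) @ map truth (if c then bits_inc bs else bs)" for c out bs
  proof (induction bs arbitrary: c out)
    case Nil
    then show ?case by (cases c) (auto simp: finish_def)
  next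
    case (Cons b bs)
    show ?case
      using Cons[of True "False # out"] Cons[of False "True # out"] Cons[of False "b # out"]
      by (cases b; cases c) (simp_all add: step_def)
  qed
  from this[of True "[]" "binary n"] show ?thesis
    by (simp add: inc_def enc_nat_truth lookup_def binary_Suc step_def finish_def)
qed

lemma bounded_inc:
  assumes "n < B"
  shows "bounded inc [enc_nat n, y, z] B"
proof -
  let ?f = "Fold (Arg 0) (Node (Node Leaf Leaf) Leaf)
      (Cond (First (Arg 3))
        (Cond (Arg 4)
          (Node (Node Leaf Leaf) (Node Leaf (Rest (Arg 3))))
          (Node Leaf (Node (Node Leaf Leaf) (Rest (Arg 3)))))
        (Node Leaf (Node (Arg 4) (Rest (Arg 3)))))"
  have 1: "bounded ?f [enc_nat n, y, z] B"
    by (rule bounded_FoldI[where P = "\<lambda>_. True"])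
      (use assms length_spine_enc_nat[of n] in \<open>auto simp: lookup_def\<close>)
  \<comment> \<open>Every pass produces exactly one digit, and a leftover carry adds at most one
    more, so \<open>reverse\<close> traverses at most \<open>n + 1\<close> elements.\<close>
  have "length (spine (tail (foldl f a xs))) = length (spine (tail a)) + length xs"
    if "\<And>a x. length (spine (tail (f a x))) = Suc (length (spine (tail a)))" for f a and xs :: "tree list"
    by (induction xs arbitrary: a) (auto simp: that)
  then have "length (spine (tail (val ?f [enc_nat n, y, z]))) = length (spine (enc_nat n))"
    by (simp add: lookup_def)
  then have "length (spine (tail (val ?f [enc_nat n, y, z]))) < B"
    using assms length_spine_enc_nat[of n] by simp
  then show ?thesis
    unfolding inc_def bounded.simps(8)
    using 1 by (auto simp: lookup_def intro!: bounded_reverse simp del: val.simps(9) bounded.simps(9))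
qed

text \<open>The kind of a label shows in the binary notation of its tag 0, 1 or 2: the tag is
  \<open>Nil\<close> exactly for a symbol, and its lowest bit is set for an opening and clear for a
  closing marker. The empty label is \<open>Nil\<close> itself.\<close>

definition allowed :: prog where
  "allowed =
  Cond (Arg 0)
    (Cond (First (Arg 0))
      (Fold (Arg 2) (Node Leaf Leaf)
        (Cond (Same (First (Arg 4)) (Rest (Arg 0)))
          (Cond (Same (Cond (First (First (Arg 0))) (First (Rest (Arg 4))) (Rest (Rest (Arg 4))))
                      (Arg 1))
            (Arg 3) Leaf)
          (Arg 3)))
      Leaf)
    (Node Leaf Leaf)"

definition allowed_at :: "tree \<Rightarrow> tree \<Rightarrow> tree \<Rightarrow> bool" where
  "allowed_at l pos t \<longleftrightarrow> l = Nil \<or> head l \<noteq> Nil \<and> (\<forall>e\<in>set (spine t). head e = tail l \<longrightarrow>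
     (if head (head l) \<noteq> Nil then head (tail e) else tail (tail e)) = pos)"

lemma foldl_all:
  "foldl (\<lambda>a y. if P y then (if Q y then a else Nil) else a) (truth b) ys =
    truth (b \<and> (\<forall>y\<in>set ys. P y \<longrightarrow> Q y))"
proof (induction ys arbitrary: b)
  case (Cons y ys)
  show ?case using Cons[of b] Cons[of False] by auto
qed simp

lemma val_allowed [simp]: "val allowed [l, pos, t] = truth (allowed_at l pos t)"
  using foldl_all[of "\<lambda>e. head e = tail l"
      "\<lambda>e. (if head (head l) \<noteq> Nil then head (tail e) else tail (tail e)) = pos" True "spine t"]
  by (simp add: allowed_def allowed_at_def lookup_def)

lemma bounded_allowed:
  assumes "size l \<le> B" "size pos \<le> B" "\<forall>e\<in>set (spine t). size e \<le> B" "length (spine t) \<le> B"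
  shows "bounded allowed [l, pos, t] B"
proof -
  have "bounded (Fold (Arg 2) (Node Leaf Leaf)
        (Cond (Same (First (Arg 4)) (Rest (Arg 0)))
          (Cond (Same (Cond (First (First (Arg 0))) (First (Rest (Arg 4))) (Rest (Rest (Arg 4))))
                      (Arg 1))
            (Arg 3) Leaf)
          (Arg 3))) [l, pos, t] B"
    by (rule bounded_FoldI[where P = "\<lambda>_. True"])
      (use assms in \<open>auto simp: lookup_def intro!: size_head_le size_tail_le\<close>)
  then show ?thesis
    unfolding allowed_def by (simp add: lookup_def del: val.simps(9) bounded.simps(9))
qed

text \<open>A table entry \<open>(i, (i + 1, symbol))\<close> stores the symbol as a complete label
  code, so reading it takes a single equality test. A label that reads nothing, if allowed, yields
  an edge that stays at position \<open>i\<close>.\<close>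

definition edges :: prog where
  "edges =
  Fold (Arg 1) Leaf
    (Fold (Arg 2) (Arg 3)
      (Cond (Call allowed (First (Rest (Arg 6))) (First (Arg 4)) (Arg 0))
        (Node (Node (Node (First (Arg 6)) (First (Arg 4)))
                    (Node (Rest (Rest (Arg 6))) (First (Arg 4)))) (Arg 5))
        (Cond (Same (First (Rest (Arg 6))) (Rest (Rest (Arg 4))))
          (Node (Node (Node (First (Arg 6)) (First (Arg 4)))
                      (Node (Rest (Rest (Arg 6))) (First (Rest (Arg 4))))) (Arg 5))
          (Arg 5))))"

definition stay :: "tree \<Rightarrow> tree \<Rightarrow> tree" where
  "stay pe tr = Pair (Pair (head tr) (head pe)) (Pair (tail (tail tr)) (head pe))"

definition advance :: "tree \<Rightarrow> tree \<Rightarrow> tree" where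
  "advance pe tr = Pair (Pair (head tr) (head pe)) (Pair (tail (tail tr)) (head (tail pe)))"

definition edge :: "tree \<Rightarrow> tree \<Rightarrow> tree \<Rightarrow> tree set" where
  "edge t pe tr = (if allowed_at (head (tail tr)) (head pe) t then {stay pe tr}
     else if head (tail tr) = tail (tail pe) then {advance pe tr} else {})"

lemma val_edges:
  "set (spine (val edges [t, pw, tt])) = (\<Union>pe\<in>set (spine pw). \<Union>tr\<in>set (spine tt). edge t pe tr)"
  "length (spine (val edges [t, pw, tt])) \<le> length (spine pw) * length (spine tt)"
proof -
  define f where "f = (\<lambda>pe a tr. if allowed_at (head (tail tr)) (head pe) t then Pair (stay pe tr) a
     else if head (tail tr) = tail (tail pe) then Pair (advance pe tr) a else a)"
  have val: "val edges [t, pw, tt] = foldl (\<lambda>a pe. foldl (f pe) a (spine tt)) Nil (spine pw)"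
    by (simp add: edges_def lookup_def f_def stay_def advance_def)
  have 1: "set (spine (foldl (f pe) a xs)) = set (spine a) \<union> (\<Union>tr\<in>set xs. edge t pe tr)" for pe a xs
    by (induction xs arbitrary: a) (auto simp: f_def edge_def)
  have 2: "length (spine (foldl (f pe) a xs)) \<le> length (spine a) + length xs" for pe a xs
  proof (induction xs arbitrary: a)
    case (Cons x xs)
    show ?case using Cons[of "f pe a x"] by (auto simp: f_def split: if_splits)
  qed simp
  have "set (spine (foldl (\<lambda>a pe. foldl (f pe) a (spine tt)) a ps)) =
     set (spine a) \<union> (\<Union>pe\<in>set ps. \<Union>tr\<in>set (spine tt). edge t pe tr)" for a ps
    by (induction ps arbitrary: a) (auto simp: 1)
  then show "set (spine (val edges [t, pw, tt])) =
      (\<Union>pe\<in>set (spine pw). \<Union>tr\<in>set (spine tt). edge t pe tr)"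
    by (simp add: val)
  have "length (spine (foldl (\<lambda>a pe. foldl (f pe) a (spine tt)) a ps)) \<le>
     length (spine a) + length ps * length (spine tt)" for a ps
  proof (induction ps arbitrary: a)
    case (Cons p ps)
    show ?case using Cons[of "foldl (f p) a (spine tt)"] 2[of p a "spine tt"] by simp
  qed simp
  from this[of Nil "spine pw"] show "length (spine (val edges [t, pw, tt])) \<le> length (spine pw) * length (spine tt)"
    by (simp add: val)
qed

lemma bounded_edges:
  assumes "\<forall>e\<in>set (spine t). size e \<le> B" "length (spine t) \<le> B"
    "\<forall>e\<in>set (spine pw). size e \<le> B" "length (spine pw) \<le> B"
    "\<forall>e\<in>set (spine tt). size e \<le> B" "length (spine tt) \<le> B"
  shows "bounded edges [t, pw, tt] B"
  unfolding edges_def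
  apply (rule bounded_FoldI[where P = "\<lambda>_. True"])
      apply (use assms in \<open>simp_all add: lookup_def del: val.simps(9) bounded.simps(9)\<close>)
  apply (rule bounded_FoldI[where P = "\<lambda>_. True"])
      apply (use assms in \<open>auto simp: lookup_def intro!: size_head_le size_tail_le bounded_allowed\<close>)
  done

text \<open>
  Every pass over the edge list either adds a node or finds the set of reached nodes closed,
  hence as many passes as there are edges suffice.
\<close>

definition reach :: prog where
  "reach =
  Call mem (Arg 2)
    (Fold (Arg 0) (Node (Arg 1) Leaf)
      (Fold (Arg 0) (Arg 3)
        (Cond (Call mem (First (Arg 6)) (Arg 5) Leaf)
          (Cond (Call mem (Rest (Arg 6)) (Arg 5) Leaf) (Arg 5) (Node (Rest (Arg 6)) (Arg 5)))
          (Arg 5)))) Leaf"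

definition graph :: "tree list \<Rightarrow> (tree \<times> tree) set" where
  "graph es = (\<lambda>e. (head e, tail e)) ` set es"

definition propagate :: "tree list \<Rightarrow> tree \<Rightarrow> tree" where
  "propagate es R = foldl (\<lambda>R e. if head e \<in> set (spine R) then
     if tail e \<in> set (spine R) then R else Pair (tail e) R else R) R es"

definition saturated :: "tree list \<Rightarrow> tree \<Rightarrow> bool" where
  "saturated es R \<longleftrightarrow> (\<forall>e\<in>set es. head e \<in> set (spine R) \<longrightarrow> tail e \<in> set (spine R))"

text \<open>Distinctness identifies the length of the list with the number of nodes, and these are
  only the source and targets of edges. The resulting bound serves twice: for the running time and
  for showing that the iteration closes up.\<close>

definition reached :: "tree list \<Rightarrow> tree \<Rightarrow> tree \<Rightarrow> bool" where
  "reached es src R \<longleftrightarrow> distinct (spine R) \<and> src \<in> set (spine R) \<and>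
     set (spine R) \<subseteq> insert src (tail ` set es) \<and> set (spine R) \<subseteq> {y. (src, y) \<in> (graph es)\<^sup>*}"

lemma reached_step:
  assumes "reached es src R" "e \<in> set es" "head e \<in> set (spine R)" "tail e \<notin> set (spine R)"
  shows "reached es src (Pair (tail e) R)"
proof -
  have "(src, head e) \<in> (graph es)\<^sup>*" "(head e, tail e) \<in> graph es"
    using assms by (auto simp: reached_def graph_def)
  then have "(src, tail e) \<in> (graph es)\<^sup>*" by (rule rtrancl_into_rtrancl)
  then show ?thesis using assms by (auto simp: reached_def)
qed

lemma reached_propagate: "reached es src R \<Longrightarrow> set es' \<subseteq> set es \<Longrightarrow> reached es src (propagate es' R)"
proof (induction es' arbitrary: R)
  case Nil
  then show ?case by (simp add: propagate_def)
next
  case (Cons e es')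
  then show ?case
    using reached_step[of es src R e] by (auto simp: propagate_def)
qed

lemma propagate_length: "length (spine R) \<le> length (spine (propagate es R))"
proof (induction es arbitrary: R)
  case (Cons e es)
  then show ?case using Cons[of "Pair (tail e) R"] by (auto simp: propagate_def)
qed (simp add: propagate_def)

lemma propagate_saturated_or_grows:
  "saturated es R \<or> length (spine R) < length (spine (propagate es R))"
proof (induction es arbitrary: R)
  case (Cons e es)
  then show ?case
    using propagate_length[of "Pair (tail e) R" es] by (auto simp: propagate_def saturated_def)
qed (simp add: saturated_def)

lemma propagate_saturated: "saturated es R \<Longrightarrow> propagate es R = R"
  by (induction es) (auto simp: propagate_def saturated_def)

lemma iterate_saturated_or_grow:
  fixes ks :: "tree list"
  shows "saturated es (foldl (\<lambda>R _. propagate es R) R ks) \<or>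
    length ks + length (spine R) \<le> length (spine (foldl (\<lambda>R _. propagate es R) R ks))"
proof (induction ks arbitrary: R)
  case (Cons k ks)
  show ?case
  proof (cases "saturated es R")
    case True
    have "foldl (\<lambda>R _. propagate es R) R ks = R" for ks :: "tree list"
      by (induction ks) (auto simp: propagate_saturated[OF True])
    then show ?thesis using True by metis
  next
    case False
    then show ?thesis
      using propagate_saturated_or_grows[of es R] Cons[of "propagate es R"] by auto
  qed
qed simp

lemma reached_length:
  assumes "reached es src R"
  shows "length (spine R) \<le> length es + 1"
proof -
  have "length (spine R) = card (set (spine R))"
    using assms by (simp add: reached_def distinct_card)
  also have "\<dots> \<le> card (insert src (tail ` set es))"
    using assms by (intro card_mono) (auto simp: reached_def)
  also have "\<dots> \<le> Suc (card (tail ` set es))"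
    by (simp add: card_insert_if)
  also have "\<dots> \<le> Suc (length es)"
    using card_image_le[of "set es" tail] card_length[of es] by simp
  finally show ?thesis by simp
qed

lemma reached_iterate:
  fixes ks :: "tree list"
  assumes "reached es src R"
  shows "reached es src (foldl (\<lambda>R _. propagate es R) R ks)"
  using assms by (induction ks arbitrary: R) (auto intro: reached_propagate)

lemma iterate_reach:
  defines "R \<equiv> \<lambda>es src. foldl (\<lambda>R _. propagate es R) (Pair src Nil) es"
  shows "set (spine (R es src)) = {y. (src, y) \<in> (graph es)\<^sup>*}"
proof -
  have init: "reached es src (Pair src Nil)" by (auto simp: reached_def)
  have R: "reached es src (R es src)"
    unfolding R_def by (rule reached_iterate[OF init])
  have saturated: "saturated es (R es src)"
  proof (rule ccontr)
    \<comment> \<open>Starting from one node, \<open>length es\<close> growing passes give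
      \<open>length es + 1\<close> nodes, at least as many as the source and all targets of edges
      together. The set then contains every target and is closed after all.\<close>
    assume "\<not> saturated es (R es src)"
    then have "length es + 1 \<le> length (spine (R es src))"
      using iterate_saturated_or_grow[of es "Pair src Nil" es] unfolding R_def by auto
    also have "length (spine (R es src)) = card (set (spine (R es src)))"
      using R by (simp add: reached_def distinct_card)
    finally have "length es + 1 \<le> card (set (spine (R es src)))" .
    moreover have "card (insert src (tail ` set es)) \<le> length es + 1"
      using card_image_le[of "set es" tail] card_length[of es]
      by (simp add: card_insert_if)
    ultimately have "set (spine (R es src)) = insert src (tail ` set es)"
      using R by (intro card_seteq) (auto simp: reached_def)
    then show False using \<open>\<not> saturated es (R es src)\<close> by (auto simp: saturated_def)
  qed
  have "y \<in> set (spine (R es src))" if "(src, y) \<in> (graph es)\<^sup>*" for y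
    using that
  proof (induction rule: rtrancl_induct)
    case base
    then show ?case using R by (simp add: reached_def)
  qed (use saturated in \<open>auto simp: saturated_def graph_def\<close>)
  then show ?thesis using R by (auto simp: reached_def)
qed

lemma val_reach: "val reach [E, src, dst] = truth ((src, dst) \<in> (graph (spine E))\<^sup>*)"
proof -
  have "val reach [E, src, dst] =
      truth (dst \<in> set (spine (foldl (\<lambda>R _. propagate (spine E) R) (Pair src Nil) (spine E))))"
    by (simp add: reach_def lookup_def propagate_def)
  then show ?thesis by (simp add: iterate_reach)
qed

lemma bounded_reach:
  assumes "\<forall>e\<in>set (spine E). size e \<le> B" "length (spine E) + 1 \<le> B" "size src \<le> B" "size dst \<le> B"
  shows "bounded reach [E, src, dst] B"
proof -
  let ?es = "spine E"
  let ?g = "Cond (Call mem (First (Arg 6)) (Arg 5) Leaf)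
          (Cond (Call mem (Rest (Arg 6)) (Arg 5) Leaf) (Arg 5) (Node (Rest (Arg 6)) (Arg 5)))
          (Arg 5)"
  have size: "size x \<le> B" if "reached ?es src R" "x \<in> set (spine R)" for x R
    using that assms by (auto simp: reached_def dest!: subsetD intro: size_tail_le)
  have len: "length (spine R) \<le> B" if "reached ?es src R" for R
    using reached_length[OF that] assms(2) by simp
  have inner: "bounded (Fold (Arg 0) (Arg 3) ?g) [E, src, dst, R, x] B"
    if "reached ?es src R" for R x
  proof (rule bounded_FoldI[where P = "reached ?es src"])
    fix a e assume a: "reached ?es src a" and e: "e \<in> set (spine (val (Arg 0) [E, src, dst, R, x]))"
    have "bounded mem [head e, a, Nil] B" "bounded mem [tail e, a, Nil] B"
      using a e assms size len
      by (auto intro!: bounded_mem size_head_le size_tail_le simp: lookup_def)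
    then show "reached ?es src (val ?g ([E, src, dst, R, x] @ [a, e])) \<and>
        bounded ?g ([E, src, dst, R, x] @ [a, e]) B"
      using a e reached_step[of ?es src a e] by (auto simp: lookup_def)
  qed (use that assms in \<open>auto simp: lookup_def\<close>)
  have init: "reached ?es src (Pair src Nil)" by (auto simp: reached_def)
  have outer: "bounded (Fold (Arg 0) (Node (Arg 1) Leaf) (Fold (Arg 0) (Arg 3) ?g)) [E, src, dst] B"
  proof (rule bounded_FoldI[where P = "reached ?es src"])
    fix a e assume a: "reached ?es src a"
    have "val (Fold (Arg 0) (Arg 3) ?g) [E, src, dst, a, e] = propagate ?es a"
      by (simp add: lookup_def propagate_def)
    then show "reached ?es src (val (Fold (Arg 0) (Arg 3) ?g) ([E, src, dst] @ [a, e])) \<and>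
        bounded (Fold (Arg 0) (Arg 3) ?g) ([E, src, dst] @ [a, e]) B"
      using inner[OF a, of e] reached_propagate[OF a order_refl]
      by (simp del: val.simps(9) bounded.simps(9))
  qed (use assms init in \<open>auto simp: lookup_def\<close>)
  have "val (Fold (Arg 0) (Node (Arg 1) Leaf) (Fold (Arg 0) (Arg 3) ?g)) [E, src, dst] =
      foldl (\<lambda>R _. propagate ?es R) (Pair src Nil) ?es"
    by (simp add: lookup_def propagate_def)
  moreover have "reached ?es src (foldl (\<lambda>R _. propagate ?es R) (Pair src Nil) ?es)"
    by (rule reached_iterate[OF init])
  ultimately show ?thesis
    using outer size len assms(4)
    by (auto simp: reach_def lookup_def intro!: bounded_mem simp del: val.simps(9) bounded.simps(9))
qed

definition alive :: prog where
  "alive =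
  Call reach (Call edges (Arg 0) (First (Arg 1)) (First (Rest (Arg 1))))
    (First (Rest (Rest (Arg 1)))) (Rest (Rest (Rest (Arg 1))))"

text \<open>
  The entries \<open>(i, (i + 1, symbol))\<close> of the table are visited in descending order of \<open>i\<close>; the
  first component of the accumulator tells whether the position belongs to the span.
\<close>

definition factor :: prog where
  "factor =
  Rest (Fold (Arg 1) Leaf
    (Bind (Cond (Same (First (Rest (Arg 4))) (First (Arg 0))) Leaf
            (Cond (Same (First (Rest (Arg 4))) (Rest (Arg 0))) (Node Leaf Leaf) (First (Arg 3))))
      (Node (Arg 5) (Cond (Arg 5) (Node (Rest (Rest (Arg 4))) (Rest (Arg 3))) (Rest (Arg 3))))))"

text \<open>An entry for position \<open>p\<close> is compared by its successor
  \<open>p + 1\<close>: equality with \<open>j\<close> switches membership on at the last position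
  of the span, equality with \<open>i\<close> switches it off just before the first. The test for
  \<open>i\<close> has priority, so an empty span yields no symbols.\<close>

definition factor_step :: "tree \<Rightarrow> tree \<Rightarrow> tree \<Rightarrow> tree" where
  "factor_step ij a e =
    (let b = (if head (tail e) = head ij then Nil
              else if head (tail e) = tail ij then true else head a)
     in Pair b (if b \<noteq> Nil then Pair (tail (tail e)) (tail a) else tail a))"

lemma val_factor: "val factor [ij, pw, z] = tail (foldl (factor_step ij) Nil (spine pw))"
  by (simp add: factor_def lookup_def factor_step_def[abs_def] Let_def)

text \<open>The result consists of symbols copied from the table; this bounds the trees that
  \<open>selected\<close> compares.\<close>

lemma size_factor: "size (val factor [ij, pw, z]) \<le> size pw"
proof -
  have "size (tail (foldl (factor_step ij) a es)) \<le> size (tail a) + size (enc_list es)" for a es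
  proof (induction es arbitrary: a)
    case (Cons e es)
    have "size (tail (tail e)) \<le> size e" by (intro size_tail_le order_refl)
    then show ?case using Cons[of "factor_step ij a e"] by (auto simp: factor_step_def Let_def)
  qed simp
  from this[of Nil "spine pw"] show ?thesis by (simp add: val_factor)
qed

lemma bounded_factor:
  assumes "size ij \<le> B" "\<forall>e\<in>set (spine pw). size e \<le> B" "length (spine pw) \<le> B"
  shows "bounded factor [ij, pw, z] B"
  unfolding factor_def bounded.simps(5) by (rule bounded_FoldI[where P = "\<lambda>_. True"])
    (use assms in \<open>auto simp: lookup_def intro!: size_head_le size_tail_le\<close>)

definition assoc :: prog where
  "assoc =
  Fold (Arg 1) Leaf (Cond (Same (First (Arg 4)) (Arg 0)) (Rest (Arg 4)) (Arg 3))"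

lemma val_assoc:
  "val assoc [x, t, z] = foldl (\<lambda>a e. if head e = x then tail e else a) Nil (spine t)"
  by (simp add: assoc_def lookup_def)

lemma size_assoc:
  assumes "\<forall>e\<in>set (spine t). size e \<le> B"
  shows "size (val assoc [x, t, z]) \<le> B"
proof -
  have "size (foldl (\<lambda>a e. if head e = x then tail e else a) a es) \<le> B"
    if "size a \<le> B" "\<forall>e\<in>set es. size e \<le> B" for a es
    using that by (induction es arbitrary: a) (auto intro: size_tail_le)
  then show ?thesis using assms by (simp add: val_assoc)
qed

lemma bounded_assoc:
  assumes "size x \<le> B" "\<forall>e\<in>set (spine t). size e \<le> B" "length (spine t) \<le> B"
  shows "bounded assoc [x, t, z] B"
  unfolding assoc_def by (rule bounded_FoldI[where P = "\<lambda>_. True"])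
    (use assms in \<open>auto simp: lookup_def intro!: size_head_le\<close>)

definition selected :: prog where
  "selected =
  Fold (Arg 1) (Node Leaf Leaf)
    (Cond (Same (Call factor (Call assoc (First (Arg 4)) (Arg 0) Leaf) (Arg 2) Leaf)
                (Call factor (Call assoc (Rest (Arg 4)) (Arg 0) Leaf) (Arg 2) Leaf))
      (Arg 3) Leaf)"

lemma val_selected:
  "val selected [t, eqs, pw] = truth (\<forall>e\<in>set (spine eqs).
     val factor [val assoc [head e, t, Nil], pw, Nil] =
     val factor [val assoc [tail e, t, Nil], pw, Nil])"
  using foldl_all[of "\<lambda>_. True" "\<lambda>e. val factor [val assoc [head e, t, Nil], pw, Nil] =
     val factor [val assoc [tail e, t, Nil], pw, Nil]" True "spine eqs"]
  by (simp add: selected_def lookup_def)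

lemma bounded_selected:
  assumes "\<forall>e\<in>set (spine t). size e \<le> B" "length (spine t) \<le> B"
    "\<forall>e\<in>set (spine eqs). size e \<le> B" "length (spine eqs) \<le> B"
    "\<forall>e\<in>set (spine pw). size e \<le> B" "length (spine pw) \<le> B" "size pw \<le> B"
  shows "bounded selected [t, eqs, pw] B"
  unfolding selected_def by (rule bounded_FoldI[where P = "\<lambda>_. True"])
    (use assms in \<open>auto simp: lookup_def intro!: size_head_le size_tail_le bounded_factor
       bounded_assoc size_assoc order_trans[OF size_factor]\<close>)

section \<open>Candidate spans, assignments and the table of positions\<close>

definition spans :: prog where
  "spans =
  Fold (Arg 0) Leaf
    (Fold (Arg 0) (Arg 3) (Node (Node (First (Arg 4)) (First (Arg 6))) (Arg 5)))"

definition assign_all :: prog where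
  "assign_all =
  Fold (Arg 0) Leaf
    (Fold (Arg 2) (Arg 3) (Node (Node (Node (Arg 1) (Arg 6)) (Arg 4)) (Arg 5)))"

lemma foldl_product:
  "foldl (\<lambda>a x. foldl (\<lambda>a y. Pair (f x y) a) a ys) (enc_list as) xs =
    enc_list (rev (concat (map (\<lambda>x. map (f x) ys) xs)) @ as)"
proof -
  have 1: "foldl (\<lambda>a y. Pair (f x y) a) (enc_list as) ys = enc_list (rev (map (f x) ys) @ as)" for x as ys
  proof (induction ys arbitrary: as)
    case (Cons y ys)
    show ?case using Cons[of "f x y # as"] by simp
  qed simp
  show ?thesis
    by (induction xs arbitrary: as) (simp_all add: 1)
qed

lemma val_spans: "val spans [pw, y, z] =
    enc_list (rev (concat (map (\<lambda>e. map (\<lambda>e'. Pair (head e) (head e')) (spine pw)) (spine pw))))"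
  using foldl_product[of "\<lambda>e e'. Pair (head e) (head e')" "spine pw" "[]" "spine pw"]
  by (simp add: spans_def lookup_def)

lemma bounded_spans: "length (spine pw) \<le> B \<Longrightarrow> bounded spans [pw, y, z] B"
  by (simp add: spans_def lookup_def)

lemma val_assign_all: "val assign_all [ts, x, sp] =
    enc_list (rev (concat (map (\<lambda>t. map (\<lambda>ij. Pair (Pair x ij) t) (spine sp)) (spine ts))))"
  using foldl_product[of "\<lambda>t ij. Pair (Pair x ij) t" "spine sp" "[]" "spine ts"]
  by (simp add: assign_all_def lookup_def)

lemma bounded_assign_all:
  "length (spine ts) \<le> B \<Longrightarrow> length (spine sp) \<le> B \<Longrightarrow> bounded assign_all [ts, x, sp] B"
  by (simp add: assign_all_def lookup_def)

text \<open>The accumulator pairs the current position with the table built so far, newest entry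
  first. \<open>Node Leaf\<close> in front of a symbol makes it a label code, since
  \<open>enc_nat 0\<close> is \<open>Nil\<close>. The final entry is the position behind the last
  symbol, where only labels that read nothing apply.\<close>

definition positions :: prog where
  "positions =
  Bind
    (Fold (Arg 0) (Node (Node (Node Leaf Leaf) Leaf) Leaf)
      (Bind (Call inc (First (Arg 3)) Leaf Leaf)
        (Node (Arg 5)
          (Node (Node (First (Arg 3)) (Node (Arg 5) (Node Leaf (Arg 4)))) (Rest (Arg 3))))))
    (Node (Node (First (Arg 3)) (Node Leaf Leaf)) (Rest (Arg 3)))"

definition occurs :: prog where
  "occurs =
  Fold (Arg 1) Leaf
    (Cond (Same (Arg 0) (First (Arg 4))) (Node Leaf Leaf)
      (Cond (Same (Arg 0) (Rest (Arg 4))) (Node Leaf Leaf) (Arg 3)))"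

lemma val_occurs [simp]:
  "val occurs [x, eqs, z] = truth (\<exists>e\<in>set (spine eqs). x = head e \<or> x = tail e)"
proof -
  have "foldl (\<lambda>a e. if x = head e then true else if x = tail e then true else a) Nil es =
      foldl (\<lambda>a e. if x = head e \<or> x = tail e then true else a) Nil es" for es
    by (rule foldl_cong) auto
  then show ?thesis
    using foldl_mem[of "\<lambda>e. x = head e \<or> x = tail e" Nil "spine eqs"]
    by (simp add: occurs_def lookup_def)
qed

lemma bounded_occurs:
  assumes "size x \<le> B" "\<forall>e\<in>set (spine eqs). size e \<le> B" "length (spine eqs) \<le> B"
  shows "bounded occurs [x, eqs, z] B"
  unfolding occurs_def by (rule bounded_FoldI[where P = "\<lambda>_. True"])
    (use assms in \<open>auto simp: lookup_def intro!: size_head_le size_tail_le\<close>)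

text \<open>\<open>Arg 0\<close> is the search stack. The fold starts from the rest of the stack, so
  that the surviving extensions of the top node are pushed onto it directly.\<close>

definition step :: prog where
  "step =
  Fold (Arg 1) (Rest (Arg 0))
    (Bind (Node (Node (First (Rest (First (Arg 0)))) (Arg 4)) (First (First (Arg 0))))
      (Cond (Call alive (Arg 5) (Arg 2) Leaf)
        (Node (Node (Arg 5) (Rest (Rest (First (Arg 0))))) (Arg 3))
        (Arg 3)))"

lemma foldl_filter:
  "foldl (\<lambda>a x. if P x then Pair (f x) a else a) (enc_list as) xs =
    enc_list (rev (map f (filter P xs)) @ as)"
proof (induction xs arbitrary: as)
  case (Cons x xs)
  show ?case using Cons[of as] Cons[of "f x # as"] by simp
qed simp

lemma val_step:
  "val step [Pair (Pair t (Pair x vs)) (enc_list st), sp, g] =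
    enc_list (rev (map (\<lambda>ij. Pair (Pair (Pair x ij) t) vs)
      (filter (\<lambda>ij. val alive [Pair (Pair x ij) t, g, Nil] \<noteq> Nil) (spine sp))) @ st)"
  using foldl_filter[of "\<lambda>ij. val alive [Pair (Pair x ij) t, g, Nil] \<noteq> Nil"
      "\<lambda>ij. Pair (Pair (Pair x ij) t) vs" st "spine sp"]
  by (simp add: step_def lookup_def)

lemma bounded_step:
  assumes "length (spine sp) \<le> B"
    "\<And>ij. ij \<in> set (spine sp) \<Longrightarrow> bounded alive [Pair (Pair x ij) t, g, Nil] B"
  shows "bounded step [Pair (Pair t (Pair x vs)) st, sp, g] B"
  unfolding step_def by (rule bounded_FoldI[where P = "\<lambda>_. True"])
    (use assms in \<open>auto simp: lookup_def\<close>)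

lemma enc_nat_eq [simp]: "enc_nat m = enc_nat n \<longleftrightarrow> m = n"
  using inj_enc_nat by (auto dest: injD)

lemma enc_nat_0 [simp]: "enc_nat 0 = Nil"
proof -
  have "binary 0 = []" by (subst binary.simps) simp
  then show ?thesis by (simp add: enc_nat_truth)
qed

lemma enc_nat_1 [simp]: "enc_nat (Suc 0) = Pair true Nil"
proof -
  have "binary 1 = bits_inc (binary 0)" "binary 0 = []"
    using binary_Suc[of 0] by (simp, subst binary.simps, simp)
  then show ?thesis by (simp add: enc_nat_truth)
qed

lemma enc_nat_2 [simp]: "enc_nat 2 = Pair Nil (Pair true Nil)"
proof -
  have "binary 2 = bits_inc (bits_inc (binary 0))" "binary 0 = []"
    using binary_Suc[of 0] binary_Suc[of 1] by (simp add: numeral_2_eq_2, subst binary.simps, simp)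
  then show ?thesis by (simp add: enc_nat_truth)
qed

lemma enc_nat_Nil [simp]: "enc_nat n = Nil \<longleftrightarrow> n = 0" "Nil = enc_nat n \<longleftrightarrow> n = 0"
  using enc_nat_eq[of n 0] enc_nat_eq[of 0 n] by (auto simp del: enc_nat_eq)

lemma enc_list_eq [simp]: "enc_list xs = enc_list ys \<longleftrightarrow> xs = ys"
  using enc_list_inject by blast

section \<open>Reachability of configurations\<close>

text \<open>Injectivity lets a path in the image graph be pulled back edge by edge; reachability can
  thus be computed on codes of configurations.\<close>

lemma rtrancl_map_prod:
  assumes "inj f"
  shows "(f a, f b) \<in> (map_prod f f ` r)\<^sup>* \<longleftrightarrow> (a, b) \<in> r\<^sup>*"
proof
  have "\<exists>y'. y = f y' \<and> (a, y') \<in> r\<^sup>*" if "(f a, y) \<in> (map_prod f f ` r)\<^sup>*" for y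
    using that
  proof (induction rule: rtrancl_induct)
    case (step y z)
    then obtain y' u v where "y = f y'" "(a, y') \<in> r\<^sup>*" "(u, v) \<in> r" "y = f u" "z = f v"
      by auto
    then show ?case using assms by (auto dest!: injD intro: rtrancl_into_rtrancl)
  qed auto
  then show "(a, b) \<in> r\<^sup>*" if "(f a, f b) \<in> (map_prod f f ` r)\<^sup>*"
    using that assms by (metis injD)
  show "(f a, f b) \<in> (map_prod f f ` r)\<^sup>*" if "(a, b) \<in> r\<^sup>*"
    using that
  proof (induction rule: rtrancl_induct)
    case (step y z)
    then have "(f y, f z) \<in> map_prod f f ` r" by force
    then show ?case using step by (meson rtrancl_into_rtrancl)
  qed auto
qed

lemma distinct_concat_map:
  assumes "distinct xs" "\<And>x. x \<in> set xs \<Longrightarrow> distinct (f x)"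
    "\<And>x y z. x \<in> set xs \<Longrightarrow> y \<in> set xs \<Longrightarrow> z \<in> set (f x) \<Longrightarrow> z \<in> set (f y) \<Longrightarrow> x = y"
  shows "distinct (concat (map f xs))"
  using assms
proof (induction xs)
  case (Cons x xs)
  have "distinct (concat (map f xs))" using Cons.prems by (intro Cons.IH) auto
  moreover have "set (f x) \<inter> set (concat (map f xs)) = {}"
    using Cons.prems(1) Cons.prems(3)[of x] by fastforce
  ultimately show ?case using Cons.prems by auto
qed simp

lemma clr_append [simp]: "clr (r @ r') = clr r @ clr r'"
  by (induction r rule: clr.induct) auto

text \<open>An entry \<open>(x, i, j)\<close> of the list \<open>t\<close> prescribes the span \<open>[i,j\<rangle>\<close> for \<open>x\<close>. The predicate
  tells whether a letter may be read at position \<open>i\<close> without advancing in the string.\<close>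

fun permits :: "('v \<times> span) list \<Rightarrow> nat \<Rightarrow> ('a, 'v) letter option \<Rightarrow> bool" where
  "permits t i None = True"
| "permits t i (Some (Sym a)) = False"
| "permits t i (Some (Open x)) = (\<forall>(y, b, e) \<in> set t. y = x \<longrightarrow> b = i)"
| "permits t i (Some (Close x)) = (\<forall>(y, b, e) \<in> set t. y = x \<longrightarrow> e = i)"

fun compatible :: "('v \<times> span) list \<Rightarrow> nat \<Rightarrow> ('a, 'v) letter list \<Rightarrow> bool" where
  "compatible t i [] = True"
| "compatible t i (Sym a # r) = compatible t (Suc i) r"
| "compatible t i (l # r) = (permits t i (Some l) \<and> compatible t i r)"

lemma compatible_append:
  "compatible t i (r @ r') \<longleftrightarrow> compatible t i r \<and> compatible t (i + length (clr r)) r'"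
  by (induction t i r rule: compatible.induct) auto

text \<open>The number \<open>k\<close> counts the symbols already read, so the position in the
  sense of spans is \<open>Suc k\<close>.\<close>

definition move ::
  "('a, 'v, 'q) automaton \<Rightarrow> 'a list \<Rightarrow> ('v \<times> span) list \<Rightarrow> (('q \<times> nat) \<times> ('q \<times> nat)) set" where
  "move A s t = {((p, k), (q, k')). \<exists>l. (p, l, q) \<in> transitions A \<and> k \<le> length s \<and>
     (permits t (Suc k) l \<and> k' = k \<or>
      k < length s \<and> l = Some (Sym (s ! k)) \<and> k' = Suc k)}"

definition live :: "('a, 'v, 'q) automaton \<Rightarrow> 'a list \<Rightarrow> ('v \<times> span) list \<Rightarrow> bool" where
  "live A s t \<longleftrightarrow> ((init A, 0), (final A, length s)) \<in> (move A s t)\<^sup>*"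

text \<open>The unread part of the string is \<open>drop k s\<close>; the remainder \<open>w\<close>
  behind the word stays fixed while the induction consumes letters from the front.\<close>

lemma path_move:
  assumes "vset_automaton A" "path A p r q" "p \<in> states A" "compatible t (Suc k) r"
    "drop k s = clr r @ w" "k \<le> length s"
  shows "((p, k), (q, k + length (clr r))) \<in> (move A s t)\<^sup>*"
  using assms(2-)
proof (induction arbitrary: k rule: path.induct)
  case (path_eps q p r q')
  then have "q \<in> states A"
    using assms(1) by (auto simp: vset_automaton_def labels_def)
  moreover have "((p, k), (q, k)) \<in> move A s t"
    using path_eps by (auto simp: move_def transitions_def labels_def intro!: exI[of _ None])
  ultimately show ?case
    using path_eps by (meson converse_rtrancl_into_rtrancl)
next
  case (path_letter l q p r q')
  then have q: "q \<in> states A"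
    using assms(1) unfolding vset_automaton_def labels_def by blast
  have tr: "(p, Some l, q) \<in> transitions A"
    using path_letter by (auto simp: transitions_def labels_def)
  show ?case
  proof (cases l)
    case (Sym a)
    then have d: "drop k s = a # clr r @ w" using path_letter by simp
    then have k: "k < length s" by (cases "k < length s") auto
    then have a: "s ! k = a" "drop (Suc k) s = clr r @ w"
      using d by (simp_all add: Cons_nth_drop_Suc[symmetric])
    have "((p, k), (q, Suc k)) \<in> move A s t"
      using tr k a Sym by (auto simp: move_def)
    moreover have "((q, Suc k), (q', Suc k + length (clr r))) \<in> (move A s t)\<^sup>*"
      using path_letter.prems Sym k a q by (intro path_letter.IH) auto
    ultimately show ?thesis
      using Sym by (simp add: converse_rtrancl_into_rtrancl)
  next
    case (Open x)
    have "((p, k), (q, k)) \<in> move A s t"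
      using tr Open path_letter.prems by (auto simp: move_def intro!: exI[of _ "Some l"])
    moreover have "((q, k), (q', k + length (clr r))) \<in> (move A s t)\<^sup>*"
      using path_letter.prems Open q by (intro path_letter.IH) auto
    ultimately show ?thesis
      using Open by (simp add: converse_rtrancl_into_rtrancl)
  next
    case (Close x)
    have "((p, k), (q, k)) \<in> move A s t"
      using tr Close path_letter.prems by (auto simp: move_def intro!: exI[of _ "Some l"])
    moreover have "((q, k), (q', k + length (clr r))) \<in> (move A s t)\<^sup>*"
      using path_letter.prems Close q by (intro path_letter.IH) auto
    ultimately show ?thesis
      using Close by (simp add: converse_rtrancl_into_rtrancl)
  qed
qed auto

lemma move_path:
  assumes "((p, k), (q, k')) \<in> (move A s t)\<^sup>*"
  shows "\<exists>r. path A p r q \<and> compatible t (Suc k) r \<and> drop k s = clr r @ drop k' s"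
  using assms
proof (induction "(p, k)" arbitrary: p k rule: converse_rtrancl_induct)
  case base
  show ?case by (intro exI[of _ "[]"]) (auto intro: path_nil)
next
  case (step z)
  obtain p1 k1 where z: "z = (p1, k1)" by (cases z)
  obtain r where r: "path A p1 r q" "compatible t (Suc k1) r" "drop k1 s = clr r @ drop k' s"
    using step(3)[OF z] by blast
  obtain l where l: "(p, l, p1) \<in> transitions A"
      "permits t (Suc k) l \<and> k1 = k \<or> k < length s \<and> l = Some (Sym (s ! k)) \<and> k1 = Suc k"
    using step(1) z by (auto simp: move_def)
  show ?case
  proof (cases l)
    case None
    then show ?thesis
      using l r by (intro exI[of _ r]) (auto simp: transitions_def intro: path_eps)
  next
    case (Some b)
    have "path A p (b # r) q"
      using l(1) r(1) Some by (auto simp: transitions_def labels_def intro: path_letter)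
    moreover have "compatible t (Suc k) (b # r) \<and> drop k s = clr (b # r) @ drop k' s"
      using l(2) r Some by (cases b) (auto simp: Cons_nth_drop_Suc[symmetric])
    ultimately show ?thesis by blast
  qed
qed

section \<open>Tuples and extensible assignments\<close>

definition agrees :: "'v tuple \<Rightarrow> ('v \<times> span) list \<Rightarrow> bool" where
  "agrees \<mu> t \<longleftrightarrow> (\<forall>(x, ij) \<in> set t. \<mu> x = Some ij)"

lemma agrees_Cons [simp]: "agrees \<mu> ((x, ij) # t) \<longleftrightarrow> \<mu> x = Some ij \<and> agrees \<mu> t"
  by (auto simp: agrees_def)

lemma valid_tuple_of_exists:
  assumes "valid V r"
  shows "\<exists>\<mu>. tuple_of V r \<mu>"
proof -
  have "\<forall>x\<in>V. \<exists>ij. \<exists>u v w. r = u @ Open x # v @ Close x # w \<and>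
     ij = (length (clr u) + 1, length (clr u) + 1 + length (clr v))"
    using assms by (auto simp: valid_def)
  from bchoice[OF this] obtain f where f: "\<And>x. x \<in> V \<Longrightarrow> \<exists>u v w. r = u @ Open x # v @ Close x # w \<and>
     f x = (length (clr u) + 1, length (clr u) + 1 + length (clr v))"
    by blast
  show ?thesis
    unfolding tuple_of_def
    by (intro exI[of _ "\<lambda>x. if x \<in> V then Some (f x) else None"])
      (use f in \<open>auto simp: dom_def split: if_splits\<close>)
qed

text \<open>Identifies a marker met anywhere in a valid word with the one in the decomposition that
  defines the span.\<close>

lemma count_list_unique:
  assumes "count_list (u @ a # v) a = 1" "u @ a # v = u' @ a # v'"
  shows "u' = u \<and> v' = v"
proof -
  have "count_list u a = 0" "count_list v a = 0" using assms(1) by auto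
  then have "a \<notin> set u" "a \<notin> set v" by (simp_all add: count_list_0_iff)
  moreover have "count_list (u' @ a # v') a = 1" using assms by simp
  then have "count_list u' a = 0" "count_list v' a = 0" by auto
  then have "a \<notin> set u'" "a \<notin> set v'" by (simp_all add: count_list_0_iff)
  ultimately show ?thesis
    using assms(2) by (metis append_Cons_eq_iff)
qed

text \<open>Replaces the letter-by-letter recursion of \<open>compatible\<close> by a condition on
  the occurrences of markers, to which unique decompositions of valid words apply.\<close>

lemma compatibleI:
  assumes "\<And>u x v y b e. r = u @ Open x # v \<Longrightarrow> (y, b, e) \<in> set t \<Longrightarrow> y = x \<Longrightarrow>
      b = i + length (clr u)"
    and "\<And>u x v y b e. r = u @ Close x # v \<Longrightarrow> (y, b, e) \<in> set t \<Longrightarrow> y = x \<Longrightarrow>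
      e = i + length (clr u)"
  shows "compatible t i r"
  using assms
proof (induction r arbitrary: i)
  case (Cons l r)
  have 1: "b = i + length (clr (l # u))" if "r = u @ Open x # v" "(y, b, e) \<in> set t" "y = x"
    for u x v y b e
    using Cons.prems(1)[of "l # u" x v y b e] that by simp
  have 2: "e = i + length (clr (l # u))" if "r = u @ Close x # v" "(y, b, e) \<in> set t" "y = x"
    for u x v y b e
    using Cons.prems(2)[of "l # u" x v y b e] that by simp
  show ?case
  proof (cases l)
    case (Sym a)
    then show ?thesis using 1 2 by (auto intro!: Cons.IH)
  next
    case (Open x)
    have "permits t i (Some l)" using Cons.prems(1)[of "[]" x r] Open by auto
    moreover have "compatible t i r" using 1 2 Open by (auto intro!: Cons.IH)
    ultimately show ?thesis using Open by simp
  next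
    case (Close x)
    have "permits t i (Some l)" using Cons.prems(2)[of "[]" x r] Close by auto
    moreover have "compatible t i r" using 1 2 Close by (auto intro!: Cons.IH)
    ultimately show ?thesis using Close by simp
  qed
qed simp

text \<open>A valid word contains both markers of each variable in \<open>t\<close>, and
  compatibility at these markers fixes its span; variables outside \<open>t\<close> take whatever
  spans the word gives them. Conversely, as markers are unique, a word defining an agreeing tuple
  meets every marker at the prescribed position.\<close>

lemma live_iff:
  assumes "vset_automaton A" "functional A" "fst ` set t \<subseteq> Vars A"
  shows "live A s t \<longleftrightarrow> (\<exists>\<mu>\<in>spanner A s. agrees \<mu> t)"
proof
  assume "live A s t"
  then obtain r where r: "path A (init A) r (final A)" "compatible t (Suc 0) r" "clr r = s"
    using move_path[of "init A" 0 "final A" "length s" A s t] by (auto simp: live_def)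
  then have valid: "valid (Vars A) r"
    using assms(2) by (auto simp: functional_def ref_language_def)
  then obtain \<mu> where \<mu>: "tuple_of (Vars A) r \<mu>" using valid_tuple_of_exists by blast
  have "\<mu> x = Some (b, e)" if x: "(x, b, e) \<in> set t" for x b e
  proof -
    have "x \<in> Vars A" using assms(3) x by force
    then obtain u v w where u: "r = u @ Open x # v @ Close x # w"
        "\<mu> x = Some (length (clr u) + 1, length (clr u) + 1 + length (clr v))"
      using \<mu> unfolding tuple_of_def by blast
    have "permits t (1 + length (clr u)) (Some (Open x) :: ('a, 'b) letter option)"
      "permits t (1 + length (clr u) + length (clr v)) (Some (Close x) :: ('a, 'b) letter option)"
      using r(2) unfolding u(1) by (simp_all add: compatible_append)
    then have "b = 1 + length (clr u)" "e = 1 + length (clr u) + length (clr v)"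
      using x by auto
    then show ?thesis using u(2) by simp
  qed
  then have "agrees \<mu> t" by (auto simp: agrees_def)
  moreover have "\<mu> \<in> spanner A s"
    using r \<mu> valid by (auto simp: spanner_def ref_language_def)
  ultimately show "\<exists>\<mu>\<in>spanner A s. agrees \<mu> t" by blast
next
  assume "\<exists>\<mu>\<in>spanner A s. agrees \<mu> t"
  then obtain \<mu> r where \<mu>: "agrees \<mu> t" and r: "path A (init A) r (final A)" "valid (Vars A) r"
      "clr r = s" "tuple_of (Vars A) r \<mu>"
    by (auto simp: spanner_def ref_language_def)
  have span: "\<exists>u v w. r = u @ Open x # v @ Close x # w \<and> b = 1 + length (clr u) \<and>
      e = 1 + length (clr u) + length (clr v) \<and> count_list r (Open x) = 1 \<and>
      count_list r (Close x) = 1" if x: "(x, b, e) \<in> set t" for x b e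
  proof -
    have "x \<in> Vars A" using assms(3) x by force
    moreover have "\<mu> x = Some (b, e)" using \<mu> x by (auto simp: agrees_def)
    moreover from \<open>x \<in> Vars A\<close> obtain u v w i j where "r = u @ Open x # v @ Close x # w"
        "i = length (clr u) + 1" "j = i + length (clr v)" "\<mu> x = Some (i, j)"
      using r(4) unfolding tuple_of_def by blast
    moreover have "count_list r (Open x) = 1" "count_list r (Close x) = 1"
      using r(2) \<open>x \<in> Vars A\<close> unfolding valid_def by blast+
    ultimately show ?thesis by (intro exI[of _ u] exI[of _ v] exI[of _ w]) auto
  qed
  have "compatible t (Suc 0) r"
  proof (rule compatibleI)
    fix u x v y b e
    assume u: "r = u @ Open x # v" and "(y, b, e) \<in> set t" "y = x"
    then have "(x, b, e) \<in> set t" by simp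
    from span[OF this] obtain u' v' w' where
      u': "r = u' @ Open x # v' @ Close x # w'" "b = 1 + length (clr u')" "count_list r (Open x) = 1"
      by blast
    have "u = u'"
      by (rule conjunct1[OF count_list_unique]) (use u u' in \<open>simp_all only:\<close>)
    then show "b = Suc 0 + length (clr u)" using u'(2) by simp
  next
    fix u x v y b e
    assume u: "r = u @ Close x # v" and "(y, b, e) \<in> set t" "y = x"
    then have "(x, b, e) \<in> set t" by simp
    from span[OF this] obtain u' v' w' where
      u': "r = (u' @ Open x # v') @ Close x # w'" "e = 1 + length (clr u') + length (clr v')"
      "count_list r (Close x) = 1"
      by (auto simp only: append_assoc append_Cons)
    have "u = u' @ Open x # v'"
      by (rule conjunct1[OF count_list_unique]) (use u u' in \<open>simp_all only:\<close>)
    then show "e = Suc 0 + length (clr u)" using u'(2) by simp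
  qed
  moreover have "init A \<in> states A" using assms(1) by (simp add: vset_automaton_def)
  ultimately show "live A s t"
    using path_move[OF assms(1) r(1), of t 0 s "[]"] r(3) by (simp add: live_def)
qed

lemma spanner_span:
  assumes "\<mu> \<in> spanner A s" "x \<in> Vars A"
  shows "\<exists>i j. \<mu> x = Some (i, j) \<and> 1 \<le> i \<and> i \<le> j \<and> j \<le> length s + 1"
proof -
  obtain r where r: "clr r = s" "tuple_of (Vars A) r \<mu>"
    using assms by (auto simp: spanner_def)
  obtain u v w where "r = u @ Open x # v @ Close x # w"
      "\<mu> x = Some (length (clr u) + 1, length (clr u) + 1 + length (clr v))"
    using r(2) assms(2) unfolding tuple_of_def by blast
  then show ?thesis using r(1) by auto
qed

lemma spanner_dom: "\<mu> \<in> spanner A s \<Longrightarrow> dom \<mu> = Vars A"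
  by (auto simp: spanner_def tuple_of_def)

section \<open>Representation of the problem\<close>

text \<open>The bindings from \<open>Arg 1\<close> on are: position table, candidate spans, context
  for \<open>alive\<close>, selected variables, remaining variables, assignments of the selected
  variables. \<open>Node (Node Leaf Leaf) Leaf\<close> is position 1; the last position is read off
  the head of the table.\<close>

definition initialize :: prog where
  "initialize =
    Bind (Call positions (First (Rest (Rest (Arg 0)))) Leaf Leaf)
    (Bind (Call spans (Arg 1) Leaf Leaf)
    (Bind (Node (Arg 1) (Node (First (Rest (Rest (Rest (Rest (First (Arg 0)))))))
      (Node (Node (First (Rest (Rest (First (Arg 0))))) (Node (Node Leaf Leaf) Leaf))
            (Node (First (Rest (Rest (Rest (First (Arg 0)))))) (First (First (Arg 1)))))))
    (Bind (Fold (First (First (Arg 0))) Leaf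
      (Cond (Call occurs (Arg 5) (First (Rest (Arg 0))) Leaf) (Node (Arg 5) (Arg 4)) (Arg 4)))
    (Bind (Fold (First (First (Arg 0))) Leaf
      (Cond (Call occurs (Arg 6) (First (Rest (Arg 0))) Leaf) (Arg 5) (Node (Arg 6) (Arg 5))))
    (Bind (Fold (Arg 4) (Node Leaf Leaf) (Call assign_all (Arg 6) (Arg 7) (Arg 2)))
      (Node
        (Fold (Arg 6) Leaf
          (Cond (Call selected (Arg 8) (First (Rest (Arg 0))) (Arg 1))
            (Cond (Call alive (Arg 8) (Arg 3) Leaf) (Node (Node (Arg 8) (Arg 5)) (Arg 7)) (Arg 7))
            (Arg 7)))
        (Node (Arg 2) (Arg 3))))))))"

fun enc_span :: "span \<Rightarrow> tree" where
  "enc_span (i, j) = Pair (enc_nat i) (enc_nat j)"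

lemma enc_span_eq [simp]: "enc_span u = enc_span v \<longleftrightarrow> u = v"
  by (cases u; cases v) auto

fun configuration :: "nat \<times> nat \<Rightarrow> tree" where
  "configuration (p, k) = Pair (enc_nat p) (enc_nat (Suc k))"

lemma inj_configuration: "inj configuration"
  by (auto simp: inj_def)

text \<open>\<open>vs\<close> and \<open>ts\<close> are the listings of variables and transitions
  that the given input code happens to use; the trees computed from it depend on them, the set of
  answers does not.\<close>

locale problem =
  fixes lc :: "'a::finite \<Rightarrow> nat" and vc :: "'v \<Rightarrow> nat"
    and A :: "('a, 'v, nat) automaton" and S :: "('v \<times> 'v) list" and s :: "'a list"
    and vs :: "'v list" and ts :: "(nat \<times> ('a, 'v) letter option \<times> nat) list"
  assumes inj_lc: "inj lc" and inj_vc: "inj vc"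
    and automaton: "vset_automaton A" and functional: "functional A"
    and S_vars: "set S \<subseteq> Vars A \<times> Vars A"
    and vs: "distinct vs" "set vs = Vars A" and ts: "set ts = transitions A"
begin

abbreviation n :: nat where "n \<equiv> length s"

definition enc_var :: "'v \<Rightarrow> tree" where
  "enc_var x = enc_nat (vc x)"

lemma enc_var_eq [simp]: "enc_var x = enc_var y \<longleftrightarrow> x = y"
  using inj_vc by (auto simp: enc_var_def dest: injD)

definition enc_binding :: "'v \<times> span \<Rightarrow> tree" where
  "enc_binding = (\<lambda>(x, ij). Pair (enc_var x) (enc_span ij))"

lemma enc_binding_simp [simp]: "enc_binding (x, ij) = Pair (enc_var x) (enc_span ij)"
  by (simp add: enc_binding_def)

definition enc_assignment :: "('v \<times> span) list \<Rightarrow> tree" where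
  "enc_assignment t = enc_list (map enc_binding t)"

lemma enc_assignment_Nil [simp]: "enc_assignment [] = Nil"
  by (simp add: enc_assignment_def)

lemma enc_assignment_Cons [simp]:
  "enc_assignment (b # t) = Pair (enc_binding b) (enc_assignment t)"
  by (simp add: enc_assignment_def)

lemma spine_enc_assignment [simp]: "spine (enc_assignment t) = map enc_binding t"
  by (simp add: enc_assignment_def)

definition enc_transition :: "nat \<times> ('a, 'v) letter option \<times> nat \<Rightarrow> tree" where
  "enc_transition = (\<lambda>(p, l, q). Pair (enc_nat p) (Pair (enc_label lc vc l) (enc_nat q)))"

definition enc_eq :: "'v \<times> 'v \<Rightarrow> tree" where
  "enc_eq = (\<lambda>(x, y). Pair (enc_var x) (enc_var y))"

definition enc_symbol :: "'a \<Rightarrow> tree" where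
  "enc_symbol a = Pair Nil (enc_nat (lc a))"

lemma inj_enc_symbol: "inj enc_symbol"
  using inj_lc by (auto simp: inj_def enc_symbol_def)

definition entry :: "'a list \<Rightarrow> nat \<Rightarrow> tree" where
  "entry u k = Pair (enc_nat (Suc k)) (Pair (enc_nat (Suc (Suc k))) (enc_symbol (u ! k)))"

definition last_entry :: tree where
  "last_entry = Pair (enc_nat (Suc n)) (Pair Nil Nil)"

definition table :: tree where
  "table = enc_list (last_entry # map (entry s) (rev [0..<n]))"

definition equalities :: tree where
  "equalities = enc_list (map enc_eq S)"

definition arrows :: tree where
  "arrows = enc_list (map enc_transition ts)"

definition input :: "tree \<Rightarrow> tree" where
  "input dQ = enc_list [enc_list [enc_list (map enc_var vs), dQ, enc_nat (init A),
     enc_nat (final A), arrows], equalities, enc_list (map (\<lambda>a. enc_nat (lc a)) s)]"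

text \<open>Pushing entries reverses the string, which gives the descending order that
  \<open>factor\<close> relies on; induction from the right follows the fold.\<close>

lemma val_positions_aux:
  "foldl (\<lambda>a x. Pair (val inc [head a, Nil, Nil])
     (Pair (Pair (head a) (Pair (val inc [head a, Nil, Nil]) (Pair Nil x))) (tail a)))
     (Pair (enc_nat (Suc 0)) Nil) (map (\<lambda>a. enc_nat (lc a)) u) =
   Pair (enc_nat (Suc (length u))) (enc_list (map (entry u) (rev [0..<length u])))"
proof (induction u rule: rev_induct)
  case Nil
  then show ?case by simp
next
  case (snoc a u)
  have "map (entry (u @ [a])) (rev [0..<length u]) = map (entry u) (rev [0..<length u])"
    by (auto simp: entry_def nth_append)
  then show ?case
    using snoc by (simp add: entry_def[of "u @ [a]" "length u"] enc_symbol_def del: enc_nat_1)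
qed

lemma val_positions: "val positions [enc_list (map (\<lambda>a. enc_nat (lc a)) s), y, z] = table"
  using val_positions_aux[of s]
  by (simp add: positions_def lookup_def table_def last_entry_def)

lemma bounded_positions:
  assumes "Suc n < B"
  shows "bounded positions [enc_list (map (\<lambda>a. enc_nat (lc a)) s), y, z] B"
proof -
  have "bounded inc [head (foldl (\<lambda>a x. Pair (val inc [head a, Nil, Nil])
     (Pair (Pair (head a) (Pair (val inc [head a, Nil, Nil]) (Pair Nil x))) (tail a)))
     (Pair (enc_nat (Suc 0)) Nil) (take k (map (\<lambda>a. enc_nat (lc a)) s))), Nil, Nil] B"
    if "k < n" for k
    using val_positions_aux[of "take k s"] assms that
    by (simp add: take_map bounded_inc del: enc_nat_1)
  then show ?thesis
    using assms by (simp add: positions_def lookup_def)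
qed

lemma spine_table: "spine table = last_entry # map (entry s) (rev [0..<n])"
  by (simp add: table_def)

lemma head_table: "map head (spine table) = map (\<lambda>k. enc_nat (Suc k)) (rev [0..<Suc n])"
  by (simp add: spine_table last_entry_def entry_def)

lemma allowed_at_iff:
  "allowed_at (enc_label lc vc l) (enc_nat i) (enc_assignment t) \<longleftrightarrow> permits t i l"
proof (cases l)
  case None
  then show ?thesis by (simp add: allowed_at_def)
next
  case (Some b)
  show ?thesis
  proof (cases b)
    case (Open x)
    then show ?thesis using Some
      by (auto simp: allowed_at_def enc_binding_def enc_var_def[symmetric])
  next
    case (Close x)
    then show ?thesis using Some
      by (auto simp: allowed_at_def enc_binding_def enc_var_def[symmetric])
  qed (use Some in \<open>simp add: allowed_at_def\<close>)
qed

lemma enc_label_symbol: "enc_label lc vc l = enc_symbol a \<longleftrightarrow> l = Some (Sym a)"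
proof (cases l)
  case (Some b)
  then show ?thesis
    using inj_lc by (cases b) (auto simp: enc_symbol_def dest: injD)
qed (simp add: enc_symbol_def)

lemma edge_entry:
  "k < n \<Longrightarrow> edge (enc_assignment t) (entry s k) (enc_transition (p, l, q)) =
    (if permits t (Suc k) l then {Pair (configuration (p, k)) (configuration (q, k))}
     else if l = Some (Sym (s ! k)) then {Pair (configuration (p, k)) (configuration (q, Suc k))}
     else {})"
  by (simp add: edge_def entry_def enc_transition_def allowed_at_iff enc_label_symbol
      stay_def advance_def)

text \<open>The dummy symbol \<open>Nil\<close> equals only the code of the empty label. That label
  is always permitted, so the test for a symbol never succeeds at the end of the string.\<close>

lemma edge_last_entry:
  "edge (enc_assignment t) last_entry (enc_transition (p, l, q)) =
    (if permits t (Suc n) l then {Pair (configuration (p, n)) (configuration (q, n))} else {})"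
proof -
  have "enc_label lc vc l = Nil \<longleftrightarrow> l = None"
    by (cases "(lc, vc, l)" rule: enc_label.cases) auto
  then show ?thesis
    by (auto simp: edge_def last_entry_def enc_transition_def allowed_at_iff stay_def)
qed

text \<open>Makes the two cases of \<open>edge\<close> exclusive, so that testing for permission
  first loses no move that reads a symbol.\<close>

lemma not_permits_Sym: "permits t i l \<Longrightarrow> l \<noteq> Some (Sym a)"
  by auto

lemma set_edges:
  "set (spine (val edges [enc_assignment t, table, arrows])) =
    (\<lambda>(c, c'). Pair (configuration c) (configuration c')) ` move A s t"
proof -
  have "e \<in> (\<Union>pe\<in>set (spine table). \<Union>tr\<in>set (spine arrows). edge (enc_assignment t) pe tr) \<longleftrightarrow>
      e \<in> (\<lambda>(c, c'). Pair (configuration c) (configuration c')) ` move A s t" (is "?l \<longleftrightarrow> ?r") for e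
  proof
    assume ?l
    then consider (last) p l q where "(p, l, q) \<in> transitions A"
        "e \<in> edge (enc_assignment t) last_entry (enc_transition (p, l, q))"
      | (entry) k p l q where "(p, l, q) \<in> transitions A" "k < n"
        "e \<in> edge (enc_assignment t) (entry s k) (enc_transition (p, l, q))"
      using ts by (auto simp: spine_table arrows_def)
    then show ?r
    proof cases
      case last
      then have "permits t (Suc n) l" "e = Pair (configuration (p, n)) (configuration (q, n))"
        by (auto simp: edge_last_entry split: if_splits)
      moreover then have "((p, n), (q, n)) \<in> move A s t"
        using last by (auto simp: move_def)
      ultimately show ?thesis by force
    next
      case entry
      then consider "permits t (Suc k) l" "e = Pair (configuration (p, k)) (configuration (q, k))"
        | "l = Some (Sym (s ! k))" "e = Pair (configuration (p, k)) (configuration (q, Suc k))"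
        by (auto simp: edge_entry split: if_splits)
      then show ?thesis
      proof cases
        case 1
        then have "((p, k), (q, k)) \<in> move A s t" using entry by (auto simp: move_def)
        then show ?thesis using 1 by force
      next
        case 2
        then have "((p, k), (q, Suc k)) \<in> move A s t" using entry by (auto simp: move_def)
        then show ?thesis using 2 by force
      qed
    qed
  next
    assume ?r
    then obtain p k q k' l where e: "e = Pair (configuration (p, k)) (configuration (q, k'))"
      and l: "(p, l, q) \<in> transitions A" "k \<le> n" "permits t (Suc k) l \<and> k' = k \<or>
        k < n \<and> l = Some (Sym (s ! k)) \<and> k' = Suc k"
      by (auto simp: move_def)
    have tr: "enc_transition (p, l, q) \<in> set (spine arrows)"
      using l(1) ts by (simp add: arrows_def)
    show ?l
    proof (cases "k < n")
      case True
      have "e \<in> edge (enc_assignment t) (entry s k) (enc_transition (p, l, q))"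
        using l(3) e not_permits_Sym[of t "Suc k" l "s ! k"] by (auto simp: edge_entry[OF True])
      moreover have "entry s k \<in> set (spine table)" using True by (simp add: spine_table)
      ultimately show ?thesis using tr by blast
    next
      case False
      then have "k = n" using l(2) by simp
      then have "e \<in> edge (enc_assignment t) last_entry (enc_transition (p, l, q))"
        using l(3) e by (auto simp: edge_last_entry)
      moreover have "last_entry \<in> set (spine table)" by (simp add: spine_table)
      ultimately show ?thesis using tr by blast
    qed
  qed
  then show ?thesis unfolding val_edges(1) by blast
qed

text \<open>A \<open>Call\<close> passes three arguments only, so all that \<open>alive\<close>
  needs besides the assignment is packed into one tree.\<close>

definition context_tree :: tree where
  "context_tree = Pair table (Pair arrows
     (Pair (configuration (init A, 0)) (configuration (final A, n))))"

lemma val_alive: "val alive [enc_assignment t, context_tree, z] = truth (live A s t)"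
proof -
  have "graph (spine (val edges [enc_assignment t, table, arrows])) =
      map_prod configuration configuration ` move A s t"
    unfolding graph_def set_edges image_image by (intro image_cong) auto
  then show ?thesis
    using rtrancl_map_prod[OF inj_configuration, of "(init A, 0)" "(final A, n)" "move A s t"]
    by (simp add: alive_def lookup_def val_reach context_tree_def live_def
        del: configuration.simps)
qed

section \<open>Factors of the string and the equality test\<close>

lemma val_factor_aux:
  assumes "1 \<le> i" "i \<le> j" "j \<le> Suc n" "k \<le> n"
  shows "foldl (factor_step (enc_span (i, j))) (Pair Nil Nil) (map (entry s) (rev [k..<n])) =
    Pair (truth (i \<le> Suc k \<and> Suc k < j))
      (enc_list (map (\<lambda>p. enc_symbol (s ! p)) (filter (\<lambda>p. i \<le> Suc p \<and> Suc p < j) [k..<n])))"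
  \<comment> \<open>Induction on \<open>k\<close> downwards from \<open>n\<close>. The flag tells
    whether position \<open>Suc k\<close> belongs to the span; it starts out false because
    \<open>j\<close> is at most \<open>Suc n\<close>.\<close>
  using assms(4)
proof (induction k rule: inc_induct)
  case base
  then show ?case using assms by simp
next
  case (step k)
  have "[k..<n] = k # [Suc k..<n]" using step by (simp add: upt_conv_Cons)
  moreover have "factor_step (enc_span (i, j)) (Pair (truth (i \<le> Suc (Suc k) \<and> Suc (Suc k) < j)) b)
      (entry s k) = Pair (truth (i \<le> Suc k \<and> Suc k < j))
        (if i \<le> Suc k \<and> Suc k < j then Pair (enc_symbol (s ! k)) b else b)" for b
    using assms by (auto simp: factor_step_def Let_def entry_def truth_def)
  ultimately show ?case using step by auto
qed

lemma substring_filter: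
  assumes "1 \<le> i" "i \<le> j" "j \<le> Suc n"
  shows "substring s (i, j) = map ((!) s) (filter (\<lambda>p. i \<le> Suc p \<and> Suc p < j) [0..<n])"
proof -
  have "[0..<n] = [0..<i - 1] @ [i - 1..<j - 1] @ [j - 1..<n]"
    using assms upt_add_eq_append[of 0 "i - 1" "n - (i - 1)"]
      upt_add_eq_append[of "i - 1" "j - 1" "n - (j - 1)"] by simp
  moreover have "filter (\<lambda>p. i \<le> Suc p \<and> Suc p < j) [0..<i - 1] = []"
    "filter (\<lambda>p. i \<le> Suc p \<and> Suc p < j) [j - 1..<n] = []"
    "filter (\<lambda>p. i \<le> Suc p \<and> Suc p < j) [i - 1..<j - 1] = [i - 1..<j - 1]"
    using assms by (auto simp: filter_empty_conv filter_id_conv)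
  ultimately have "filter (\<lambda>p. i \<le> Suc p \<and> Suc p < j) [0..<n] = [i - 1..<j - 1]"
    by simp
  moreover have "take (j - i) (drop (i - 1) s) = map ((!) s) [i - 1..<j - 1]"
    using assms by (intro nth_equalityI) auto
  ultimately show ?thesis by (simp add: substring_def)
qed

lemma val_factor_span:
  assumes "1 \<le> i" "i \<le> j" "j \<le> Suc n"
  shows "val factor [enc_span (i, j), table, z] = enc_list (map enc_symbol (substring s (i, j)))"
proof -
  \<comment> \<open>The successor field of \<open>last_entry\<close> is \<open>Nil\<close>, the code
    of 0, and so differs from both ends of the span.\<close>
  have "factor_step (enc_span (i, j)) Nil last_entry = Pair Nil Nil"
    using assms by (simp add: factor_step_def last_entry_def)
  then show ?thesis
    using val_factor_aux[OF assms, of 0] substring_filter[OF assms]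
    by (simp add: val_factor spine_table comp_def)
qed

text \<open>\<open>assoc\<close> returns the last match; agreement with a tuple makes all matches
  equal.\<close>

lemma val_assoc_agrees:
  assumes "agrees \<mu> t" "x \<in> fst ` set t"
  shows "val assoc [enc_var x, enc_assignment t, z] = enc_span (the (\<mu> x))"
proof -
  have "foldl (\<lambda>a e. if head e = enc_var x then tail e else a) a (map enc_binding t) =
      (if x \<in> fst ` set t then enc_span (the (\<mu> x)) else a)" if "agrees \<mu> t" for a t
    using that by (induction t arbitrary: a) (auto simp: agrees_def)
  then show ?thesis using assms by (simp add: val_assoc)
qed

text \<open>The selections mention only variables assigned by \<open>t\<close>, so the verdict is
  the same for every tuple that extends \<open>t\<close> and need not be repeated during the
  search.\<close>

lemma val_selected_agrees:
  assumes "\<mu> \<in> spanner A s" "agrees \<mu> t" "fst ` set S \<union> snd ` set S \<subseteq> fst ` set t"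
  shows "val selected [enc_assignment t, equalities, table] \<noteq> Nil \<longleftrightarrow> \<mu> \<in> select_eq S A s"
proof -
  have fac: "val factor [val assoc [enc_var x, enc_assignment t, Nil], table, Nil] =
      enc_list (map enc_symbol (substring s (the (\<mu> x))))"
    if x: "x \<in> Vars A" "x \<in> fst ` set t" for x
  proof -
    obtain i j where "\<mu> x = Some (i, j)" "1 \<le> i" "i \<le> j" "j \<le> Suc n"
      using spanner_span[OF assms(1) x(1)] unfolding Suc_eq_plus1 by blast
    then show ?thesis
      using val_factor_span[of i j Nil] val_assoc_agrees[OF assms(2) x(2)] by simp
  qed
  have "val factor [val assoc [enc_var x, enc_assignment t, Nil], table, Nil] =
      val factor [val assoc [enc_var y, enc_assignment t, Nil], table, Nil] \<longleftrightarrow>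
      substring s (the (\<mu> x)) = substring s (the (\<mu> y))" if "(x, y) \<in> set S" for x y
  proof -
    have "x \<in> Vars A" "y \<in> Vars A" using that S_vars by auto
    moreover have "x \<in> fst ` set t" "y \<in> fst ` set t" using that assms(3) by force+
    ultimately show ?thesis
      using inj_map_eq_map[OF inj_enc_symbol] by (simp add: fac)
  qed
  then show ?thesis
    using assms(1) by (fastforce simp: val_selected equalities_def enc_eq_def select_eq_def)
qed

section \<open>The list of all assignments of the selected variables\<close>

definition span_list :: "span list" where
  "span_list = rev (concat (map (\<lambda>k. map (\<lambda>k'. (Suc k, Suc k')) (rev [0..<Suc n])) (rev [0..<Suc n])))"

definition span_tree :: tree where
  "span_tree = enc_list (map enc_span span_list)"

lemma val_spans_table: "val spans [table, y, z] = span_tree"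
proof -
  have "map (\<lambda>e'. Pair x (head e')) (spine table) =
      map (\<lambda>k'. Pair x (enc_nat (Suc k'))) (rev [0..<Suc n])" for x
    using arg_cong[OF head_table, of "map (Pair x)"] by (simp only: map_map comp_def)
  then have "map (\<lambda>e. map (\<lambda>e'. Pair (head e) (head e')) (spine table)) (spine table) =
      map (\<lambda>x. map (\<lambda>k'. Pair x (enc_nat (Suc k'))) (rev [0..<Suc n])) (map head (spine table))"
    by (simp only: map_map comp_def)
  then show ?thesis
    unfolding val_spans span_tree_def span_list_def head_table
    by (simp only: rev_map[symmetric] map_concat map_map comp_def enc_span.simps)
qed

text \<open>Pairs with \<open>i > j\<close> are included. They are no spans, but no tuple of the
  spanner agrees with them, so they never belong to a live assignment.\<close>

lemma set_span_list: "set span_list = {1..Suc n} \<times> {1..Suc n}"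
proof -
  have "(i, j) \<in> set span_list" if "1 \<le> i" "i \<le> Suc n" "1 \<le> j" "j \<le> Suc n" for i j
  proof -
    have "i - 1 \<in> {..<Suc n}" "j - 1 \<in> {..<Suc n}" "(i, j) = (Suc (i - 1), Suc (j - 1))"
      using that by auto
    then show ?thesis by (force simp: span_list_def simp del: upt_Suc)
  qed
  moreover have "set span_list \<subseteq> {1..Suc n} \<times> {1..Suc n}"
    by (auto simp: span_list_def simp del: upt_Suc)
  ultimately show ?thesis by auto
qed

lemma distinct_span_list: "distinct span_list"
  unfolding span_list_def distinct_rev
  by (rule distinct_concat_map) (auto simp: distinct_map inj_on_def simp del: upt_Suc)

lemma length_span_list: "length span_list = Suc n * Suc n"
  using distinct_card[OF distinct_span_list] by (simp add: set_span_list)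

definition assignments :: "'v list \<Rightarrow> ('v \<times> span) list list" where
  "assignments = foldl (\<lambda>us x. rev (concat (map (\<lambda>t. map (\<lambda>ij. (x, ij) # t) span_list) us))) [[]]"

lemma foldl_assign_all:
  "foldl (\<lambda>a x. val assign_all [a, x, span_tree]) (Pair Nil Nil) (map enc_var xs) =
    enc_list (map enc_assignment (assignments xs))"
proof (induction xs rule: rev_induct)
  case Nil
  then show ?case by (simp add: assignments_def)
next
  case (snoc x xs)
  then show ?case
    by (simp add: assignments_def val_assign_all span_tree_def rev_map[symmetric] map_concat comp_def)
qed

text \<open>Variables are consed in a fixed order, hence the reversal. The fixed order also means
  that a choice of spans occurs as one list only, which excludes repeated answers.\<close>

lemma set_assignments:
  "set (assignments xs) = {t. map fst t = rev xs \<and> snd ` set t \<subseteq> set span_list}"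
proof (induction xs rule: rev_induct)
  case Nil
  then show ?case by (auto simp: assignments_def)
next
  case (snoc x xs)
  have "set (assignments (xs @ [x])) = {(x, ij) # t | ij t. ij \<in> set span_list \<and> t \<in> set (assignments xs)}"
    by (auto simp: assignments_def)
  also have "\<dots> = {t. map fst t = rev (xs @ [x]) \<and> snd ` set t \<subseteq> set span_list}"
    unfolding snoc
  proof (intro equalityI subsetI)
    fix t assume "t \<in> {t. map fst t = rev (xs @ [x]) \<and> snd ` set t \<subseteq> set span_list}"
    then obtain ij t' where "t = (x, ij) # t'" "map fst t' = rev xs" "snd ` set t \<subseteq> set span_list"
      by (auto simp: map_eq_Cons_conv)
    then show "t \<in> {(x, ij) # t | ij t. ij \<in> set span_list \<and>
        t \<in> {t. map fst t = rev xs \<and> snd ` set t \<subseteq> set span_list}}" by (cases ij) auto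
  qed (fastforce simp: image_subset_iff)
  finally show ?case .
qed

lemma distinct_assignments: "distinct (assignments xs)"
proof (induction xs rule: rev_induct)
  case Nil
  then show ?case by (simp add: assignments_def)
next
  case (snoc x xs)
  have "distinct (concat (map (\<lambda>t. map (\<lambda>ij. (x, ij) # t) span_list) (assignments xs)))"
    using snoc distinct_span_list by (intro distinct_concat_map) (auto simp: distinct_map inj_on_def)
  then show ?case by (simp add: assignments_def)
qed

lemma length_assignments: "length (assignments xs) = length span_list ^ length xs"
proof (induction xs rule: rev_induct)
  case Nil
  then show ?case by (simp add: assignments_def)
next
  case (snoc x xs)
  have "length (concat (map (\<lambda>t. map (\<lambda>ij. (x, ij) # t) span_list) us)) =
      length us * length span_list" for us :: "('v \<times> span) list list"
    by (induction us) auto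
  then show ?case using snoc by (simp add: assignments_def)
qed

abbreviation occurring :: "'v \<Rightarrow> bool" where
  "occurring x \<equiv> x \<in> fst ` set S \<union> snd ` set S"

definition bound_vars :: "'v list" where
  "bound_vars = rev (filter occurring vs)"

definition free_vars :: "'v list" where
  "free_vars = rev (filter (\<lambda>x. \<not> occurring x) vs)"

text \<open>A selection names at most two variables. This limits the exhaustive part to at most
  \<open>(n + 1) ^ (4 * length S)\<close> assignments.\<close>

lemma length_bound_vars: "length bound_vars \<le> 2 * length S"
proof -
  have "length bound_vars = card (set (filter occurring vs))"
    using vs(1) by (simp add: bound_vars_def distinct_card del: set_filter)
  also have "\<dots> \<le> card (fst ` set S \<union> snd ` set S)"
    by (intro card_mono) auto
  also have "\<dots> \<le> card (fst ` set S) + card (snd ` set S)" by (rule card_Un_le)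
  also have "\<dots> \<le> length S + length S"
    using card_image_le[of "set S" fst] card_image_le[of "set S" snd] card_length[of S] by simp
  finally show ?thesis by simp
qed

definition enc_node :: "('v \<times> span) list \<times> 'v list \<Rightarrow> tree" where
  "enc_node = (\<lambda>(t, xs). Pair (enc_assignment t) (enc_list (map enc_var xs)))"

text \<open>Filtering by \<open>live\<close> already here ensures that no node of the stack is ever
  a dead end. The reversal comes from pushing onto a list.\<close>

definition initial_nodes :: "(('v \<times> span) list \<times> 'v list) list" where
  "initial_nodes = map (\<lambda>t. (t, free_vars)) (rev (filter
     (\<lambda>t. val selected [enc_assignment t, equalities, table] \<noteq> Nil \<and> live A s t)
     (assignments bound_vars)))"

lemma val_occurs_var: "val occurs [enc_var x, equalities, z] = truth (occurring x)"
  by (simp add: equalities_def enc_eq_def) (rule arg_cong[of _ _ truth], force)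

lemma val_bound_vars:
  "foldl (\<lambda>a x. if val occurs [x, equalities, Nil] \<noteq> Nil then Pair x a else a) Nil (map enc_var vs) =
    enc_list (map enc_var bound_vars)"
  using foldl_filter[of "\<lambda>x. val occurs [x, equalities, Nil] \<noteq> Nil" "\<lambda>x. x" "[]" "map enc_var vs"]
  by (simp add: filter_map comp_def val_occurs_var bound_vars_def rev_map del: val_occurs)

lemma val_free_vars:
  "foldl (\<lambda>a x. if val occurs [x, equalities, Nil] \<noteq> Nil then a else Pair x a) Nil (map enc_var vs) =
    enc_list (map enc_var free_vars)"
proof -
  have "foldl (\<lambda>a x. if val occurs [x, equalities, Nil] \<noteq> Nil then a else Pair x a) Nil (map enc_var vs) =
      foldl (\<lambda>a x. if \<not> val occurs [x, equalities, Nil] \<noteq> Nil then Pair x a else a) Nil (map enc_var vs)"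
    by (rule foldl_cong) auto
  then show ?thesis
    using foldl_filter[of "\<lambda>x. \<not> val occurs [x, equalities, Nil] \<noteq> Nil" "\<lambda>x. x" "[]" "map enc_var vs"]
    by (simp add: filter_map comp_def val_occurs_var free_vars_def rev_map del: val_occurs)
qed

lemma val_initial_nodes:
  "foldl (\<lambda>a x. if val selected [x, equalities, table] \<noteq> Nil
       then if val alive [x, context_tree, Nil] \<noteq> Nil
         then Pair (Pair x (enc_list (map enc_var free_vars))) a else a
       else a) Nil (map enc_assignment (assignments bound_vars)) =
    enc_list (map enc_node initial_nodes)"
proof -
  let ?P = "\<lambda>x. val selected [x, equalities, table] \<noteq> Nil \<and> val alive [x, context_tree, Nil] \<noteq> Nil"
  have "foldl (\<lambda>a x. if val selected [x, equalities, table] \<noteq> Nil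
       then if val alive [x, context_tree, Nil] \<noteq> Nil
         then Pair (Pair x (enc_list (map enc_var free_vars))) a else a
       else a) Nil (map enc_assignment (assignments bound_vars)) =
     foldl (\<lambda>a x. if ?P x then Pair (Pair x (enc_list (map enc_var free_vars))) a else a)
       Nil (map enc_assignment (assignments bound_vars))"
    by (rule foldl_cong) auto
  then show ?thesis
    using foldl_filter[of ?P "\<lambda>x. Pair x (enc_list (map enc_var free_vars))" "[]"
        "map enc_assignment (assignments bound_vars)"]
    by (simp add: filter_map comp_def val_alive initial_nodes_def enc_node_def rev_map)
qed

end

lemma size_enc_list: "(\<And>x. x \<in> set xs \<Longrightarrow> size x \<le> b) \<Longrightarrow> size (enc_list xs) \<le> length xs * Suc b"
proof (induction xs)
  case (Cons x xs)
  then have "size x \<le> b" "size (enc_list xs) \<le> length xs * Suc b" by auto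
  then show ?case by simp
qed simp

context problem
begin

lemma val_initialize:
  "val initialize [input dQ] =
    Pair (enc_list (map enc_node initial_nodes)) (Pair span_tree context_tree)"
proof -
  have ctx: "Pair table (Pair arrows (Pair (Pair (enc_nat (init A)) (Pair true Nil))
      (Pair (enc_nat (final A)) (head (head table))))) = context_tree"
    by (simp add: context_tree_def table_def last_entry_def)
  show ?thesis
    unfolding initialize_def
    by (simp add: lookup_def input_def val_positions val_spans_table ctx val_bound_vars
        val_free_vars foldl_assign_all val_initial_nodes del: val_occurs)
qed

end

text \<open>\<open>K\<close> bounds the parts of the input, \<open>B\<close> everything that is
  compared or traversed. Single entries and codes of configurations are linear in \<open>K\<close>;
  assignments, the table, the edge list and the list of spans are quadratic, which
  \<open>20 * (K * K)\<close> covers generously; the power counts the assignments of selected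
  variables.\<close>

locale sized_problem = problem lc vc A S s vs ts
  for lc :: "'a::finite \<Rightarrow> nat" and vc :: "'v \<Rightarrow> nat"
    and A :: "('a, 'v, nat) automaton" and S s vs ts +
  fixes K B :: nat
  assumes size_var: "x \<in> Vars A \<Longrightarrow> size (enc_var x) \<le> K"
    and length_vs: "length vs \<le> K" and length_ts: "length ts \<le> K"
    and size_transition: "tr \<in> set ts \<Longrightarrow> size (enc_transition tr) \<le> K"
    and length_S: "length S \<le> K" and length_s: "length s < K"
    and size_symbol: "a \<in> set s \<Longrightarrow> size (enc_nat (lc a)) \<le> K"
    and size_init: "size (enc_nat (init A)) \<le> K" and size_final: "size (enc_nat (final A)) \<le> K"
    and B_square: "20 * (K * K) \<le> B" and B_power: "(K * K) ^ (2 * length S) \<le> B"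
begin

section \<open>Bounds on the trees that arise\<close>

lemma K_pos: "1 \<le> K"
  using length_s by simp

lemma K_square: "K \<le> K * K"
  using K_pos by simp

lemma K_le_B: "k \<le> 20 * K \<Longrightarrow> k \<le> B"
  using K_square B_square by linarith

lemma size_position: "k \<le> Suc n \<Longrightarrow> size (enc_nat k) \<le> 2 * K"
  using size_enc_nat[of k] length_s by simp

definition partial :: "('v \<times> span) list \<Rightarrow> bool" where
  "partial t \<longleftrightarrow> fst ` set t \<subseteq> Vars A \<and> snd ` set t \<subseteq> set span_list \<and> length t \<le> length vs"

lemma size_binding:
  assumes "partial t" "b \<in> set t"
  shows "size (enc_binding b) \<le> 5 * K + 2"
proof -
  obtain x i j where b: "b = (x, i, j)" by (cases b) auto
  then have "x \<in> Vars A" "i \<le> Suc n" "j \<le> Suc n"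
    using assms by (force simp: partial_def set_span_list)+
  then show ?thesis
    using size_var[of x] size_position[of i] size_position[of j] by (simp add: b)
qed

lemma size_assignment:
  assumes "partial t"
  shows "size (enc_assignment t) \<le> B"
proof -
  have "size (enc_assignment t) \<le> length (map enc_binding t) * Suc (5 * K + 2)"
    unfolding enc_assignment_def
    by (rule size_enc_list) (use size_binding[OF assms] in force)
  also have "\<dots> \<le> K * Suc (5 * K + 2)"
    using assms length_vs unfolding length_map by (intro mult_le_mono1) (simp add: partial_def)
  also have "\<dots> = 5 * (K * K) + 3 * K" by (simp add: algebra_simps)
  also have "\<dots> \<le> B" using K_square B_square by linarith
  finally show ?thesis .
qed

lemma partial_bounds:
  assumes "partial t"
  shows "\<forall>e\<in>set (spine (enc_assignment t)). size e \<le> B" "length (spine (enc_assignment t)) \<le> B"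
proof -
  have "size (enc_binding b) \<le> B" if "b \<in> set t" for b
    using size_binding[OF assms that] K_pos by (intro K_le_B) linarith
  then show "\<forall>e\<in>set (spine (enc_assignment t)). size e \<le> B" by simp
  show "length (spine (enc_assignment t)) \<le> B"
    using assms length_vs by (auto simp: partial_def intro!: K_le_B)
qed

lemma size_table_entry:
  assumes "e \<in> set (spine table)"
  shows "size e \<le> 5 * K + 3"
proof -
  consider "e = last_entry" | k where "k < n" "e = entry s k"
    using assms by (auto simp: spine_table)
  then show ?thesis
  proof cases
    case 1
    then show ?thesis using size_position[of "Suc n"] by (simp add: last_entry_def)
  next
    case 2
    have "s ! k \<in> set s" using 2 by simp
    then show ?thesis
      using size_position[of "Suc k"] size_position[of "Suc (Suc k)"] size_symbol[of "s ! k"] 2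
      by (simp add: entry_def enc_symbol_def)
  qed
qed

lemma length_table: "length (spine table) = Suc n"
  by (simp add: spine_table)

lemma table_bounds:
  "\<forall>e\<in>set (spine table). size e \<le> B" "length (spine table) \<le> B" "size table \<le> B"
proof -
  have "size e \<le> B" if "e \<in> set (spine table)" for e
    using size_table_entry[OF that] K_pos by (intro K_le_B) linarith
  then show "\<forall>e\<in>set (spine table). size e \<le> B" by blast
  show "length (spine table) \<le> B"
    using length_s by (auto simp: length_table intro!: K_le_B)
  have "size table \<le> length (spine table) * Suc (5 * K + 3)"
    using size_enc_list[OF size_table_entry, of "spine table"] by simp
  also have "\<dots> \<le> K * Suc (5 * K + 3)"
    using length_s by (intro mult_le_mono1) (simp add: length_table)
  also have "\<dots> = 5 * (K * K) + 4 * K" by (simp add: algebra_simps)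
  also have "\<dots> \<le> B" using K_square B_square by linarith
  finally show "size table \<le> B" .
qed

lemma arrows_bounds: "\<forall>e\<in>set (spine arrows). size e \<le> B" "length (spine arrows) \<le> B"
  using size_transition length_ts K_le_B[of K] by (force simp: arrows_def intro: order_trans)+

lemma equalities_bounds:
  "\<forall>e\<in>set (spine equalities). size e \<le> B" "length (spine equalities) \<le> B"
proof -
  have "size (enc_eq (x, y)) \<le> B" if "(x, y) \<in> set S" for x y
    using that S_vars size_var[of x] size_var[of y] K_pos
    by (intro K_le_B) (auto simp: enc_eq_def)
  then show "\<forall>e\<in>set (spine equalities). size e \<le> B" by (auto simp: equalities_def)
  show "length (spine equalities) \<le> B"
    using length_S by (auto simp: equalities_def intro!: K_le_B)
qed

lemma length_span_list_le: "length span_list \<le> K * K"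
  unfolding length_span_list using length_s by (intro mult_le_mono) auto

lemma span_tree_bound: "length (spine span_tree) \<le> B"
  using length_span_list_le B_square by (simp add: span_tree_def)

lemma bounded_alive:
  assumes "partial t"
  shows "bounded alive [enc_assignment t, context_tree, z] B"
proof -
  let ?E = "val edges [enc_assignment t, table, arrows]"
  have "size e \<le> B" if e: "e \<in> set (spine ?E)" for e
  proof -
    obtain p k q k' where m: "((p, k), (q, k')) \<in> move A s t"
      and e: "e = Pair (configuration (p, k)) (configuration (q, k'))"
      using e unfolding set_edges by auto
    from m obtain l where l: "(p, l, q) \<in> set ts" "k \<le> n" "k' \<le> n"
      using ts by (auto simp: move_def)
    then have "size (enc_nat p) \<le> K" "size (enc_nat q) \<le> K"
      using size_transition[OF l(1)] by (simp_all add: enc_transition_def)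
    then show ?thesis
      using size_position[of "Suc k"] size_position[of "Suc k'"] l(2,3) K_pos
      by (intro K_le_B) (simp add: e)
  qed
  moreover have "length (spine ?E) + 1 \<le> B"
  proof -
    have "length (spine ?E) \<le> length (spine table) * length (spine arrows)" by (rule val_edges(2))
    also have "\<dots> \<le> K * K"
      using length_s length_ts by (intro mult_le_mono) (simp_all add: length_table arrows_def)
    finally show ?thesis using B_square K_square K_pos by linarith
  qed
  moreover have "size (configuration (init A, 0)) \<le> B"
    using size_position[of "Suc 0"] size_init K_pos
    by (intro K_le_B) (simp del: enc_nat_1)
  moreover have "size (configuration (final A, n)) \<le> B"
    using size_position[of "Suc n"] size_final K_pos by (intro K_le_B) simp
  ultimately have "bounded reach [?E, configuration (init A, 0), configuration (final A, n)] B"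
    by (intro bounded_reach) auto
  moreover have "bounded edges [enc_assignment t, table, arrows] B"
    by (intro bounded_edges partial_bounds[OF assms] table_bounds arrows_bounds)
  ultimately show ?thesis
    by (simp add: alive_def lookup_def context_tree_def del: configuration.simps)
qed

lemma length_assignments_le:
  assumes "length xs \<le> 2 * length S"
  shows "length (assignments xs) \<le> B"
proof -
  have "length (assignments xs) \<le> (K * K) ^ length xs"
    unfolding length_assignments by (intro power_mono length_span_list_le) simp
  also have "\<dots> \<le> (K * K) ^ (2 * length S)"
    using assms K_pos by (intro power_increasing) simp_all
  finally show ?thesis using B_power by linarith
qed

lemma bound_vars_subset: "set bound_vars \<subseteq> Vars A"
  using vs by (auto simp: bound_vars_def)

lemma partial_assignments: "t \<in> set (assignments bound_vars) \<Longrightarrow> partial t"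
proof -
  assume "t \<in> set (assignments bound_vars)"
  then have t: "map fst t = rev bound_vars" "snd ` set t \<subseteq> set span_list"
    by (simp_all add: set_assignments)
  have "fst ` set t = set bound_vars" "length t = length bound_vars"
    using arg_cong[OF t(1), of set] arg_cong[OF t(1), of length] by simp_all
  then show "partial t"
    using bound_vars_subset t(2) by (simp add: partial_def bound_vars_def)
qed

lemma bounded_initialize: "bounded initialize [input dQ] B"
proof -
  have occ: "bounded occurs [enc_var x, equalities, Nil] B" if "x \<in> set vs" for x
    using that vs size_var[of x] K_le_B[of K]
    by (intro bounded_occurs equalities_bounds) auto
  have vs_le: "length vs \<le> B" using length_vs by (intro K_le_B) simp
  have 1: "bounded positions [enc_list (map (\<lambda>a. enc_nat (lc a)) s), Nil, Nil] B"
    using length_s B_square K_square by (intro bounded_positions) linarith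
  have 2: "bounded spans [table, Nil, Nil] B"
    by (intro bounded_spans table_bounds)
  have ctx: "Pair table (Pair arrows (Pair (Pair (enc_nat (init A)) (Pair true Nil))
      (Pair (enc_nat (final A)) (head (head table))))) = context_tree"
    by (simp add: context_tree_def table_def last_entry_def)
  have 3: "bounded (Fold (First (First (Arg 0))) Leaf
      (Cond (Call occurs (Arg 5) (First (Rest (Arg 0))) Leaf) (Node (Arg 5) (Arg 4)) (Arg 4)))
      [input dQ, table, span_tree, context_tree] B"
    by (rule bounded_FoldI[where P = "\<lambda>_. True"])
      (use occ vs_le in \<open>auto simp: lookup_def input_def\<close>)
  have 4: "bounded (Fold (First (First (Arg 0))) Leaf
      (Cond (Call occurs (Arg 6) (First (Rest (Arg 0))) Leaf) (Arg 5) (Node (Arg 6) (Arg 5))))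
      [input dQ, table, span_tree, context_tree, enc_list (map enc_var bound_vars)] B"
    by (rule bounded_FoldI[where P = "\<lambda>_. True"])
      (use occ vs_le in \<open>auto simp: lookup_def input_def\<close>)
  have 5: "bounded (Fold (Arg 4) (Node Leaf Leaf) (Call assign_all (Arg 6) (Arg 7) (Arg 2)))
      [input dQ, table, span_tree, context_tree, enc_list (map enc_var bound_vars),
       enc_list (map enc_var free_vars)] B"
  proof -
    \<comment> \<open>The intermediate accumulators are the assignments of initial segments of
      \<open>bound_vars\<close>, so the count for lists of at most \<open>2 * length S\<close>
      variables applies to them too.\<close>
    have "bounded assign_all [foldl (\<lambda>a x. val assign_all [a, x, span_tree]) (Pair Nil Nil)
        (take k (map enc_var bound_vars)), x, span_tree] B" for k x
      unfolding take_map foldl_assign_all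
      using length_bound_vars
      by (intro bounded_assign_all span_tree_bound) (auto intro!: length_assignments_le)
    moreover have "length bound_vars \<le> B"
      using vs_le by (simp add: bound_vars_def) (meson le_trans length_filter_le)
    ultimately show ?thesis
      by (simp add: lookup_def)
  qed
  have 6: "bounded (Fold (Arg 6) Leaf
      (Cond (Call selected (Arg 8) (First (Rest (Arg 0))) (Arg 1))
        (Cond (Call alive (Arg 8) (Arg 3) Leaf) (Node (Node (Arg 8) (Arg 5)) (Arg 7)) (Arg 7))
        (Arg 7)))
      [input dQ, table, span_tree, context_tree, enc_list (map enc_var bound_vars),
       enc_list (map enc_var free_vars), enc_list (map enc_assignment (assignments bound_vars))] B"
  proof (rule bounded_FoldI[where P = "\<lambda>_. True"])
    fix a x
    assume "x \<in> set (spine (val (Arg 6) [input dQ, table, span_tree, context_tree,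
      enc_list (map enc_var bound_vars), enc_list (map enc_var free_vars),
      enc_list (map enc_assignment (assignments bound_vars))]))"
    then obtain t where t: "t \<in> set (assignments bound_vars)" "x = enc_assignment t"
      by (auto simp: lookup_def)
    have "bounded selected [enc_assignment t, equalities, table] B"
      by (intro bounded_selected partial_bounds partial_assignments t(1) table_bounds
          equalities_bounds)
    moreover have "bounded alive [enc_assignment t, context_tree, Nil] B"
      by (intro bounded_alive partial_assignments t(1))
    ultimately show "True \<and> bounded (Cond (Call selected (Arg 8) (First (Rest (Arg 0))) (Arg 1))
        (Cond (Call alive (Arg 8) (Arg 3) Leaf) (Node (Node (Arg 8) (Arg 5)) (Arg 7)) (Arg 7))
        (Arg 7)) ([input dQ, table, span_tree, context_tree, enc_list (map enc_var bound_vars),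
       enc_list (map enc_var free_vars), enc_list (map enc_assignment (assignments bound_vars))] @ [a, x]) B"
      by (simp add: lookup_def t(2) input_def)
  qed (use length_assignments_le[OF length_bound_vars] in \<open>simp_all add: lookup_def\<close>)
  show ?thesis
    unfolding initialize_def bounded.simps(8)
    using 1 2 3 4 5 6
    by (simp add: lookup_def val_positions val_spans_table ctx val_bound_vars
        val_free_vars foldl_assign_all input_def del: val_occurs bounded.simps(9))
qed

end

section \<open>Depth-first search\<close>

text \<open>
  The first answer comes after at most \<open>g\<close> units of time, later gaps have length at most \<open>D\<close>.
\<close>

fun gaps_le :: "nat \<Rightarrow> nat \<Rightarrow> trace \<Rightarrow> bool" where
  "gaps_le D g [] = True"
| "gaps_le D g (None # t) = (g > 0 \<and> gaps_le D (g - 1) t)"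
| "gaps_le D g (Some d # t) = gaps_le D D t"

lemma gaps_le_mono: "gaps_le D g t \<Longrightarrow> D \<le> D' \<Longrightarrow> g \<le> g' \<Longrightarrow> gaps_le D' g' t"
proof (induction D g t arbitrary: g' rule: gaps_le.induct)
  case (2 D g t)
  from 2(1)[of "g' - 1"] 2(2-) show ?case by simp
qed auto

lemma gaps_le_ticks: "gaps_le D (g - k) t \<Longrightarrow> k \<le> g \<Longrightarrow> gaps_le D g (ticks k @ t)"
proof (induction k arbitrary: g)
  case (Suc k)
  then have "gaps_le D (g - 1 - k) t" "k \<le> g - 1" by simp_all
  then show ?case using Suc.IH[of "g - 1"] Suc.prems(2) by simp
qed simp

lemma gaps_le_ticksD: "gaps_le D g (ticks k @ t) \<Longrightarrow> k \<le> g"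
proof (induction k arbitrary: g)
  case (Suc k)
  from Suc(1)[of "g - 1"] Suc(2) show ?case by auto
qed simp

text \<open>\<open>gaps_le\<close> composes along a run, \<open>delay_le\<close> speaks of arbitrary
  blocks of ticks. The induction is generalized to any current budget \<open>g\<close> below
  \<open>D\<close>, since answers reset it.\<close>

lemma delay_le_gaps:
  assumes "gaps_le D D t"
  shows "delay_le t D"
proof -
  have "k \<le> D" if "gaps_le D g (u @ ticks k @ w)" "g \<le> D" for u k w g
    using that
  proof (induction u arbitrary: g)
    case Nil
    then show ?case using gaps_le_ticksD[of D g k w] by simp
  next
    case (Cons e u)
    show ?case
    proof (cases e)
      case None
      then show ?thesis using Cons.IH[of "g - 1"] Cons.prems by simp
    next
      case (Some d)
      then show ?thesis using Cons.IH[of D] Cons.prems by simp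
    qed
  qed
  then show ?thesis using assms by (auto simp: delay_le_def)
qed

lemma answers_simps [simp]:
  "answers (t @ t') = answers t @ answers t'"
  "answers (ticks k) = []"
  "answers [] = []" "answers (None # t) = answers t" "answers (Some d # t) = d # answers t"
  by (auto simp: answers_def List.map_filter_def)

text \<open>Registers 2, 3 and 4 hold the stack, the spans and the context; 5 and above are scratch
  space. The tail of the top node is its list of unassigned variables, so \<open>Nil\<close> marks a
  leaf.\<close>

definition search :: com where
  "search = While (Var 2)
     (If (Tl (Hd (Var 2)))
       (Seq (compile step [2, 3, 4] 5) (Assign 2 (Var 5)))
       (Seq (Emit (Hd (Hd (Var 2)))) (Assign 2 (Tl (Var 2)))))"

definition enumerator :: com where
  "enumerator =
     Seq (compile initialize [0] 1)
     (Seq (Assign 2 (Hd (Var 1)))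
     (Seq (Assign 3 (Hd (Tl (Var 1))))
     (Seq (Assign 4 (Tl (Tl (Var 1)))) search)))"

section \<open>The search tree and its leaves\<close>

context problem
begin

definition children :: "'v \<Rightarrow> ('v \<times> span) list \<Rightarrow> ('v \<times> span) list list" where
  "children x t = rev (map (\<lambda>ij. (x, ij) # t) (filter (\<lambda>ij. live A s ((x, ij) # t)) span_list))"

primrec leaves :: "'v list \<Rightarrow> ('v \<times> span) list \<Rightarrow> ('v \<times> span) list list" where
  "leaves [] t = [t]"
| "leaves (x # xs) t = concat (map (leaves xs) (children x t))"

lemma spanner_span_list:
  "\<mu> \<in> spanner A s \<Longrightarrow> x \<in> Vars A \<Longrightarrow> \<exists>ij \<in> set span_list. \<mu> x = Some ij"
  using spanner_span[of \<mu> A s x] by (force simp: set_span_list)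

lemma live_agrees: "fst ` set t \<subseteq> Vars A \<Longrightarrow> live A s t \<longleftrightarrow> (\<exists>\<mu>\<in>spanner A s. agrees \<mu> t)"
  using live_iff[OF automaton functional] .

text \<open>For empty \<open>xs\<close> the right-hand side is \<open>{t}\<close>, because a live
  assignment is extended by at least one tuple. In the step, a tuple itself selects the child
  through its span for \<open>x\<close>.\<close>

lemma set_leaves:
  assumes "live A s t" "fst ` set t \<subseteq> Vars A" "set xs \<subseteq> Vars A"
  shows "set (leaves xs t) =
    {map (\<lambda>x. (x, the (\<mu> x))) (rev xs) @ t | \<mu>. \<mu> \<in> spanner A s \<and> agrees \<mu> t}"
  using assms
proof (induction xs arbitrary: t)
  case Nil
  then show ?case using live_agrees by auto
next
  case (Cons x xs)
  have "u \<in> set (leaves (x # xs) t) \<longleftrightarrow>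
      (\<exists>\<mu>. u = map (\<lambda>x. (x, the (\<mu> x))) (rev (x # xs)) @ t \<and> \<mu> \<in> spanner A s \<and> agrees \<mu> t)" for u
  proof
    assume "u \<in> set (leaves (x # xs) t)"
    then obtain ij where "live A s ((x, ij) # t)" "u \<in> set (leaves xs ((x, ij) # t))"
      by (auto simp: children_def)
    then obtain \<mu> where "u = map (\<lambda>x. (x, the (\<mu> x))) (rev xs) @ (x, ij) # t"
        "\<mu> \<in> spanner A s" "agrees \<mu> ((x, ij) # t)"
      using Cons.IH[of "(x, ij) # t"] Cons.prems by auto
    then show "\<exists>\<mu>. u = map (\<lambda>x. (x, the (\<mu> x))) (rev (x # xs)) @ t \<and> \<mu> \<in> spanner A s \<and> agrees \<mu> t"
      by (intro exI[of _ \<mu>]) simp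
  next
    assume "\<exists>\<mu>. u = map (\<lambda>x. (x, the (\<mu> x))) (rev (x # xs)) @ t \<and> \<mu> \<in> spanner A s \<and> agrees \<mu> t"
    then obtain \<mu> where \<mu>: "u = map (\<lambda>x. (x, the (\<mu> x))) (rev (x # xs)) @ t"
        "\<mu> \<in> spanner A s" "agrees \<mu> t" by blast
    obtain ij where ij: "ij \<in> set span_list" "\<mu> x = Some ij"
      using spanner_span_list[OF \<mu>(2), of x] Cons.prems by auto
    have sub: "fst ` set ((x, ij) # t) \<subseteq> Vars A" using Cons.prems by simp
    have agrees: "agrees \<mu> ((x, ij) # t)" using \<mu> ij by simp
    have live: "live A s ((x, ij) # t)" using live_agrees[OF sub] agrees \<mu>(2) by blast
    have "u \<in> set (leaves xs ((x, ij) # t))"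
      unfolding Cons.IH[OF live sub order_trans[OF set_subset_Cons Cons.prems(3)]]
      using \<mu> ij agrees by auto
    moreover have "(x, ij) # t \<in> set (children x t)" using ij live by (auto simp: children_def)
    ultimately show "u \<in> set (leaves (x # xs) t)" by auto
  qed
  then show ?case by blast
qed

text \<open>A leaf contains its ancestor as a suffix of known length; subtrees of different siblings
  are therefore disjoint.\<close>

lemma drop_leaves: "u \<in> set (leaves xs t) \<Longrightarrow> drop (length xs) u = t"
proof (induction xs arbitrary: t)
  case (Cons x xs)
  then obtain ij where "u \<in> set (leaves xs ((x, ij) # t))" by (auto simp: children_def)
  then have "drop (length xs) u = (x, ij) # t" by (rule Cons.IH)
  then show ?case using drop_Suc[of "length xs" u] by (metis length_Cons list.sel(3) tl_drop)
qed simp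

lemma distinct_leaves: "distinct (leaves xs t)"
proof (induction xs arbitrary: t)
  case (Cons x xs)
  have "distinct (children x t)"
    using distinct_span_list by (simp add: children_def distinct_map inj_on_def)
  moreover have "u = v" if "w \<in> set (leaves xs u)" "w \<in> set (leaves xs v)" for u v w
    using drop_leaves that by metis
  ultimately show ?case
    unfolding leaves.simps by (intro distinct_concat_map Cons) blast+
qed simp

definition assignment_of :: "'v tuple \<Rightarrow> ('v \<times> span) list" where
  "assignment_of \<mu> = map (\<lambda>x. (x, the (\<mu> x))) (rev free_vars @ rev bound_vars)"

lemma agrees_eq: "agrees \<mu> t \<Longrightarrow> map (\<lambda>x. (x, the (\<mu> x))) (map fst t) = t"
  by (induction t) (auto simp: agrees_def)

lemma set_vars: "set bound_vars \<union> set free_vars = Vars A" "distinct (rev free_vars @ rev bound_vars)"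
  using vs by (auto simp: bound_vars_def free_vars_def)

lemma map_of_assignment_of:
  assumes "\<mu> \<in> spanner A s"
  shows "map_of (assignment_of \<mu>) = \<mu>"
proof
  fix x
  have "set (rev free_vars @ rev bound_vars) = dom \<mu>"
    using spanner_dom[OF assms] set_vars(1) by auto
  then have "map_of (assignment_of \<mu>) = (Some \<circ> (\<lambda>x. the (\<mu> x))) |` dom \<mu>"
    unfolding assignment_of_def map_of_map_restrict by simp
  then show "map_of (assignment_of \<mu>) x = \<mu> x"
    by (cases "\<mu> x") (auto simp: restrict_map_def)
qed

definition all_leaves :: "('v \<times> span) list list" where
  "all_leaves = concat (map (\<lambda>(t, xs). leaves xs t) initial_nodes)"

lemma set_initial_nodes:
  "(t, xs) \<in> set initial_nodes \<longleftrightarrow> xs = free_vars \<and> map fst t = rev bound_vars \<and>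
    snd ` set t \<subseteq> set span_list \<and> live A s t \<and>
    val selected [enc_assignment t, equalities, table] \<noteq> Nil"
  by (auto simp: initial_nodes_def set_assignments)

lemma bound_vars_occurring:
  assumes "map fst t = rev bound_vars"
  shows "fst ` set t \<subseteq> Vars A" "fst ` set S \<union> snd ` set S \<subseteq> fst ` set t"
proof -
  have t: "fst ` set t = set bound_vars"
    using arg_cong[OF assms, of set] by simp
  show "fst ` set t \<subseteq> Vars A" using t set_vars(1) by auto
  show "fst ` set S \<union> snd ` set S \<subseteq> fst ` set t"
    unfolding t using S_vars vs(2) by (auto simp: bound_vars_def image_iff)
qed

lemma set_all_leaves: "set all_leaves = assignment_of ` select_eq S A s"
proof (intro equalityI subsetI)
  fix u assume "u \<in> set all_leaves"
  then obtain t where t: "(t, free_vars) \<in> set initial_nodes" "u \<in> set (leaves free_vars t)"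
    by (auto simp: all_leaves_def set_initial_nodes)
  then have t': "map fst t = rev bound_vars" "live A s t"
      "val selected [enc_assignment t, equalities, table] \<noteq> Nil"
    by (simp_all add: set_initial_nodes)
  obtain \<mu> where \<mu>: "\<mu> \<in> spanner A s" "agrees \<mu> t" "u = map (\<lambda>x. (x, the (\<mu> x))) (rev free_vars) @ t"
    using t(2) set_leaves[OF t'(2) bound_vars_occurring(1)[OF t'(1)], of free_vars] set_vars(1)
    by auto
  have "u = assignment_of \<mu>"
    using agrees_eq[OF \<mu>(2)] t'(1) \<mu>(3) by (simp add: assignment_of_def)
  moreover have "\<mu> \<in> select_eq S A s"
    using val_selected_agrees[OF \<mu>(1,2) bound_vars_occurring(2)[OF t'(1)]] t'(3) by simp
  ultimately show "u \<in> assignment_of ` select_eq S A s" by blast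
next
  fix u assume "u \<in> assignment_of ` select_eq S A s"
  then obtain \<mu> where \<mu>: "\<mu> \<in> select_eq S A s" "u = assignment_of \<mu>" by blast
  then have sp: "\<mu> \<in> spanner A s" by (simp add: select_eq_def)
  define t where "t = map (\<lambda>x. (x, the (\<mu> x))) (rev bound_vars)"
  have fst: "map fst t = rev bound_vars" by (simp add: t_def comp_def)
  have defined: "\<exists>ij\<in>set span_list. \<mu> x = Some ij" if "x \<in> set bound_vars" for x
    using spanner_span_list[OF sp, of x] that set_vars(1) by blast
  have agrees: "agrees \<mu> t"
    using defined by (force simp: agrees_def t_def)
  have snd: "snd ` set t \<subseteq> set span_list"
    using defined by (force simp: t_def)
  have live: "live A s t"
    using live_agrees[OF bound_vars_occurring(1)[OF fst]] agrees sp by blast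
  have "(t, free_vars) \<in> set initial_nodes"
    using val_selected_agrees[OF sp agrees bound_vars_occurring(2)[OF fst]] \<mu>(1) fst snd live
    by (simp add: set_initial_nodes)
  moreover have "u \<in> set (leaves free_vars t)"
  proof -
    have "u = map (\<lambda>x. (x, the (\<mu> x))) (rev free_vars) @ t"
      by (simp add: \<mu>(2) assignment_of_def t_def)
    then show ?thesis
      using set_leaves[OF live bound_vars_occurring(1)[OF fst], of free_vars] set_vars(1) sp agrees
      by blast
  qed
  ultimately show "u \<in> set all_leaves" by (force simp: all_leaves_def)
qed

lemma distinct_all_leaves: "distinct all_leaves"
proof -
  have "distinct initial_nodes"
    unfolding initial_nodes_def using distinct_assignments
    by (simp add: distinct_map inj_on_def)
  then show ?thesis
    unfolding all_leaves_def
  proof (rule distinct_concat_map)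
    fix x y z
    assume "x \<in> set initial_nodes" "y \<in> set initial_nodes"
      and z: "z \<in> set (case x of (t, xs) \<Rightarrow> leaves xs t)" "z \<in> set (case y of (t, xs) \<Rightarrow> leaves xs t)"
    \<comment> \<open>All roots have the same unassigned variables, so dropping equally many entries
      from the common leaf recovers both.\<close>
    then have "snd x = free_vars" "snd y = free_vars" by (auto simp: initial_nodes_def)
    then show "x = y"
      using z drop_leaves[of z free_vars "fst x"] drop_leaves[of z free_vars "fst y"]
      by (simp add: case_prod_beta prod_eq_iff)
  qed (auto simp: distinct_leaves)
qed

text \<open>\<open>map_of\<close> inverts \<open>assignment_of\<close>, so distinct leaves are
  distinct tuples. The list at a leaf enumerates the graph of its tuple and can be emitted as it
  stands.\<close>

lemma all_leaves_select:
  "distinct (map map_of all_leaves)" "set (map map_of all_leaves) = select_eq S A s"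
  "list_all2 (tuple_code vc) (map enc_assignment all_leaves) (map map_of all_leaves)"
proof -
  have id: "map_of (assignment_of \<mu>) = \<mu>" if "\<mu> \<in> select_eq S A s" for \<mu>
    using that by (simp add: map_of_assignment_of select_eq_def)
  have "inj_on map_of (assignment_of ` select_eq S A s)"
    by (auto simp: inj_on_def id)
  then show "distinct (map map_of all_leaves)"
    using distinct_all_leaves by (simp add: distinct_map set_all_leaves)
  show "set (map map_of all_leaves) = select_eq S A s"
    by (simp add: set_all_leaves image_image id)
  have "tuple_code vc (enc_assignment t) (map_of t)" if "t \<in> set all_leaves" for t
  proof -
    have "distinct (map fst t)"
      using that set_vars(2) by (auto simp: set_all_leaves assignment_of_def comp_def)
    moreover have "(\<lambda>(x, i, j). Pair (enc_nat (vc x)) (Pair (enc_nat i) (enc_nat j))) = enc_binding"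
      by (auto simp: fun_eq_iff enc_var_def)
    ultimately show ?thesis
      unfolding tuple_code_def set_code_def
      by (intro exI[of _ t])
        (auto simp: graph_map_of_if_distinct_dom enc_assignment_def distinct_map)
  qed
  then show "list_all2 (tuple_code vc) (map enc_assignment all_leaves) (map map_of all_leaves)"
    by (auto simp: list_all2_map1 list_all2_map2 list_all2_same)
qed

end

section \<open>Delay of the search\<close>

context sized_problem
begin

text \<open>An iteration either calls \<open>step\<close> or emits an answer of size at most
  \<open>B\<close>; the constant covers tests and assignments.\<close>

definition step_time :: nat where
  "step_time = time step B + B + 20"

text \<open>The slack of a stack of admissible nodes is at most \<open>(K + 2) * step_time\<close>;
  one more \<open>step_time\<close> pays for the rest of an iteration after its answer.\<close>

definition delay :: nat where
  "delay = (K + 3) * step_time"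

definition node_ok :: "('v \<times> span) list \<times> 'v list \<Rightarrow> bool" where
  "node_ok = (\<lambda>(t, xs). live A s t \<and> fst ` set t \<union> set xs \<subseteq> Vars A \<and>
     snd ` set t \<subseteq> set span_list \<and> length t + length xs \<le> length vs)"

text \<open>
  Bounds the time to the next answer: the topmost node is live, so each step before it
  descends one level.
\<close>

fun slack :: "(('v \<times> span) list \<times> 'v list) list \<Rightarrow> nat" where
  "slack [] = step_time"
| "slack ((t, xs) # _) = (length xs + 2) * step_time"

definition searches :: "(('v \<times> span) list \<times> 'v list) list \<Rightarrow> bool" where
  "searches ns \<longleftrightarrow> (\<forall>\<sigma>. \<sigma> 2 = enc_list (map enc_node ns) \<and> \<sigma> 3 = span_tree \<and> \<sigma> 4 = context_tree \<longrightarrow>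
     (\<exists>t \<sigma>'. exec search \<sigma> t \<sigma>' \<and>
        answers t = map enc_assignment (concat (map (\<lambda>(t, xs). leaves xs t) ns)) \<and>
        gaps_le delay (slack ns) t))"

lemma node_ok_partial: "node_ok (t, xs) \<Longrightarrow> partial t"
  by (auto simp: node_ok_def partial_def)

lemma slack_delay:
  assumes "\<forall>nd\<in>set ns. node_ok nd"
  shows "slack ns + step_time \<le> delay"
proof (cases ns)
  case Nil
  then show ?thesis by (simp add: delay_def algebra_simps)
next
  case (Cons nd ns')
  obtain t xs where "nd = (t, xs)" by (cases nd)
  then have "length xs \<le> K" using assms Cons length_vs by (auto simp: node_ok_def)
  then have "(length xs + 3) * step_time \<le> delay"
    unfolding delay_def by (intro mult_le_mono1) simp
  then show ?thesis using Cons \<open>nd = (t, xs)\<close> by (simp add: algebra_simps)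
qed

lemma searches_Nil: "searches []"
proof -
  have "exec search \<sigma> (ticks 2) \<sigma>" if "\<sigma> 2 = Nil" for \<sigma>
    using exec_while_false[of "Var 2" \<sigma>] that by (simp add: search_def numeral_2_eq_2)
  moreover have "gaps_le delay step_time (ticks 2)"
    using gaps_le_ticks[of delay step_time 2 "[]"] by (simp add: step_time_def)
  ultimately show ?thesis
    unfolding searches_def by (auto intro!: exI[of _ "ticks 2"])
qed

lemma searches_leaf:
  assumes ok: "node_ok (t, [])" "\<forall>nd\<in>set ns. node_ok nd" and ns: "searches ns"
  shows "searches ((t, []) # ns)"
  unfolding searches_def
proof (intro allI impI, elim conjE)
  fix \<sigma> :: store
  assume \<sigma>: "\<sigma> 2 = enc_list (map enc_node ((t, []) # ns))" "\<sigma> 3 = span_tree" "\<sigma> 4 = context_tree"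
  let ?d = "enc_assignment t"
  define \<sigma>1 where "\<sigma>1 = \<sigma>(2 := enc_list (map enc_node ns))"
  obtain u \<sigma>' where u: "exec search \<sigma>1 u \<sigma>'"
      "answers u = map enc_assignment (concat (map (\<lambda>(t, xs). leaves xs t) ns))"
      "gaps_le delay (slack ns) u"
    using ns[unfolded searches_def, rule_format, of \<sigma>1] \<sigma> by (auto simp: \<sigma>1_def)
  have emit: "exec (Emit (Hd (Hd (Var 2)))) \<sigma> (ticks (4 + size ?d) @ [Some ?d]) \<sigma>"
    using exec_emit[of "Hd (Hd (Var 2))" \<sigma>] \<sigma> by (simp add: enc_node_def eval_nat_numeral)
  have assign: "exec (Assign 2 (Tl (Var 2))) \<sigma> (ticks 3) \<sigma>1"
    using exec_assign[of 2 "Tl (Var 2)" \<sigma>] \<sigma> by (simp add: \<sigma>1_def numeral_3_eq_3)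
  have "exec (If (Tl (Hd (Var 2))) (Seq (compile step [2, 3, 4] 5) (Assign 2 (Var 5)))
      (Seq (Emit (Hd (Hd (Var 2)))) (Assign 2 (Tl (Var 2))))) \<sigma>
      (ticks (1 + cost (Tl (Hd (Var 2))) \<sigma>) @ (ticks (4 + size ?d) @ [Some ?d]) @ ticks 3) \<sigma>1"
    by (rule exec_if_false[OF _ exec_seq[OF emit assign]]) (use \<sigma> in \<open>simp add: enc_node_def\<close>)
  then have "exec search \<sigma> (ticks (1 + cost (Var 2) \<sigma>) @ (ticks (1 + cost (Tl (Hd (Var 2))) \<sigma>) @
      (ticks (4 + size ?d) @ [Some ?d]) @ ticks 3) @ u) \<sigma>'"
    unfolding search_def by (intro exec_while_true) (use \<sigma> u(1) in \<open>simp_all add: search_def\<close>)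
  moreover have "gaps_le delay (slack ((t, []) # ns)) (ticks (1 + cost (Var 2) \<sigma>) @
      (ticks (1 + cost (Tl (Hd (Var 2))) \<sigma>) @ (ticks (4 + size ?d) @ [Some ?d]) @ ticks 3) @ u)"
  proof -
    have "size ?d \<le> B" using ok(1) node_ok_partial size_assignment by blast
    \<comment> \<open>The answer has reset the budget to \<open>delay\<close>, which leaves room for
      popping the node and for the slack of the remaining stack.\<close>
    moreover have "gaps_le delay delay (ticks 3 @ u)"
      using slack_delay[OF ok(2)] by (intro gaps_le_ticks gaps_le_mono[OF u(3)]) (auto simp: step_time_def)
    ultimately show ?thesis
      by (auto simp: step_time_def simp del: replicate.simps intro!: gaps_le_ticks)
  qed
  ultimately show "\<exists>u \<sigma>'. exec search \<sigma> u \<sigma>' \<and> answers u = map enc_assignment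
      (concat (map (\<lambda>(t, xs). leaves xs t) ((t, []) # ns))) \<and>
      gaps_le delay (slack ((t, []) # ns)) u"
    using u(2) by (intro exI conjI) (assumption | simp)+
qed

lemma searches_branch:
  assumes ok: "node_ok (t, x # xs)" and ns: "searches (map (\<lambda>u. (u, xs)) (children x t) @ ns)"
  shows "searches ((t, x # xs) # ns)"
  unfolding searches_def
proof (intro allI impI, elim conjE)
  fix \<sigma> :: store
  assume \<sigma>: "\<sigma> 2 = enc_list (map enc_node ((t, x # xs) # ns))" "\<sigma> 3 = span_tree" "\<sigma> 4 = context_tree"
  let ?ns = "map (\<lambda>u. (u, xs)) (children x t) @ ns"
  let ?env = "[enc_list (map enc_node ((t, x # xs) # ns)), span_tree, context_tree]"
  have live: "val alive [Pair (Pair (enc_var x) (enc_span ij)) (enc_assignment t), context_tree, Nil] =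
      truth (live A s ((x, ij) # t))" for ij
    using val_alive[of "(x, ij) # t" Nil] by simp
  have "bounded alive [Pair (Pair (enc_var x) d) (enc_assignment t), context_tree, Nil] B"
    if d: "d \<in> set (spine span_tree)" for d
  proof -
    obtain ij where "ij \<in> set span_list" "d = enc_span ij"
      using d unfolding span_tree_def by force
    moreover have "partial ((x, ij) # t)" if "ij \<in> set span_list" for ij
      using ok that by (auto simp: node_ok_def partial_def)
    ultimately show ?thesis using bounded_alive[of "(x, ij) # t" Nil] by simp
  qed
  then have "bounded step ?env B"
    using bounded_step[OF span_tree_bound] by (simp add: enc_node_def)
  moreover have "map \<sigma> [2, 3, 4] = ?env" using \<sigma> by simp
  moreover have "r < 5" if "r \<in> set [2, 3, 4]" for r :: nat using that by auto
  ultimately obtain \<sigma>1 where \<sigma>1: "runs (compile step [2, 3, 4] 5) \<sigma> (time step B) \<sigma>1"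
      "\<sigma>1 5 = val step ?env" "\<forall>r<5. \<sigma>1 r = \<sigma> r"
    using compile_correct[of step \<sigma> "[2, 3, 4]" B 5] by metis
  have val_step_env: "val step ?env = enc_list (map enc_node ?ns)"
    by (simp add: enc_node_def val_step span_tree_def filter_map comp_def live children_def
        rev_map[symmetric] split: prod.splits)
  define \<sigma>2 where "\<sigma>2 = \<sigma>1(2 := \<sigma>1 5)"
  obtain u \<sigma>' where u: "exec search \<sigma>2 u \<sigma>'"
      "answers u = map enc_assignment (concat (map (\<lambda>(t, xs). leaves xs t) ?ns))"
      "gaps_le delay (slack ?ns) u"
    using ns[unfolded searches_def, rule_format, of \<sigma>2] \<sigma> \<sigma>1(2,3) val_step_env
    by (auto simp: \<sigma>2_def)
  have assign: "exec (Assign 2 (Var 5)) \<sigma>1 (ticks 2) \<sigma>2"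
    using exec_assign[of 2 "Var 5" \<sigma>1] by (simp add: \<sigma>2_def numeral_2_eq_2)
  obtain k where k: "k \<le> time step B" "exec (compile step [2, 3, 4] 5) \<sigma> (ticks k) \<sigma>1"
    using \<sigma>1(1) by (auto simp: runs_def)
  have "exec (If (Tl (Hd (Var 2))) (Seq (compile step [2, 3, 4] 5) (Assign 2 (Var 5)))
      (Seq (Emit (Hd (Hd (Var 2)))) (Assign 2 (Tl (Var 2))))) \<sigma>
      (ticks (1 + cost (Tl (Hd (Var 2))) \<sigma>) @ ticks k @ ticks 2) \<sigma>2"
    by (rule exec_if_true[OF _ exec_seq[OF k(2) assign]]) (use \<sigma> in \<open>simp add: enc_node_def\<close>)
  then have "exec search \<sigma> (ticks (1 + cost (Var 2) \<sigma>) @ (ticks (1 + cost (Tl (Hd (Var 2))) \<sigma>) @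
      ticks k @ ticks 2) @ u) \<sigma>'"
    unfolding search_def by (intro exec_while_true) (use \<sigma> u(1) in \<open>simp_all add: search_def\<close>)
  moreover have "gaps_le delay (slack ((t, x # xs) # ns)) (ticks (1 + cost (Var 2) \<sigma>) @
      (ticks (1 + cost (Tl (Hd (Var 2))) \<sigma>) @ ticks k @ ticks 2) @ u)"
  proof -
    have "fst ` set t \<subseteq> Vars A" "x \<in> Vars A" "live A s t"
      using ok by (auto simp: node_ok_def)
    \<comment> \<open>A tuple extending \<open>t\<close> supplies a span for \<open>x\<close> and
      hence a live child. The new top has one variable fewer, and the slack released by this pays
      for the current iteration.\<close>
    then obtain \<mu> ij where "\<mu> \<in> spanner A s" "agrees \<mu> ((x, ij) # t)" "ij \<in> set span_list"
      using live_agrees[of t] spanner_span_list[of _ x] by fastforce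
    then have "live A s ((x, ij) # t)"
      using live_agrees[of "(x, ij) # t"] \<open>x \<in> Vars A\<close> \<open>fst ` set t \<subseteq> Vars A\<close> by auto
    then have "children x t \<noteq> []"
      using \<open>ij \<in> set span_list\<close> by (auto simp: children_def filter_empty_conv)
    then have "slack ?ns = (length xs + 2) * step_time"
      by (cases "children x t") auto
    then have "gaps_le delay ((length xs + 2) * step_time) u" using u(3) by simp
    then have "gaps_le delay ((length xs + 2) * step_time + (2 + (4 + (k + 2))))
        (ticks 2 @ ticks 4 @ ticks k @ ticks 2 @ u)"
      by (intro gaps_le_ticks) (auto elim: gaps_le_mono)
    then have "gaps_le delay ((length xs + 3) * step_time) (ticks 2 @ ticks 4 @ ticks k @ ticks 2 @ u)"
      by (rule gaps_le_mono) (use k(1) in \<open>simp_all add: step_time_def algebra_simps\<close>)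
    moreover have "1 + cost (Var 2) \<sigma> = 2" "1 + cost (Tl (Hd (Var 2))) \<sigma> = 4"
      by simp_all
    moreover have "length (x # xs) + 2 = length xs + 3" by simp
    ultimately show ?thesis by (simp only: append_assoc slack.simps)
  qed
  ultimately show "\<exists>u \<sigma>'. exec search \<sigma> u \<sigma>' \<and> answers u = map enc_assignment
      (concat (map (\<lambda>(t, xs). leaves xs t) ((t, x # xs) # ns))) \<and>
      gaps_le delay (slack ((t, x # xs) # ns)) u"
    using u(2) by (intro exI conjI) (assumption | simp add: comp_def)+
qed

lemma node_ok_children:
  assumes "node_ok (t, x # xs)" "u \<in> set (children x t)"
  shows "node_ok (u, xs)"
proof -
  obtain ij where "u = (x, ij) # t" "ij \<in> set span_list" "live A s ((x, ij) # t)"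
    using assms(2) unfolding children_def by auto
  then show ?thesis using assms(1) by (simp add: node_ok_def)
qed

text \<open>Induction on the unassigned variables with the lower part \<open>ns\<close> of the stack
  arbitrary: a branching node is replaced by children with one variable fewer. This also yields
  termination.\<close>

lemma searches_Cons:
  assumes "node_ok (t, xs)" "\<forall>nd\<in>set ns. node_ok nd" "searches ns"
  shows "searches ((t, xs) # ns)"
  using assms
proof (induction xs arbitrary: t ns)
  case Nil
  then show ?case by (intro searches_leaf)
next
  case (Cons x xs)
  \<comment> \<open>The children are placed on \<open>ns\<close> one at a time from the bottom up,
    so the outer hypothesis applies to each new top.\<close>
  have "searches (map (\<lambda>u. (u, xs)) us @ ns) \<and> (\<forall>nd\<in>set (map (\<lambda>u. (u, xs)) us @ ns). node_ok nd)"
    if "set us \<subseteq> set (children x t)" for us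
    using that
  proof (induction us)
    case (Cons u us)
    then show ?case
      using Cons.IH Cons.prems node_ok_children[OF \<open>node_ok (t, x # xs)\<close>, of u]
      by (auto intro!: \<open>\<And>t ns. node_ok (t, xs) \<Longrightarrow> \<forall>nd\<in>set ns. node_ok nd \<Longrightarrow> searches ns \<Longrightarrow> searches ((t, xs) # ns)\<close>)
  qed (use Cons.prems in auto)
  then show ?case
    using Cons.prems by (intro searches_branch) auto
qed

lemma searches_all:
  assumes "\<forall>nd\<in>set ns. node_ok nd"
  shows "searches ns"
  using assms by (induction ns) (auto intro: searches_Nil searches_Cons)

lemma initial_nodes_ok: "\<forall>nd\<in>set initial_nodes. node_ok nd"
proof -
  have "node_ok (t, xs)" if "(t, xs) \<in> set initial_nodes" for t xs
  proof -
    from that have t: "xs = free_vars" "map fst t = rev bound_vars" "snd ` set t \<subseteq> set span_list"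
        "live A s t"
      by (auto simp: set_initial_nodes)
    have "length t + length free_vars = length (rev free_vars @ rev bound_vars)"
      using arg_cong[OF t(2), of length] by simp
    also have "\<dots> = card (Vars A)"
      using distinct_card[OF set_vars(2)] set_vars(1) by (simp add: Un_commute)
    also have "\<dots> = length vs" using distinct_card[OF vs(1)] vs(2) by simp
    finally show ?thesis
      using t bound_vars_occurring(1)[OF t(2)] set_vars(1) by (auto simp: node_ok_def)
  qed
  then show ?thesis by auto
qed

text \<open>The whole precomputation falls into the gap before the first answer; 20 covers the 11
  units spent on unpacking its result.\<close>

lemma enumerates_enumerator:
  "enumerates enumerator (input dQ) (tuple_code vc) (select_eq S A s)
    (time initialize B + 20 + delay)"
proof -
  define \<sigma> :: store where "\<sigma> = (\<lambda>_. Nil)(0 := input dQ)"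
  have "bounded initialize (map \<sigma> [0]) B" using bounded_initialize by (simp add: \<sigma>_def)
  then obtain \<sigma>1 where \<sigma>1: "runs (compile initialize [0] 1) \<sigma> (time initialize B) \<sigma>1"
      "\<sigma>1 1 = Pair (enc_list (map enc_node initial_nodes)) (Pair span_tree context_tree)"
    using compile_correct[of initialize \<sigma> "[0]" B 1] by (auto simp: \<sigma>_def val_initialize)
  obtain k where k: "k \<le> time initialize B" "exec (compile initialize [0] 1) \<sigma> (ticks k) \<sigma>1"
    using \<sigma>1(1) by (auto simp: runs_def)
  define \<sigma>2 where "\<sigma>2 = \<sigma>1(2 := enc_list (map enc_node initial_nodes))"
  define \<sigma>3 where "\<sigma>3 = \<sigma>2(3 := span_tree)"
  define \<sigma>4 where "\<sigma>4 = \<sigma>3(4 := context_tree)"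
  have 2: "exec (Assign 2 (Hd (Var 1))) \<sigma>1 (ticks 3) \<sigma>2"
    using exec_assign[of 2 "Hd (Var 1)" \<sigma>1] \<sigma>1(2) by (simp add: \<sigma>2_def numeral_3_eq_3)
  have 3: "exec (Assign 3 (Hd (Tl (Var 1)))) \<sigma>2 (ticks 4) \<sigma>3"
    using exec_assign[of 3 "Hd (Tl (Var 1))" \<sigma>2] \<sigma>1(2) by (simp add: \<sigma>3_def \<sigma>2_def eval_nat_numeral)
  have 4: "exec (Assign 4 (Tl (Tl (Var 1)))) \<sigma>3 (ticks 4) \<sigma>4"
    using exec_assign[of 4 "Tl (Tl (Var 1))" \<sigma>3] \<sigma>1(2)
    by (simp add: \<sigma>4_def \<sigma>3_def \<sigma>2_def eval_nat_numeral)
  obtain u \<sigma>' where u: "exec search \<sigma>4 u \<sigma>'" "answers u = map enc_assignment all_leaves"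
      "gaps_le delay (slack initial_nodes) u"
    using searches_all[OF initial_nodes_ok, unfolded searches_def, rule_format, of \<sigma>4]
    by (auto simp: \<sigma>4_def \<sigma>3_def \<sigma>2_def all_leaves_def)
  let ?t = "ticks k @ ticks 3 @ ticks 4 @ ticks 4 @ u"
  have "exec enumerator \<sigma> ?t \<sigma>'"
    unfolding enumerator_def by (intro exec_seq[OF k(2)] exec_seq[OF 2] exec_seq[OF 3] exec_seq[OF 4] u(1))
  moreover have "answers ?t = map enc_assignment all_leaves" using u(2) by simp
  moreover have "gaps_le (time initialize B + 20 + delay) (time initialize B + 20 + delay) ?t"
    using k(1) slack_delay[OF initial_nodes_ok]
    by (intro gaps_le_ticks gaps_le_mono[OF u(3)]) auto
  ultimately show ?thesis
    unfolding enumerates_def \<sigma>_def using all_leaves_select delay_le_gaps by metis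
qed

end

section \<open>The bound as a polynomial in the size of the input\<close>

lemma size_mem_enc_list: "x \<in> set xs \<Longrightarrow> size x < size (enc_list xs)"
  by (induction xs) auto

lemma length_le_size_enc_list: "length xs \<le> size (enc_list xs)"
  by (induction xs) auto

theorem theorem5p4:
  fixes lc :: "'a::finite \<Rightarrow> nat" and vc :: "'v \<Rightarrow> nat" and m :: nat
  assumes "card (UNIV :: 'a set) \<ge> 2" and "infinite (UNIV :: 'v set)"
    and "inj lc" and "inj vc" and "m \<ge> 1"
  shows "\<exists>(c :: com) (p :: nat poly).
    \<forall>(A :: ('a, 'v, nat) automaton) (S :: ('v \<times> 'v) list) (s :: 'a list) (d :: tree).
      vset_automaton A \<and> functional A \<and> length S = m \<and> set S \<subseteq> Vars A \<times> Vars A \<and>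
      input_code lc vc d A S s \<longrightarrow>
      enumerates c d (tuple_code vc) (select_eq S A s) (poly p (size d))"
proof -
  \<comment> \<open>The sum meets both requirements that \<open>sized_problem\<close> puts on
    \<open>B\<close>, for \<open>K = Suc N\<close> and \<open>m\<close> selections. Its degree
    depends on \<open>m\<close> only.\<close>
  define B where "B = (\<lambda>N. 20 * (Suc N * Suc N) + (Suc N * Suc N) ^ (2 * m))"
  define T where "T = (\<lambda>N. time initialize (B N) + 20 + (Suc N + 3) * (time step (B N) + B N + 20))"
  have "poly_bounded (\<lambda>N. 20 * ((N + 1) * (N + 1)) + ((N + 1) * (N + 1)) ^ (2 * m))"
    by (intro poly_bounded_add poly_bounded_mult poly_bounded_power poly_bounded_id poly_bounded_const)
  then have B: "poly_bounded (\<lambda>N. B N)" by (simp add: B_def)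
  have "poly_bounded (\<lambda>N. time initialize (B N) + 20 + (4 + N) * (time step (B N) + B N + 20))"
    by (intro poly_bounded_add poly_bounded_mult poly_bounded_id poly_bounded_const B
        poly_bounded_compose[OF poly_bounded_time B])
  then have "poly_bounded T" by (simp add: T_def)
  then obtain p where p: "\<And>N. T N \<le> poly p N" unfolding poly_bounded_def by blast
  have "enumerates enumerator d (tuple_code vc) (select_eq S A s) (poly p (size d))"
    if A: "vset_automaton A" "functional A" "length S = m" "set S \<subseteq> Vars A \<times> Vars A"
      "input_code lc vc d A S s"
    for A :: "('a, 'v, nat) automaton" and S s d
  proof -
    obtain vs dQ ts where vs: "distinct vs" "set vs = Vars A" and ts: "set ts = transitions A"
      and d: "d = enc_list [enc_list [enc_list (map (\<lambda>x. enc_nat (vc x)) vs), dQ, enc_nat (init A),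
          enc_nat (final A), enc_list (map (\<lambda>(p, l, q). Pair (enc_nat p)
            (Pair (enc_label lc vc l) (enc_nat q))) ts)],
        enc_list (map (\<lambda>(x, y). Pair (enc_nat (vc x)) (enc_nat (vc y))) S),
        enc_list (map (\<lambda>a. enc_nat (lc a)) s)]"
      using A(5) unfolding input_code_def automaton_code_def set_code_def by blast
    interpret problem lc vc A S s vs ts
      by unfold_locales (use assms A vs ts in auto)
    have input: "d = input dQ"
      by (simp add: d input_def arrows_def equalities_def enc_var_def[abs_def]
          enc_transition_def enc_eq_def)
    have size: "size (enc_list (map enc_var vs)) \<le> size d" "size arrows \<le> size d"
        "size equalities \<le> size d" "size (enc_list (map (\<lambda>a. enc_nat (lc a)) s)) \<le> size d"
        "size (enc_nat (init A)) \<le> size d" "size (enc_nat (final A)) \<le> size d"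
      by (simp_all add: input input_def)
    \<comment> \<open>The parts of the input are subtrees of \<open>d\<close>; the successor leaves
      room for the position behind the last symbol.\<close>
    interpret sized_problem lc vc A S s vs ts "Suc (size d)" "B (size d)"
    proof unfold_locales
      show "size (enc_var x) \<le> Suc (size d)" if "x \<in> Vars A" for x
        using size_mem_enc_list[of "enc_var x" "map enc_var vs"] that vs size(1) by simp
      show "length vs \<le> Suc (size d)"
        using length_le_size_enc_list[of "map enc_var vs"] size(1) by simp
      show "length ts \<le> Suc (size d)"
        using length_le_size_enc_list[of "map enc_transition ts"] size(2) by (simp add: arrows_def)
      show "size (enc_transition tr) \<le> Suc (size d)" if "tr \<in> set ts" for tr
        using size_mem_enc_list[of "enc_transition tr" "map enc_transition ts"] that size(2)
        by (simp add: arrows_def)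
      show "length S \<le> Suc (size d)"
        using length_le_size_enc_list[of "map enc_eq S"] size(3) by (simp add: equalities_def)
      show "length s < Suc (size d)"
        using length_le_size_enc_list[of "map (\<lambda>a. enc_nat (lc a)) s"] size(4) by simp
      show "size (enc_nat (lc a)) \<le> Suc (size d)" if "a \<in> set s" for a
        using size_mem_enc_list[of "enc_nat (lc a)" "map (\<lambda>a. enc_nat (lc a)) s"] that size(4) by simp
    qed (use size A(3) in \<open>simp_all add: B_def\<close>)
    have "time initialize (B (size d)) + 20 + delay = T (size d)"
      by (simp add: T_def delay_def step_time_def)
    then have "enumerates enumerator d (tuple_code vc) (select_eq S A s) (T (size d))"
      using enumerates_enumerator[of dQ] by (simp add: input)
    then show ?thesis
      using p[of "size d"] unfolding enumerates_def delay_le_def by (meson order_trans)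
  qed
  then show ?thesis by blast
qed

end
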